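(* Let $B:=2K_3$ be the pattern on $6$ vertices (without loops) that is the disjoint union of two triangles. Then $\lambda_{4,2}=1/2$, the $(4,2)$-edge-inducibility problem is perfectly $B$-stable, and the unique maximizer of $\lambda_{4,2}(B(\mathbf{a}))$ over $\mathbf{a}\in\mathbb{S}_6$ is $\mathbf{a}=(1/6,\ldots,1/6)$.
   Context: Graphs are finite and simple. $[m]:=\{0,\dots,m-1\}$, and $ij$ abbreviates the unordered pair $\{i,j\}$ (with $ii$ denoting a loop at $i$). Edge-inducibility: for non-negative integers $\kappa,\ell$ and a graph $G$ with $n\ge\kappa$ vertices, $\lambda_{\kappa,\ell}(G)$ is the number of $\kappa$-subsets of $V(G)$ that span exactly $\ell$ edges of $G$, divided by $\binom{n}{\kappa}$. Further, $\lambda_{\kappa,\ell}(n):=\max\{\lambda_{\kappa,\ell}(G): G \text{ is an } n\text{-vertex graph}\}$ and $\lambda_{\kappa,\ell}:=\lim_{n\to\infty}\lambda_{\kappa,\ell}(n)$ (the limit exists). A pattern $B$ is a graph in which loops on some vertices are additionally allowed (no multiple edges). A pattern automorphism is a bijection $f:V(B)\to V(B)$ such that for all $u,w\in V(B)$ (including $u=w$) $\{u,w\}\in E(B)$ iff $\{f(u),f(w)\}\in E(B)$. For a pattern $B$ with vertex set $[m]$ and pairwise disjoint finite sets $V_0,\dots,V_{m-1}$ (some possibly empty), the blowup $B(V_0,\dots,V_{m-1})$ is the (loopless) graph on $V_0\cup\dots\cup V_{m-1}$ in which distinct $x\in V_i$, $y\in V_j$ are adjacent iff $\{i,j\}\in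 E(B)$ (so $V_i$ is a clique if $i$ has a loop, and an independent set otherwise). $B()$ denotes the family of all blowups of $B$. $\mathbb{S}_m:=\{(x_0,\dots,x_{m-1})\in\mathbb{R}^m: x_0+\dots+x_{m-1}=1,\ x_i\ge 0 \text{ for all } i\}$. For $\mathbf{x}\in\mathbb{S}_m$, $\lambda_{\kappa,\ell}(B(\mathbf{x}))$ is the limit as $n\to\infty$ of $\lambda_{\kappa,\ell}(B(V_0,\dots,V_{m-1}))$ where $|V_i|=(x_i+o(1))n$ for each $i\in[m]$. A maximizer is an $\mathbf{x}\in\mathbb{S}_m$ at which this function attains its maximum over $\mathbb{S}_m$. The edit distance $\delta_{\mathrm{edit}}(G,H)$ between graphs of the same order is the minimum of $|E(G)\bigtriangleup f(E(H))|$ over bijections $f:V(H)\to V(G)$, and $\delta_{\mathrm{edit}}(G,B())$ is the minimum of $\delta_{\mathrm{edit}}(G,H)$ over $H\in B()$ with the same number of vertices as $G$. The $(\kappa,\ell)$-problem is perfectly $B$-stable if there is $C>0$ such that every graph $G$ of order $n\ge C$ satisfies $\delta_{\mathrm{edit}}(G,B())\le C\,(\lambda_{\kappa,\ell}(n)-\lambda_{\kappa,\ell}(G))\,n^2$. *)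

theory Defs
  imports "HOL-Analysis.Analysis"
begin

text \<open>
  A graph or pattern is a pair of a vertex set and an edge set, the edges being unordered
  pairs of vertices. The pair \<open>{i, i} = {i}\<close> is a loop at \<open>i\<close>, which only patterns may have.
\<close>

type_synonym 'a graph = "'a set \<times> 'a set set"

abbreviation verts :: "'a graph \<Rightarrow> 'a set" where "verts \<equiv> fst"
abbreviation edges :: "'a graph \<Rightarrow> 'a set set" where "edges \<equiv> snd"

definition simple_graph :: "'a graph \<Rightarrow> bool" where
  "simple_graph G \<longleftrightarrow> finite (verts G) \<and> (\<forall>e\<in>edges G. e \<subseteq> verts G \<and> card e = 2)"

definition pattern :: "'a graph \<Rightarrow> bool" where
  "pattern B \<longleftrightarrow> finite (verts B) \<and> (\<forall>e\<in>edges B. e \<subseteq> verts B \<and> (card e = 1 \<or> card e = 2))"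

text \<open>The density of \<open>G\<close> is only meaningful for \<open>\<kappa> \<le> card (verts G)\<close>; otherwise it is \<open>0\<close>.\<close>

definition ind_density :: "nat \<Rightarrow> nat \<Rightarrow> 'a graph \<Rightarrow> real" where
  "ind_density \<kappa> l G =
     real (card {S. S \<subseteq> verts G \<and> card S = \<kappa> \<and> card {e \<in> edges G. e \<subseteq> S} = l})
       / real (card (verts G) choose \<kappa>)"

text \<open>
  From here on, ``all graphs'' means all graphs with vertices in \<^typ>\<open>nat\<close>; every finite graph is
  isomorphic to one of these. The set under \<^const>\<open>Max\<close> is finite, since \<^const>\<open>ind_density\<close> takes
  only finitely many values on graphs of a given order.
\<close>

definition max_ind_density :: "nat \<Rightarrow> nat \<Rightarrow> nat \<Rightarrow> real" where
  "max_ind_density \<kappa> l n =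
     Max {ind_density \<kappa> l G | G :: nat graph. simple_graph G \<and> card (verts G) = n}"

definition edge_inducibility :: "nat \<Rightarrow> nat \<Rightarrow> real" where
  "edge_inducibility \<kappa> l = lim (max_ind_density \<kappa> l)"

definition valid_parts :: "'b graph \<Rightarrow> ('b \<Rightarrow> 'a set) \<Rightarrow> bool" where
  "valid_parts B V \<longleftrightarrow> (\<forall>i\<in>verts B. finite (V i)) \<and> disjoint_family_on V (verts B)"

definition blowup :: "'b graph \<Rightarrow> ('b \<Rightarrow> 'a set) \<Rightarrow> 'a graph" where
  "blowup B V =
     (\<Union>i\<in>verts B. V i,
      {{x, y} | x y i j. i \<in> verts B \<and> j \<in> verts B \<and> x \<in> V i \<and> y \<in> V j \<and> x \<noteq> y \<and> {i, j} \<in> edges B})"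

definition blowups :: "'b graph \<Rightarrow> 'a graph set" where
  "blowups B = {blowup B V | V. valid_parts B V}"

text \<open>The infima below are over sets of natural numbers, hence minima whenever these are nonempty.\<close>

definition edit_distance :: "'a graph \<Rightarrow> 'b graph \<Rightarrow> nat" where
  "edit_distance G H =
     Inf {card (sym_diff (edges G) ((`) f ` edges H)) | f. bij_betw f (verts H) (verts G)}"

definition edit_distance_blowups :: "nat graph \<Rightarrow> 'b graph \<Rightarrow> nat" where
  "edit_distance_blowups G B =
     Inf {edit_distance G H | H :: nat graph. H \<in> blowups B \<and> card (verts H) = card (verts G)}"

definition perfectly_stable :: "nat \<Rightarrow> nat \<Rightarrow> 'b graph \<Rightarrow> bool" where
  "perfectly_stable \<kappa> l B \<longleftrightarrow>
     (\<exists>C>0. \<forall>G :: nat graph. simple_graph G \<and> real (card (verts G)) \<ge> C \<longrightarrow>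
        real (edit_distance_blowups G B)
          \<le> C * (max_ind_density \<kappa> l (card (verts G)) - ind_density \<kappa> l G) * real (card (verts G)) ^ 2)"

text \<open>
  Vectors in \<open>\<real>\<^sup>m\<close> are functions on \<^typ>\<open>nat\<close> that vanish outside \<open>{..<m}\<close>, so that
  each vector has exactly one representation.
\<close>

definition std_simplex :: "nat \<Rightarrow> (nat \<Rightarrow> real) set" where
  "std_simplex m = {x. (\<Sum>i<m. x i) = 1 \<and> (\<forall>i<m. x i \<ge> 0) \<and> (\<forall>i\<ge>m. x i = 0)}"

text \<open>
  The limit is required to be the same for every sequence of blowups whose part sizes are
  \<open>(x\<^sub>i + o(1)) n\<close>.
\<close>

definition blowup_density :: "nat \<Rightarrow> nat \<Rightarrow> nat graph \<Rightarrow> (nat \<Rightarrow> real) \<Rightarrow> real" where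
  "blowup_density \<kappa> l B x =
     (THE L. \<forall>V :: nat \<Rightarrow> nat \<Rightarrow> nat set.
        (\<forall>n. valid_parts B (V n)) \<and>
        (\<forall>i\<in>verts B. (\<lambda>n. real (card (V n i)) / real n) \<longlonglongrightarrow> x i) \<longrightarrow>
        (\<lambda>n. ind_density \<kappa> l (blowup B (V n))) \<longlonglongrightarrow> L)"

text \<open>Intended for patterns with vertex set \<open>{..<m}\<close>.\<close>

definition maximizers :: "nat \<Rightarrow> nat \<Rightarrow> nat graph \<Rightarrow> (nat \<Rightarrow> real) set" where
  "maximizers \<kappa> l B =
     {x \<in> std_simplex (card (verts B)).
        \<forall>y \<in> std_simplex (card (verts B)). blowup_density \<kappa> l B y \<le> blowup_density \<kappa> l B x}"

definition two_K3 :: "nat graph" where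
  "two_K3 = ({..<6}, {{0,1}, {0,2}, {1,2}, {3,4}, {3,5}, {4,5}})"

lemma pattern_two_K3: "pattern two_K3" and simple_graph_two_K3: "simple_graph two_K3"
  by (auto simp: pattern_def simple_graph_def two_K3_def)

lemma simple_graph_blowup:
  assumes "pattern B" "valid_parts B V"
  shows "simple_graph (blowup B V)"
  using assms by (auto simp: simple_graph_def pattern_def blowup_def valid_parts_def)

end

theory Submission
  imports Defs "HOL-Combinatorics.Multiset_Permutations" "HOL-Real_Asymp.Real_Asymp"
begin

text \<open>
  The bound rests on a flag-algebra certificate that is exact for every weighting of the vertices
  of a finite graph: with sums of squares over a fixed triple of vertices, the density of
  four-tuples with two edges is at most \<open>1/2\<close>, and the deficit bounds both the density of
  five-tuples that do not embed into a blowup of \<open>2K\<^sub>3\<close> and the variance of the degrees. Moving some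
  weight to a single vertex turns this into information about every vertex whose own density
  is close to \<open>1/2\<close>. The adjacencies to a suitable induced \<open>2K\<^sub>2\<close> then split the graph into six parts
  with few wrong pairs, and the degrees force the parts to be balanced.

  For perfect stability, let \<open>G*\<close> maximise, over all graphs on the vertex set of \<open>G\<close>, the number of
  four-sets with two edges minus \<open>c n\<^sup>2\<close> times the number of edges in which it differs from \<open>G\<close>.
  If \<open>G*\<close> were not a blowup, then it could be improved by passing to a balanced blowup, by
  replacing a vertex in few four-sets by a clone of another vertex, or by flipping one wrong pair.
\<close>

section \<open>The certificate\<close>

text \<open>Linear stability needs a gain of order n^2 per edited pair, and the three moves are
  matched to this: a balanced blowup gains order n^4 for at most n^2 edits, a clone order n^3 for at
  most n edits, a corrected pair order n^2 for one edit. Density alone does not control single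
  vertices; once no clone move helps, every vertex has density close to 1/2, which is what the
  rooted estimates need. Five-tuples alone cannot see the sizes of the parts, because every blowup
  of 2K_3 avoids the forbidden ones; the degree term of the certificate provides the balance and, at
  deficit 0, the uniqueness of the maximizer. Averages run over tuples with repetitions, so that no
  lower-order error enters before the passage to four-sets, and one inequality serves the uniform,
  the tilted and the pattern weights. The tiny constants are the price of square roots: a deficit
  eps yields rooted forbidden density of order sqrt eps and degree errors of order eps^(1/4), and
  each bounded product of two masses costs one more root.\<close>

definition two_edges :: "('v \<Rightarrow> 'v \<Rightarrow> bool) \<Rightarrow> 'v \<Rightarrow> 'v \<Rightarrow> 'v \<Rightarrow> 'v \<Rightarrow> bool" where
  "two_edges a x y z w \<longleftrightarrow>
     of_bool (a x y) + of_bool (a x z) + of_bool (a x w) + of_bool (a y z) + of_bool (a y w) + of_bool (a z w)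
       = (2 :: nat)"

text \<open>
  The disjuncts describe \<open>P\<^sub>4\<close> or the paw (depending on \<open>a x r\<close>), \<open>K\<^sub>4\<close>, and \<open>2K\<^sub>2\<close> plus an isolated vertex:
  the minimal graphs that are not blowups of \<open>2K\<^sub>3\<close>. For symmetric irreflexive \<open>a\<close>
  the vertices involved are automatically distinct.
\<close>

definition forbidden :: "('v \<Rightarrow> 'v \<Rightarrow> bool) \<Rightarrow> 'v set \<Rightarrow> bool" where
  "forbidden a X \<longleftrightarrow>
     (\<exists>x\<in>X. \<exists>p\<in>X. a x p \<and> (\<exists>q\<in>X. a x q \<and> \<not> a p q \<and> (\<exists>r\<in>X. a p r \<and> \<not> a q r))) \<or>
     (\<exists>x\<in>X. \<exists>p\<in>X. a x p \<and> (\<exists>q\<in>X. a x q \<and> a p q \<and> (\<exists>r\<in>X. a x r \<and> a p r \<and> a q r))) \<or>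
     (\<exists>x\<in>X. \<exists>p\<in>X. \<not> a x p \<and> (\<exists>q\<in>X. a p q \<and> \<not> a x q \<and>
        (\<exists>r\<in>X. \<not> a x r \<and> \<not> a p r \<and> \<not> a q r \<and>
        (\<exists>s\<in>X. a r s \<and> \<not> a x s \<and> \<not> a p s \<and> \<not> a q s))))"

text \<open>
  \<open>vec0\<close>, \<open>vec1\<close>, \<open>vec2\<close> encode how a further vertex is attached to a triple that spans no edge, one edge
  (the first vertex being isolated), or a path (the first vertex being its centre). They
  have average \<open>0\<close> in the balanced blowup of \<open>2K\<^sub>3\<close>. The forms are rounded solutions of the
  semidefinite program.
\<close>

fun vec0 :: "bool \<Rightarrow> bool \<Rightarrow> bool \<Rightarrow> int \<times> int" where
  "vec0 False False False = (-1, 0)"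
| "vec0 True True True = (2, 0)"
| "vec0 True False False = (0, 1)"
| "vec0 False True False = (0, 1)"
| "vec0 False False True = (0, 1)"
| "vec0 _ _ _ = (1, -1)"

fun vec1 :: "bool \<Rightarrow> bool \<Rightarrow> bool \<Rightarrow> int \<times> int \<times> int" where
  "vec1 False False False = (0, -2, 0)"
| "vec1 False True False = (1, 1, 1)"
| "vec1 False False True = (1, 1, 1)"
| "vec1 False True True = (-2, 0, 0)"
| "vec1 True False False = (0, 0, -1)"
| "vec1 True _ _ = (0, 0, 0)"

fun vec2 :: "bool \<Rightarrow> bool \<Rightarrow> bool \<Rightarrow> int \<times> int \<times> int" where
  "vec2 True False False = (1, 1, 3)"
| "vec2 False True True = (-1, 0, 0)"
| "vec2 True True True = (0, -1, 0)"
| "vec2 False False False = (0, 0, -1)"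
| "vec2 _ _ _ = (0, 0, 0)"

fun form0 :: "('r::comm_ring_1) \<times> 'r \<Rightarrow> 'r \<times> 'r \<Rightarrow> 'r" where
  "form0 (x, y) (x', y') = 864 * x * x' + 1024 * (x * y' + y * x') + 1280 * y * y'"

fun form1 :: "('r::comm_ring_1) \<times> 'r \<times> 'r \<Rightarrow> 'r \<times> 'r \<times> 'r \<Rightarrow> 'r" where
  "form1 (x, y, z) (x', y', z') = 1074 * x * x' + 3804 * y * y' + 9600 * z * z'
     + 843 * (x * y' + y * x') - 2670 * (x * z' + z * x') - 5112 * (y * z' + z * y')"

fun form2 :: "('r::comm_ring_1) \<times> 'r \<times> 'r \<Rightarrow> 'r \<times> 'r \<times> 'r \<Rightarrow> 'r" where
  "form2 (x, y, z) (x', y', z') = 18144 * x * x' + 4608 * y * y' + 3456 * z * z'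
     + 3204 * (x * y' + y * x') - 5280 * (x * z' + z * x') - 3360 * (y * z' + z * y')"

text \<open>Completing the square one variable at a time; the coefficients of the squares are the
  pivots of the Gram matrix. The other two forms are treated alike.\<close>

lemma form0_nonneg: "form0 v v \<ge> (0::real)"
proof (cases v)
  case (Pair x y)
  have "form0 v v = 864 * (x + 32/27 * y)^2 + 1792/27 * y^2"
    by (simp add: Pair power2_eq_square algebra_simps)
  then show ?thesis by simp
qed

lemma form1_nonneg: "form1 v v \<ge> (0::real)"
proof (cases v)
  case (fields x y z)
  have "form1 v v = 1074 * (x + 281/358 * y - 445/179 * z)^2
      + 1124949/358 * (y - 359942/374983 * z)^2 + 25124976/374983 * z^2"
    by (simp add: fields power2_eq_square algebra_simps)
  then show ?thesis by simp
qed

lemma form2_nonneg: "form2 v v \<ge> (0::real)"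
proof (cases v)
  case (fields x y z)
  have "form2 v v = 18144 * (x + 89/504 * y - 55/189 * z)^2
      + 56591/14 * (y - 101960/169773 * z)^2 + 26119296/56591 * z^2"
    by (simp add: fields power2_eq_square algebra_simps)
  then show ?thesis by simp
qed

datatype idx = I0 | I1 | I2 | I3 | I4

text \<open>
  In units of \<open>1/2160\<close>, this is \<open>1/2\<close> minus the indicator of two edges among \<open>b, c, x, y\<close>, minus the terms whose
  averages over \<open>x\<close> and \<open>y\<close> are nonnegative (by the sum-of-squares lemmas above).
\<close>

fun cert :: "('i \<Rightarrow> 'i \<Rightarrow> bool) \<Rightarrow> 'i \<times> 'i \<times> 'i \<times> 'i \<times> 'i \<Rightarrow> int" where
  "cert e (a, b, c, x, y) =
     1080 - 216 * (if e a x then 2 else -1) * (if e a y then 2 else -1)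
     - (if two_edges e b c x y then 2160 else 0)
     - (if e a b then
          if e a c \<and> \<not> e b c then form2 (vec2 (e a x) (e b x) (e c x)) (vec2 (e a y) (e b y) (e c y)) else 0
        else if e a c then 0
        else if e b c then form1 (vec1 (e a x) (e b x) (e c x)) (vec1 (e a y) (e b y) (e c y))
        else form0 (vec0 (e a x) (e b x) (e c x)) (vec0 (e a y) (e b y) (e c y)))"

text \<open>
  All choices of the pair \<open>{x, y}\<close> and of the first vertex of the triple; \<open>cert\<close> is symmetric otherwise.
\<close>

definition perms30 :: "(idx \<times> idx \<times> idx \<times> idx \<times> idx) list" where
  "perms30 =
    [(I0, I1, I2, I3, I4), (I1, I2, I0, I3, I4), (I2, I0, I1, I3, I4), (I0, I1, I3, I2, I4), (I1, I3, I0, I2, I4),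
     (I3, I0, I1, I2, I4), (I0, I1, I4, I2, I3), (I1, I4, I0, I2, I3), (I4, I0, I1, I2, I3), (I0, I2, I3, I1, I4),
     (I2, I3, I0, I1, I4), (I3, I0, I2, I1, I4), (I0, I2, I4, I1, I3), (I2, I4, I0, I1, I3), (I4, I0, I2, I1, I3),
     (I0, I3, I4, I1, I2), (I3, I4, I0, I1, I2), (I4, I0, I3, I1, I2), (I1, I2, I3, I0, I4), (I2, I3, I1, I0, I4),
     (I3, I1, I2, I0, I4), (I1, I2, I4, I0, I3), (I2, I4, I1, I0, I3), (I4, I1, I2, I0, I3), (I1, I3, I4, I0, I2),
     (I3, I4, I1, I0, I2), (I4, I1, I3, I0, I2), (I2, I3, I4, I0, I1), (I3, I4, I2, I0, I1), (I4, I2, I3, I0, I1)]"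

text \<open>Every symmetric irreflexive relation on \<open>idx\<close> has this form, so ten
  booleans exhaust all cases and the certificate becomes a finite evaluation.\<close>

definition table :: "bool \<Rightarrow> bool \<Rightarrow> bool \<Rightarrow> bool \<Rightarrow> bool \<Rightarrow> bool \<Rightarrow> bool \<Rightarrow> bool \<Rightarrow> bool \<Rightarrow> bool \<Rightarrow> idx \<Rightarrow> idx \<Rightarrow> bool" where
  "table b01 b02 b03 b04 b12 b13 b14 b23 b24 b34 i j = (case i of
      I0 \<Rightarrow> (case j of I0 \<Rightarrow> False | I1 \<Rightarrow> b01 | I2 \<Rightarrow> b02 | I3 \<Rightarrow> b03 | I4 \<Rightarrow> b04)
    | I1 \<Rightarrow> (case j of I0 \<Rightarrow> b01 | I1 \<Rightarrow> False | I2 \<Rightarrow> b12 | I3 \<Rightarrow> b13 | I4 \<Rightarrow> b14)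
    | I2 \<Rightarrow> (case j of I0 \<Rightarrow> b02 | I1 \<Rightarrow> b12 | I2 \<Rightarrow> False | I3 \<Rightarrow> b23 | I4 \<Rightarrow> b24)
    | I3 \<Rightarrow> (case j of I0 \<Rightarrow> b03 | I1 \<Rightarrow> b13 | I2 \<Rightarrow> b23 | I3 \<Rightarrow> False | I4 \<Rightarrow> b34)
    | I4 \<Rightarrow> (case j of I0 \<Rightarrow> b04 | I1 \<Rightarrow> b14 | I2 \<Rightarrow> b24 | I3 \<Rightarrow> b34 | I4 \<Rightarrow> False))"

text \<open>The value 0 is unavoidable for five-vertex graphs that occur in the balanced blowup,
  where the deficit vanishes in the limit; every forbidden one leaves at least 108 units.\<close>

definition cert_ok :: "(idx \<Rightarrow> idx \<Rightarrow> bool) \<Rightarrow> bool" where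
  "cert_ok e \<longleftrightarrow> (let r = sum_list (map (cert e) perms30) in
     108 \<le> r \<or> (r = 0 \<and> \<not> forbidden e (set [I0, I1, I2, I3, I4])))"

lemma cert_ok_table:
  "\<forall>b01 b02 b03 b04 b12 b13 b14 b23 b24 b34. cert_ok (table b01 b02 b03 b04 b12 b13 b14 b23 b24 b34)"
  by code_simp

section \<open>Averages with vertex weights\<close>

definition avg :: "'v set \<Rightarrow> ('v \<Rightarrow> real) \<Rightarrow> ('v \<Rightarrow> real) \<Rightarrow> real" where
  "avg V w f = (\<Sum>x\<in>V. w x * f x)"

lemma avg_add: "avg V w (\<lambda>x. f x + g x) = avg V w f + avg V w g"
  by (simp add: avg_def algebra_simps sum.distrib)

lemma avg_diff: "avg V w (\<lambda>x. f x - g x) = avg V w f - avg V w g"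
  by (simp add: avg_def algebra_simps sum_subtractf)

lemma avg_cmult: "avg V w (\<lambda>x. c * f x) = c * avg V w f"
  unfolding avg_def sum_distrib_left by (simp add: mult_ac)

lemma avg_multc: "avg V w (\<lambda>x. f x * c) = avg V w f * c"
  unfolding avg_def sum_distrib_right by (simp add: mult_ac)

lemmas avg_linear = avg_add avg_diff avg_cmult avg_multc

lemma avg_mono: "(\<And>x. x \<in> V \<Longrightarrow> 0 \<le> w x) \<Longrightarrow> (\<And>x. x \<in> V \<Longrightarrow> f x \<le> g x) \<Longrightarrow> avg V w f \<le> avg V w g"
  by (auto simp: avg_def intro!: sum_mono mult_left_mono)

lemma avg_nonneg: "(\<And>x. x \<in> V \<Longrightarrow> 0 \<le> w x) \<Longrightarrow> (\<And>x. x \<in> V \<Longrightarrow> 0 \<le> f x) \<Longrightarrow> 0 \<le> avg V w f"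
  by (auto simp: avg_def intro!: sum_nonneg mult_nonneg_nonneg)

lemma avg_const: "sum w V = 1 \<Longrightarrow> avg V w (\<lambda>x. c) = c"
  by (simp add: avg_def flip: sum_distrib_right)

lemma avg_cong: "(\<And>x. x \<in> V \<Longrightarrow> f x = g x) \<Longrightarrow> avg V w f = avg V w g"
  by (auto simp: avg_def)

lemma avg_sum: "avg V w (\<lambda>x. \<Sum>i\<in>I. f i x) = (\<Sum>i\<in>I. avg V w (f i))"
  by (simp add: avg_def sum_distrib_left) (subst sum.swap, simp)

lemma of_int_form0: "of_int (form0 v v') = form0 (real_of_int (fst v), real_of_int (snd v)) (real_of_int (fst v'), real_of_int (snd v'))"
  by (cases v; cases v') simp

lemma of_int_form1: "of_int (form1 v v') = form1 (real_of_int (fst v), real_of_int (fst (snd v)), real_of_int (snd (snd v)))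
    (real_of_int (fst v'), real_of_int (fst (snd v')), real_of_int (snd (snd v')))"
  by (cases v; cases v') simp

lemma of_int_form2: "of_int (form2 v v') = form2 (real_of_int (fst v), real_of_int (fst (snd v)), real_of_int (snd (snd v)))
    (real_of_int (fst v'), real_of_int (fst (snd v')), real_of_int (snd (snd v')))"
  by (cases v; cases v') simp

text \<open>By bilinearity the double average is the form evaluated twice at the same mean vector.
  This is where the two last vertices have to be drawn independently over a fixed triple.\<close>

lemma avg_form0: "0 \<le> avg V w (\<lambda>x. avg V w (\<lambda>y. real_of_int (form0 (v x) (v y))))"
proof -
  let ?a = "\<lambda>f. avg V w (\<lambda>x. real_of_int (f (v x)))"
  have "avg V w (\<lambda>x. avg V w (\<lambda>y. real_of_int (form0 (v x) (v y)))) = form0 (?a fst, ?a snd) (?a fst, ?a snd)"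
    unfolding of_int_form0 form0.simps avg_linear by (simp add: avg_linear algebra_simps)
  then show ?thesis by (simp only: form0_nonneg)
qed

lemma avg_form1: "0 \<le> avg V w (\<lambda>x. avg V w (\<lambda>y. real_of_int (form1 (v x) (v y))))"
proof -
  let ?a = "\<lambda>f. avg V w (\<lambda>x. real_of_int (f (v x)))"
  let ?u = "(?a fst, ?a (\<lambda>v. fst (snd v)), ?a (\<lambda>v. snd (snd v)))"
  have "avg V w (\<lambda>x. avg V w (\<lambda>y. real_of_int (form1 (v x) (v y)))) = form1 ?u ?u"
    unfolding of_int_form1 form1.simps avg_linear by (simp add: avg_linear algebra_simps)
  then show ?thesis by (simp only: form1_nonneg)
qed

lemma avg_form2: "0 \<le> avg V w (\<lambda>x. avg V w (\<lambda>y. real_of_int (form2 (v x) (v y))))"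
proof -
  let ?a = "\<lambda>f. avg V w (\<lambda>x. real_of_int (f (v x)))"
  let ?u = "(?a fst, ?a (\<lambda>v. fst (snd v)), ?a (\<lambda>v. snd (snd v)))"
  have "avg V w (\<lambda>x. avg V w (\<lambda>y. real_of_int (form2 (v x) (v y)))) = form2 ?u ?u"
    unfolding of_int_form2 form2.simps avg_linear by (simp add: avg_linear algebra_simps)
  then show ?thesis by (simp only: form2_nonneg)
qed

definition dens :: "('v \<Rightarrow> 'v \<Rightarrow> bool) \<Rightarrow> 'v set \<Rightarrow> ('v \<Rightarrow> real) \<Rightarrow> real" where
  "dens a V w = avg V w (\<lambda>x. avg V w (\<lambda>y. avg V w (\<lambda>z. avg V w (\<lambda>u. of_bool (two_edges a x y z u)))))"

definition forb :: "('v \<Rightarrow> 'v \<Rightarrow> bool) \<Rightarrow> 'v set \<Rightarrow> ('v \<Rightarrow> real) \<Rightarrow> 'v \<Rightarrow> real" where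
  "forb a V w v = avg V w (\<lambda>x. avg V w (\<lambda>y. avg V w (\<lambda>z. avg V w (\<lambda>u. of_bool (forbidden a {v, x, y, z, u})))))"

definition deg :: "('v \<Rightarrow> 'v \<Rightarrow> bool) \<Rightarrow> 'v set \<Rightarrow> ('v \<Rightarrow> real) \<Rightarrow> 'v \<Rightarrow> real" where
  "deg a V w x = avg V w (\<lambda>y. of_bool (a x y))"

lemma UNIV_idx: "UNIV = {I0, I1, I2, I3, I4}"
  by (auto, metis idx.exhaust)

lemma case_idx_eta: "case_idx (h I0) (h I1) (h I2) (h I3) (h I4) = h"
  by (rule ext) (simp split: idx.split)

text \<open>Turns five nested averages into one sum over all maps from \<open>idx\<close>, in which
  the product of the weights is visibly invariant under permutations of the positions.\<close>

lemma avg5: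
  "avg V w (\<lambda>x0. avg V w (\<lambda>x1. avg V w (\<lambda>x2. avg V w (\<lambda>x3. avg V w (\<lambda>x4. g (case_idx x0 x1 x2 x3 x4))))))
    = (\<Sum>h | range h \<subseteq> V. (\<Prod>i\<in>UNIV. w (h i)) * g h)"
proof -
  have "avg V w (\<lambda>x0. avg V w (\<lambda>x1. avg V w (\<lambda>x2. avg V w (\<lambda>x3. avg V w (\<lambda>x4. g (case_idx x0 x1 x2 x3 x4))))))
     = (\<Sum>(x0, x1, x2, x3, x4)\<in>V \<times> V \<times> V \<times> V \<times> V. w x0 * w x1 * w x2 * w x3 * w x4 * g (case_idx x0 x1 x2 x3 x4))"
    unfolding avg_def sum_distrib_left sum.cartesian_product
    by (simp add: case_prod_unfold mult.assoc)
  also have "\<dots> = (\<Sum>h | range h \<subseteq> V. (\<Prod>i\<in>UNIV. w (h i)) * g h)"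
  proof (rule sum.reindex_bij_witness[of _ "\<lambda>h. (h I0, h I1, h I2, h I3, h I4)" "\<lambda>(x0, x1, x2, x3, x4). case_idx x0 x1 x2 x3 x4"], goal_cases)
    case (2 x)
    then show ?case by (auto split: idx.splits)
  next
    case (5 x)
    then show ?case by (auto simp: UNIV_idx mult.assoc)
  qed (auto simp: case_idx_eta image_subset_iff)
  finally show ?thesis .
qed

definition distinct5 :: "idx \<times> idx \<times> idx \<times> idx \<times> idx \<Rightarrow> bool" where
  "distinct5 p = (case p of (i0, i1, i2, i3, i4) \<Rightarrow> distinct [i0, i1, i2, i3, i4])"

lemma distinct5_perms30: "list_all distinct5 perms30"
  by code_simp

lemma bij_case_idx:
  assumes "distinct5 (i0, i1, i2, i3, i4)"
  shows "bij (case_idx i0 i1 i2 i3 i4)"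
proof -
  have "inj (case_idx i0 i1 i2 i3 i4)"
    using assms by (auto simp: inj_def distinct5_def split: idx.splits)
  moreover have "finite (UNIV :: idx set)" by (simp add: UNIV_idx)
  ultimately show ?thesis by (simp add: bij_def finite_UNIV_inj_surj)
qed

lemma sum_perm:
  fixes \<pi> :: "idx \<Rightarrow> idx"
  assumes "bij \<pi>"
  shows "(\<Sum>h | range h \<subseteq> V. (\<Prod>i\<in>UNIV. w (h i)) * (g (h \<circ> \<pi>) :: real)) = (\<Sum>h | range h \<subseteq> V. (\<Prod>i\<in>UNIV. w (h i)) * g h)"
proof (rule sum.reindex_bij_witness[of _ "\<lambda>h. h \<circ> inv \<pi>" "\<lambda>h. h \<circ> \<pi>"], goal_cases)
  case (5 h)
  have "(\<Prod>i\<in>UNIV. w ((h \<circ> \<pi>) i)) = (\<Prod>i\<in>UNIV. w (h i))"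
    using prod.reindex_bij_betw[OF assms, of "\<lambda>i. w (h i)"] by simp
  then show ?case by simp
qed (use assms in \<open>auto simp: o_assoc[symmetric] bij_is_surj surj_iff[THEN iffD1] bij_is_inj fun_eq_iff\<close>)

locale weighted_graph =
  fixes V :: "'v set" and a :: "'v \<Rightarrow> 'v \<Rightarrow> bool" and w :: "'v \<Rightarrow> real"
  assumes fin: "finite V" and sym: "a x y \<longleftrightarrow> a y x" and irrefl: "\<not> a x x"
    and w_nonneg: "x \<in> V \<Longrightarrow> 0 \<le> w x" and w_sum: "sum w V = 1"
begin

abbreviation E :: "('v \<Rightarrow> real) \<Rightarrow> real" where "E \<equiv> avg V w"

text \<open>Positions holding the same vertex are nonadjacent and have equal rows, which is among
  the 1024 cases checked; so tuples with repetitions obey the same bound.\<close>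

lemma cert_pointwise:
  fixes h :: "idx \<Rightarrow> 'v"
  shows "real_of_int (\<Sum>p\<leftarrow>perms30. cert (\<lambda>i j. a (h i) (h j)) p) \<ge> 108 * of_bool (forbidden a (range h))"
proof -
  let ?e = "\<lambda>i j. a (h i) (h j)"
  have "?e = table (?e I0 I1) (?e I0 I2) (?e I0 I3) (?e I0 I4) (?e I1 I2) (?e I1 I3) (?e I1 I4) (?e I2 I3) (?e I2 I4) (?e I3 I4)"
    by (intro ext) (auto simp: table_def irrefl sym split: idx.split)
  then have "cert_ok ?e" using cert_ok_table by metis
  moreover have "forbidden ?e (set [I0, I1, I2, I3, I4]) = forbidden a (range h)"
    unfolding UNIV_idx forbidden_def by (simp only: bex_simps image_insert image_empty list.set)
  ultimately show ?thesis
    by (auto simp: cert_ok_def Let_def)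
qed

lemma cert_sum_le:
  "E (\<lambda>x0. E (\<lambda>x1. E (\<lambda>x2. E (\<lambda>x3. E (\<lambda>x4. real_of_int (cert a (x0, x1, x2, x3, x4)))))))
    \<le> 1080 - 1944 * E (\<lambda>x. (deg a V w x - 1/3)^2) - 2160 * dens a V w"
proof -
  define D where "D x y z = (of_bool (a x y) - 1/3) * (of_bool (a x z) - 1/3 :: real)" for x y z
  define K where "K x0 x1 x2 x3 x4 = (if a x0 x1 then
          if a x0 x2 \<and> \<not> a x1 x2 then form2 (vec2 (a x0 x3) (a x1 x3) (a x2 x3)) (vec2 (a x0 x4) (a x1 x4) (a x2 x4)) else 0
        else if a x0 x2 then 0
        else if a x1 x2 then form1 (vec1 (a x0 x3) (a x1 x3) (a x2 x3)) (vec1 (a x0 x4) (a x1 x4) (a x2 x4))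
        else form0 (vec0 (a x0 x3) (a x1 x3) (a x2 x3)) (vec0 (a x0 x4) (a x1 x4) (a x2 x4)))" for x0 x1 x2 x3 x4
  \<comment> \<open>The values 2 and -1 are three times \<open>of_bool - 1/3\<close>, whence 216 * 9
    = 1944.\<close>
  have c: "real_of_int (cert a (x0, x1, x2, x3, x4)) =
     1080 - 1944 * D x0 x3 x4 - 2160 * of_bool (two_edges a x1 x2 x3 x4) - of_int (K x0 x1 x2 x3 x4)" for x0 x1 x2 x3 x4
    unfolding cert.simps K_def[symmetric] D_def by (auto simp: of_bool_def)
  have K: "0 \<le> E (\<lambda>x3. E (\<lambda>x4. real_of_int (K x0 x1 x2 x3 x4)))" for x0 x1 x2
    using avg_form0[of V w "\<lambda>x. vec0 (a x0 x) (a x1 x) (a x2 x)"]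
      avg_form1[of V w "\<lambda>x. vec1 (a x0 x) (a x1 x) (a x2 x)"]
      avg_form2[of V w "\<lambda>x. vec2 (a x0 x) (a x1 x) (a x2 x)"]
    unfolding K_def by (cases "a x0 x1"; cases "a x0 x2"; cases "a x1 x2") (simp_all add: avg_const[OF w_sum])
  have K': "0 \<le> E (\<lambda>x0. E (\<lambda>x1. E (\<lambda>x2. E (\<lambda>x3. E (\<lambda>x4. real_of_int (K x0 x1 x2 x3 x4))))))"
    by (intro avg_nonneg K w_nonneg)
  have D: "E (\<lambda>x3. E (\<lambda>x4. D x0 x3 x4)) = (deg a V w x0 - 1/3)^2" for x0
    unfolding D_def deg_def power2_eq_square by (simp add: avg_linear avg_const[OF w_sum])
  show ?thesis
    unfolding c avg_linear avg_const[OF w_sum] D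
    using K' unfolding dens_def by simp
qed

text \<open>All 30 placements have the same mean, since the five vertices are drawn independently
  with the same weights; the pointwise bound then applies to their sum. The factors are 108/(30 *
  2160) = 1/600 and 1944/2160 = 9/10.\<close>

theorem certificate:
  "1/600 * E (forb a V w) + 9/10 * E (\<lambda>x. (deg a V w x - 1/3)^2) \<le> 1/2 - dens a V w"
proof -
  let ?S = "\<lambda>g. \<Sum>h | range (h :: idx \<Rightarrow> 'v) \<subseteq> V. (\<Prod>i\<in>UNIV. w (h i)) * (g h :: real)"
  define C where "C h = real_of_int (cert a (h I0, h I1, h I2, h I3, h I4))" for h :: "idx \<Rightarrow> 'v"
  have perm: "?S (\<lambda>h. real_of_int (cert (\<lambda>i j. a (h i) (h j)) p)) = ?S C" if "p \<in> set perms30" for p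
  proof -
    obtain i0 i1 i2 i3 i4 where p: "p = (i0, i1, i2, i3, i4)" by (metis prod.exhaust)
    have "distinct5 p" using distinct5_perms30 that by (auto simp: list_all_iff)
    from sum_perm[OF bij_case_idx[OF this[unfolded p]], of w C V]
    show ?thesis unfolding C_def p by (simp add: two_edges_def cong: if_cong)
  qed
  have fin': "\<And>h. range h \<subseteq> V \<Longrightarrow> 0 \<le> (\<Prod>i\<in>(UNIV::idx set). w (h i))"
    using w_nonneg by (intro prod_nonneg) auto
  have "30 * ?S C = (\<Sum>p\<leftarrow>perms30. ?S C)"
    by (simp add: perms30_def)
  also have "\<dots> = (\<Sum>p\<leftarrow>perms30. ?S (\<lambda>h. real_of_int (cert (\<lambda>i j. a (h i) (h j)) p)))"
    by (intro arg_cong[where f=sum_list] map_cong refl perm[symmetric])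
  also have "\<dots> = ?S (\<lambda>h. real_of_int (\<Sum>p\<leftarrow>perms30. cert (\<lambda>i j. a (h i) (h j)) p))"
  proof -
    have "(\<Sum>p\<leftarrow>ps. ?S (\<lambda>h. real_of_int (f h p))) = ?S (\<lambda>h. real_of_int (\<Sum>p\<leftarrow>ps. f h p))"
      for ps :: "(idx \<times> idx \<times> idx \<times> idx \<times> idx) list" and f
      by (induction ps) (auto simp: sum.distrib algebra_simps)
    then show ?thesis .
  qed
  also have "\<dots> \<ge> ?S (\<lambda>h. 108 * of_bool (forbidden a (range h)))"
  proof (rule sum_mono)
    fix h assume "h \<in> {h :: idx \<Rightarrow> 'v. range h \<subseteq> V}"
    then have "0 \<le> (\<Prod>i\<in>UNIV. w (h i))" using fin'[of h] by simp
    then show "(\<Prod>i\<in>UNIV. w (h i)) * (108 * of_bool (forbidden a (range h)))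
        \<le> (\<Prod>i\<in>UNIV. w (h i)) * real_of_int (\<Sum>p\<leftarrow>perms30. cert (\<lambda>i j. a (h i) (h j)) p)"
      using mult_left_mono[OF cert_pointwise[of h]] by simp
  qed
  finally have 1: "30 * ?S C \<ge> ?S (\<lambda>h. 108 * of_bool (forbidden a (range h)))" .
  have 2: "?S (\<lambda>h. 108 * of_bool (forbidden a (range h))) = 108 * E (forb a V w)"
    unfolding avg5[of V w "\<lambda>h. 108 * of_bool (forbidden a (range h))", symmetric]
    by (simp add: UNIV_idx forb_def[abs_def] avg_linear)
  have 3: "?S C = E (\<lambda>x0. E (\<lambda>x1. E (\<lambda>x2. E (\<lambda>x3. E (\<lambda>x4. real_of_int (cert a (x0, x1, x2, x3, x4)))))))"
    unfolding avg5[of V w C, symmetric] by (simp add: C_def del: cert.simps)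
  show ?thesis
    using 1 cert_sum_le unfolding 2 3 by linarith
qed

end

section \<open>Densities at a vertex\<close>

definition unif :: "'v set \<Rightarrow> 'v \<Rightarrow> real" where
  "unif V x = 1 / real (card V)"

definition dens_at :: "('v \<Rightarrow> 'v \<Rightarrow> bool) \<Rightarrow> 'v set \<Rightarrow> ('v \<Rightarrow> real) \<Rightarrow> 'v \<Rightarrow> real" where
  "dens_at a V w x = avg V w (\<lambda>y. avg V w (\<lambda>z. avg V w (\<lambda>u. of_bool (two_edges a x y z u))))"

definition tilt :: "real \<Rightarrow> 'v \<Rightarrow> ('v \<Rightarrow> real) \<Rightarrow> 'v \<Rightarrow> real" where
  "tilt \<eta> x w v = (1 - \<eta>) * w v + (if v = x then \<eta> else 0)"

lemma avg_tilt:
  assumes "finite V" "x \<in> V"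
  shows "avg V (tilt \<eta> x w) f = (1 - \<eta>) * avg V w f + \<eta> * f x"
proof -
  have "avg V (tilt \<eta> x w) f = (\<Sum>v\<in>V. (1 - \<eta>) * (w v * f v) + (if v = x then \<eta> * f v else 0))"
    unfolding avg_def tilt_def by (intro sum.cong) (auto simp: algebra_simps)
  also have "\<dots> = (1 - \<eta>) * avg V w f + \<eta> * f x"
    using assms by (simp add: sum.distrib avg_def sum_distrib_left)
  finally show ?thesis .
qed

context weighted_graph
begin

lemma weighted_graph_tilt:
  assumes "x \<in> V" "0 \<le> \<eta>" "\<eta> \<le> 1"
  shows "weighted_graph V a (tilt \<eta> x w)"
proof
  show "sum (tilt \<eta> x w) V = 1"
    using avg_tilt[OF fin assms(1), of \<eta> w "\<lambda>_. 1"] w_sum by (simp add: avg_def)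
qed (use assms fin sym irrefl w_nonneg in \<open>auto simp: tilt_def\<close>)

lemma two_edges_swap: "two_edges a y x z u = two_edges a x y z u" "two_edges a y z x u = two_edges a x y z u"
  "two_edges a y z u x = two_edges a x y z u"
  using sym by (auto simp: two_edges_def add_ac)

lemma E_ge_0: "(\<And>x. 0 \<le> f x) \<Longrightarrow> 0 \<le> E f"
  by (simp add: avg_nonneg w_nonneg)

lemma E_mono: "(\<And>x. x \<in> V \<Longrightarrow> f x \<le> g x) \<Longrightarrow> E f \<le> E g"
  by (simp add: avg_mono w_nonneg)

text \<open>
  The weight \<open>tilt \<eta> x w\<close> only changes the density by \<open>O(\<eta>\<^sup>2)\<close> if the densities overall and at \<open>x\<close> agree,
  but gives the rooted quantities at \<open>x\<close> the weight \<open>\<eta>\<close>; hence these are \<open>O(\<eta>)\<close>.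
\<close>

lemma dens_tilt:
  assumes x: "x \<in> V" and \<eta>: "0 \<le> \<eta>" "\<eta> \<le> 1"
  shows "(1 - \<eta>)^4 * dens a V w + 4 * \<eta> * (1 - \<eta>)^3 * dens_at a V w x \<le> dens a V (tilt \<eta> x w)"
proof -
  interpret T: weighted_graph V a "tilt \<eta> x w"
    using weighted_graph_tilt[OF assms] .
  let ?M = "avg V (tilt \<eta> x w)"
  define D where "D x y z u = (of_bool (two_edges a x y z u) :: real)" for x y z u
  have D0: "0 \<le> D x y z u" for x y z u by (simp add: D_def)
  have M: "?M f = (1 - \<eta>) * E f + \<eta> * f x" for f by (rule avg_tilt[OF fin x])
  have M_ge: "(1 - \<eta>) * E f \<le> ?M f" if "\<And>v. 0 \<le> f v" for f
    using that[of x] \<eta> by (simp add: M)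
  have M_mono: "?M f \<le> ?M g" if "\<And>v. f v \<le> g v" for f g
    using that by (intro T.E_mono)
  have E_mono': "E f \<le> E g" if "\<And>v. f v \<le> g v" for f g
    using that by (intro E_mono)
  have M1: "(1 - \<eta>) * E g \<le> ?M g" if "\<And>z. 0 \<le> g z" for g
    using M_ge that by blast
  have M2: "(1 - \<eta>)^2 * E (\<lambda>z. E (\<lambda>u. g z u)) \<le> ?M (\<lambda>z. ?M (\<lambda>u. g z u))" if g: "\<And>z u. 0 \<le> g z u" for g
  proof -
    have "(1 - \<eta>)^2 * E (\<lambda>z. E (\<lambda>u. g z u)) = (1 - \<eta>) * E (\<lambda>z. (1 - \<eta>) * E (\<lambda>u. g z u))"
      by (simp add: avg_linear power2_eq_square)
    also have "\<dots> \<le> ?M (\<lambda>z. (1 - \<eta>) * E (\<lambda>u. g z u))"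
      using \<eta> g by (intro M1 mult_nonneg_nonneg E_ge_0) auto
    also have "\<dots> \<le> ?M (\<lambda>z. ?M (\<lambda>u. g z u))"
      by (intro M_mono M1 g)
    finally show ?thesis .
  qed
  have M3: "(1 - \<eta>)^3 * E (\<lambda>y. E (\<lambda>z. E (\<lambda>u. g y z u))) \<le> ?M (\<lambda>y. ?M (\<lambda>z. ?M (\<lambda>u. g y z u)))"
    if g: "\<And>y z u. 0 \<le> g y z u" for g
  proof -
    have "(1 - \<eta>)^3 * E (\<lambda>y. E (\<lambda>z. E (\<lambda>u. g y z u))) = (1 - \<eta>) * E (\<lambda>y. (1 - \<eta>)^2 * E (\<lambda>z. E (\<lambda>u. g y z u)))"
      by (simp add: avg_linear power2_eq_square power3_eq_cube)
    also have "\<dots> \<le> ?M (\<lambda>y. (1 - \<eta>)^2 * E (\<lambda>z. E (\<lambda>u. g y z u)))"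
      using \<eta> g by (intro M1 mult_nonneg_nonneg E_ge_0) auto
    also have "\<dots> \<le> ?M (\<lambda>y. ?M (\<lambda>z. ?M (\<lambda>u. g y z u)))"
      by (intro M_mono M2 g)
    finally show ?thesis .
  qed
  \<comment> \<open>Only tuples that pick the extra mass at most once are kept. There are four
    positions for it, and the symmetry of \<open>two_edges\<close> makes each contribute
    \<open>R\<close>. The positions are switched to the tilted weight from the innermost
    outwards.\<close>
  define R where "R = dens_at a V w x"
  have R1: "E (\<lambda>y. E (\<lambda>z. E (\<lambda>u. D x y z u))) = R" and R2: "E (\<lambda>y. E (\<lambda>z. E (\<lambda>u. D y x z u))) = R"
    and R3: "E (\<lambda>y. E (\<lambda>z. E (\<lambda>u. D y z x u))) = R" and R4: "E (\<lambda>y. E (\<lambda>z. E (\<lambda>u. D y z u x))) = R"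
    unfolding R_def dens_at_def D_def
    by (simp_all only: two_edges_swap(1)[of _ x] two_edges_swap(2)[of _ _ x] two_edges_swap(3)[of _ _ _ x])
  have 1: "(1 - \<eta>) * dens a V w + \<eta> * R \<le> E (\<lambda>x1. E (\<lambda>x2. E (\<lambda>x3. ?M (\<lambda>x4. D x1 x2 x3 x4))))"
    using R4 by (simp add: M avg_linear dens_def D_def)
  have 2: "(1 - \<eta>) * E (\<lambda>x1. E (\<lambda>x2. E (\<lambda>x3. ?M (\<lambda>x4. D x1 x2 x3 x4)))) + \<eta> * ((1 - \<eta>) * R)
     \<le> E (\<lambda>x1. E (\<lambda>x2. ?M (\<lambda>x3. ?M (\<lambda>x4. D x1 x2 x3 x4))))"
  proof -
    have "(1 - \<eta>) * R \<le> E (\<lambda>x1. E (\<lambda>x2. ?M (\<lambda>x4. D x1 x2 x x4)))"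
    proof -
      have "(1 - \<eta>) * R = E (\<lambda>x1. E (\<lambda>x2. (1 - \<eta>) * E (\<lambda>x4. D x1 x2 x x4)))"
        by (simp add: R3[symmetric] avg_linear)
      also have "\<dots> \<le> E (\<lambda>x1. E (\<lambda>x2. ?M (\<lambda>x4. D x1 x2 x x4)))"
        by (intro E_mono' M1 D0)
      finally show ?thesis .
    qed
    from mult_left_mono[OF this \<eta>(1)] show ?thesis
    proof -
      have "E (\<lambda>x1. E (\<lambda>x2. ?M (\<lambda>x3. ?M (\<lambda>x4. D x1 x2 x3 x4))))
        = E (\<lambda>x1. E (\<lambda>x2. (1 - \<eta>) * E (\<lambda>x3. ?M (\<lambda>x4. D x1 x2 x3 x4)) + \<eta> * ?M (\<lambda>x4. D x1 x2 x x4)))"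
        by (intro avg_cong M)
      also have "\<dots> = (1 - \<eta>) * E (\<lambda>x1. E (\<lambda>x2. E (\<lambda>x3. ?M (\<lambda>x4. D x1 x2 x3 x4))))
          + \<eta> * E (\<lambda>x1. E (\<lambda>x2. ?M (\<lambda>x4. D x1 x2 x x4)))"
        by (simp only: avg_linear)
      finally show ?thesis using \<open>\<eta> * ((1 - \<eta>) * R) \<le> _\<close> by linarith
    qed
  qed
  have 3: "(1 - \<eta>) * E (\<lambda>x1. E (\<lambda>x2. ?M (\<lambda>x3. ?M (\<lambda>x4. D x1 x2 x3 x4)))) + \<eta> * ((1 - \<eta>)^2 * R)
     \<le> E (\<lambda>x1. ?M (\<lambda>x2. ?M (\<lambda>x3. ?M (\<lambda>x4. D x1 x2 x3 x4))))"
  proof -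
    have "(1 - \<eta>)^2 * R \<le> E (\<lambda>x1. ?M (\<lambda>x3. ?M (\<lambda>x4. D x1 x x3 x4)))"
    proof -
      have "(1 - \<eta>)^2 * R = E (\<lambda>x1. (1 - \<eta>)^2 * E (\<lambda>x3. E (\<lambda>x4. D x1 x x3 x4)))"
        by (simp add: R2[symmetric] avg_linear)
      also have "\<dots> \<le> E (\<lambda>x1. ?M (\<lambda>x3. ?M (\<lambda>x4. D x1 x x3 x4)))"
        by (intro E_mono' M2 D0)
      finally show ?thesis .
    qed
    from mult_left_mono[OF this \<eta>(1)] show ?thesis
      unfolding M[of "\<lambda>x2. ?M (\<lambda>x3. ?M (\<lambda>x4. D _ x2 x3 x4))"] avg_linear by simp
  qed
  have 4: "(1 - \<eta>) * E (\<lambda>x1. ?M (\<lambda>x2. ?M (\<lambda>x3. ?M (\<lambda>x4. D x1 x2 x3 x4)))) + \<eta> * ((1 - \<eta>)^3 * R)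
     \<le> ?M (\<lambda>x1. ?M (\<lambda>x2. ?M (\<lambda>x3. ?M (\<lambda>x4. D x1 x2 x3 x4))))"
  proof -
    have "(1 - \<eta>)^3 * R \<le> ?M (\<lambda>x2. ?M (\<lambda>x3. ?M (\<lambda>x4. D x x2 x3 x4)))"
      unfolding R1[symmetric] by (intro M3 D0)
    from mult_left_mono[OF this \<eta>(1)] show ?thesis
      unfolding M[of "\<lambda>x1. ?M (\<lambda>x2. ?M (\<lambda>x3. ?M (\<lambda>x4. D x1 x2 x3 x4)))"] by simp
  qed
  have \<eta>': "0 \<le> 1 - \<eta>" using \<eta> by simp
  have "(1 - \<eta>)^4 * dens a V w + 4 * \<eta> * (1 - \<eta>)^3 * R
     = (1 - \<eta>) * ((1 - \<eta>) * ((1 - \<eta>) * ((1 - \<eta>) * dens a V w + \<eta> * R) + \<eta> * ((1 - \<eta>) * R)) + \<eta> * ((1 - \<eta>)^2 * R))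
       + \<eta> * ((1 - \<eta>)^3 * R)"
    by (simp add: power2_eq_square power3_eq_cube power4_eq_xxxx algebra_simps)
  also have "\<dots> \<le> ?M (\<lambda>x1. ?M (\<lambda>x2. ?M (\<lambda>x3. ?M (\<lambda>x4. D x1 x2 x3 x4))))"
    using mult_left_mono[OF 1 \<eta>'] mult_left_mono[OF 2 \<eta>'] mult_left_mono[OF 3 \<eta>'] 4
    by (smt (verit) \<eta>' mult_left_mono)
  finally show ?thesis by (simp add: R_def dens_def D_def)
qed

lemma forb_tilt:
  assumes x: "x \<in> V" and \<eta>: "0 \<le> \<eta>" "\<eta> \<le> 1"
  shows "(1 - \<eta>)^4 * forb a V w x \<le> forb a V (tilt \<eta> x w) x"
proof -
  interpret T: weighted_graph V a "tilt \<eta> x w"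
    using weighted_graph_tilt[OF assms] .
  let ?M = "avg V (tilt \<eta> x w)"
  have M1: "(1 - \<eta>) * E f \<le> ?M g" if "\<And>v. 0 \<le> f v" "\<And>v. f v \<le> g v" for f g
  proof -
    have "(1 - \<eta>) * E f \<le> ?M f" using that(1)[of x] \<eta> by (simp add: avg_tilt[OF fin x])
    also have "\<dots> \<le> ?M g" using that by (intro T.E_mono)
    finally show ?thesis .
  qed
  have "(1 - \<eta>)^4 * forb a V w x = (1 - \<eta>) * E (\<lambda>y. (1 - \<eta>) * E (\<lambda>z. (1 - \<eta>) * E (\<lambda>u. (1 - \<eta>) *
      E (\<lambda>v. of_bool (forbidden a {x, y, z, u, v})))))"
    by (simp add: avg_linear forb_def power4_eq_xxxx)
  also have "\<dots> \<le> forb a V (tilt \<eta> x w) x"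
    unfolding forb_def using \<eta> by (intro M1 mult_nonneg_nonneg E_ge_0) auto
  finally show ?thesis .
qed

lemma rooted:
  assumes x: "x \<in> V" and \<eta>: "0 < \<eta>" "\<eta> \<le> 1/10"
    and d: "1/2 - \<eta>^2 \<le> dens a V w" "1/2 - \<eta>^2 \<le> dens_at a V w x"
  shows "forb a V w x \<le> 4000 * \<eta>" "((1 - \<eta>) * deg a V w x - 1/3)^2 \<le> 5 * \<eta>"
proof -
  have \<eta>': "0 \<le> \<eta>" "\<eta> \<le> 1" using \<eta> by auto
  interpret T: weighted_graph V a "tilt \<eta> x w"
    using weighted_graph_tilt[OF x \<eta>'] .
  let ?M = "avg V (tilt \<eta> x w)"
  have M: "?M f = (1 - \<eta>) * E f + \<eta> * f x" for f by (rule avg_tilt[OF fin x])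
  have M_ge: "\<eta> * f x \<le> ?M f" if "\<And>v. 0 \<le> f v" for f
    using E_ge_0[of f] that \<eta> by (simp add: M)
  have pw: "0 \<le> (1 - \<eta>)^4" "0 \<le> 4 * \<eta> * (1 - \<eta>)^3" using \<eta> by auto
  have "(1 - \<eta>)^4 * (1/2 - \<eta>^2) + 4 * \<eta> * (1 - \<eta>)^3 * (1/2 - \<eta>^2) \<le> dens a V (tilt \<eta> x w)"
    using dens_tilt[OF x \<eta>'] mult_left_mono[OF d(1) pw(1)] mult_left_mono[OF d(2) pw(2)] by linarith
  \<comment> \<open>The kept tuples have total weight at least 1 - 6 \<eta>^2, which costs 3
    \<eta>^2 of density; the assumed deficits cost at most another \<eta>^2.\<close>
  moreover have "1/2 - 4 * \<eta>^2 \<le> (1 - \<eta>)^4 * (1/2 - \<eta>^2) + 4 * \<eta> * (1 - \<eta>)^3 * (1/2 - \<eta>^2)"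
  proof -
    have e: "(1 - \<eta>)^4 + 4 * \<eta> * (1 - \<eta>)^3 = 1 - 6 * \<eta>^2 + \<eta>^3 * (8 - 3 * \<eta>)"
      by (simp add: power2_eq_square power3_eq_cube power4_eq_xxxx algebra_simps)
    have "0 \<le> \<eta>^3 * (8 - 3 * \<eta>)" using \<eta> by simp
    then have ge: "1 - 6 * \<eta>^2 \<le> (1 - \<eta>)^4 + 4 * \<eta> * (1 - \<eta>)^3" using e by simp
    have "\<eta>^2 \<le> (1/10)^2" using \<eta> by (intro power_mono) auto
    then have "(1 - 6 * \<eta>^2) * (1/2 - \<eta>^2) \<le> ((1 - \<eta>)^4 + 4 * \<eta> * (1 - \<eta>)^3) * (1/2 - \<eta>^2)"
      using ge by (intro mult_right_mono) (auto simp: power2_eq_square)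
    moreover have "(1 - 6 * \<eta>^2) * (1/2 - \<eta>^2) = 1/2 - 4 * \<eta>^2 + 6 * (\<eta>^2)^2"
      by (simp add: power2_eq_square algebra_simps)
    moreover have "0 \<le> 6 * (\<eta>^2)^2" by simp
    ultimately show ?thesis by (simp only: distrib_right)
  qed
  ultimately have "1/2 - 4 * \<eta>^2 \<le> dens a V (tilt \<eta> x w)" by (rule order_trans[rotated])
  then have c: "1/600 * ?M (forb a V (tilt \<eta> x w)) + 9/10 * ?M (\<lambda>v. (deg a V (tilt \<eta> x w) v - 1/3)^2) \<le> 4 * \<eta>^2"
    by (intro order_trans[OF T.certificate]) simp
  have f0: "0 \<le> forb a V (tilt \<eta> x w) v" for v
    unfolding forb_def by (intro T.E_ge_0) auto
  have 1: "\<eta> * forb a V (tilt \<eta> x w) x \<le> ?M (forb a V (tilt \<eta> x w))"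
    by (intro M_ge f0)
  have 2: "\<eta> * (deg a V (tilt \<eta> x w) x - 1/3)^2 \<le> ?M (\<lambda>v. (deg a V (tilt \<eta> x w) v - 1/3)^2)"
    by (rule M_ge[of "\<lambda>v. (deg a V (tilt \<eta> x w) v - 1/3)^2"]) simp
  have 3: "0 \<le> ?M (forb a V (tilt \<eta> x w))" "0 \<le> ?M (\<lambda>v. (deg a V (tilt \<eta> x w) v - 1/3)^2)"
    by (intro T.E_ge_0 f0; simp)+
  \<comment> \<open>Since \<open>x\<close> carries mass at least \<eta>, dividing by \<eta> leaves
    bounds linear in \<eta>: 600 * 4 = 2400 here, and 4 * 10/9 < 5 for the degree. Undoing the tilt
    costs the factor 6/10 and turns 2400 into 4000.\<close>
  have "\<eta> * forb a V (tilt \<eta> x w) x \<le> \<eta> * (2400 * \<eta>)"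
    using c 1 3 by (simp add: power2_eq_square)
  then have "forb a V (tilt \<eta> x w) x \<le> 2400 * \<eta>" using \<eta> by simp
  moreover have "(6/10) * forb a V w x \<le> (1 - \<eta>)^4 * forb a V w x"
  proof (rule mult_right_mono)
    have "(9/10)^4 \<le> (1 - \<eta>)^4" using \<eta> by (intro power_mono) auto
    then show "6/10 \<le> (1 - \<eta>)^4" by (simp add: power4_eq_xxxx)
    show "0 \<le> forb a V w x" unfolding forb_def by (intro E_ge_0) auto
  qed
  ultimately show "forb a V w x \<le> 4000 * \<eta>" using forb_tilt[OF x \<eta>'] by linarith
  have "\<eta> * (deg a V (tilt \<eta> x w) x - 1/3)^2 \<le> \<eta> * (5 * \<eta>)"
  proof -
    have "\<eta> * (5 * \<eta>) = 5 * \<eta>^2" by (simp add: power2_eq_square)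
    moreover have "0 \<le> \<eta>^2" by simp
    ultimately show ?thesis using c 2 3 by linarith
  qed
  then have "(deg a V (tilt \<eta> x w) x - 1/3)^2 \<le> 5 * \<eta>" using \<eta> by simp
  \<comment> \<open>As \<open>x\<close> is not its own neighbour, the added mass does not count
    towards its degree.\<close>
  then show "((1 - \<eta>) * deg a V w x - 1/3)^2 \<le> 5 * \<eta>"
    by (simp add: deg_def M irrefl)
qed

text \<open>With \<eta> = \<delta>^2/5000 the squared degree error is at most \<delta>^2/1000, so
  its root is below \<delta>/10, which leaves room for removing the factor 1 - \<eta>.\<close>

lemma rooted_close:
  assumes x: "x \<in> V" and \<delta>: "0 < \<delta>" "\<delta> \<le> 1"
    and d: "1/2 - (\<delta>^2 / 5000)^2 \<le> dens a V w" "1/2 - (\<delta>^2 / 5000)^2 \<le> dens_at a V w x"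
  shows "forb a V w x \<le> \<delta>" "\<bar>deg a V w x - 1/3\<bar> \<le> \<delta>"
proof -
  define \<eta> where "\<eta> = \<delta>^2 / 5000"
  have sq: "\<delta>^2 \<le> \<delta>" using \<delta> by (simp add: power2_eq_square mult_left_le)
  have \<eta>: "0 < \<eta>" "\<eta> \<le> 1/10" using \<delta> sq by (auto simp: \<eta>_def)
  note r = rooted[OF x \<eta> d[folded \<eta>_def]]
  show "forb a V w x \<le> \<delta>" using r(1) sq \<delta> by (simp add: \<eta>_def)
  have "((1 - \<eta>) * deg a V w x - 1/3)^2 \<le> (\<delta>/10)^2"
    by (rule order_trans[OF r(2)]) (simp add: \<eta>_def power_divide)
  then have 1: "\<bar>(1 - \<eta>) * deg a V w x - 1/3\<bar> \<le> \<delta>/10"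
    using \<delta> by (subst (asm) abs_le_square_iff[symmetric]) simp
  have "deg a V w x \<le> 1" unfolding deg_def
    using E_mono[of "\<lambda>y. of_bool (a x y)" "\<lambda>_. 1"] by (simp add: avg_const[OF w_sum])
  moreover have "0 \<le> deg a V w x" unfolding deg_def by (intro E_ge_0) simp
  ultimately have "0 \<le> \<eta> * deg a V w x" "\<eta> * deg a V w x \<le> \<eta>" using \<eta> by (auto simp: mult_left_le)
  moreover have "\<eta> \<le> \<delta> / 5000" using sq by (simp add: \<eta>_def)
  moreover have "(1 - \<eta>) * deg a V w x = deg a V w x - \<eta> * deg a V w x" by (simp add: algebra_simps)
  ultimately show "\<bar>deg a V w x - 1/3\<bar> \<le> \<delta>"
    using 1 \<delta> by linarith
qed

end

section \<open>Six parts\<close>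

lemma forbidden_paw:
  assumes "x \<in> X" "p \<in> X" "q \<in> X" "r \<in> X" "a x p" "a x q" "a p r" "\<not> a p q" "\<not> a q r"
  shows "forbidden a X"
  unfolding forbidden_def
  by (rule disjI1, rule bexI[of _ x], rule bexI[of _ p], rule conjI[OF assms(5)], rule bexI[of _ q],
      intro conjI, rule assms(6), rule assms(8), rule bexI[of _ r]) (simp_all add: assms)

lemma forbidden_K4:
  assumes "x \<in> X" "p \<in> X" "q \<in> X" "r \<in> X" "a x p" "a x q" "a x r" "a p q" "a p r" "a q r"
  shows "forbidden a X"
  unfolding forbidden_def
  by (rule disjI2, rule disjI1, rule bexI[of _ x], rule bexI[of _ p], rule conjI[OF assms(5)], rule bexI[of _ q],
      intro conjI, rule assms(6), rule assms(8), rule bexI[of _ r]) (simp_all add: assms)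

lemma forbidden_2K2_K1:
  assumes "x \<in> X" "p \<in> X" "q \<in> X" "r \<in> X" "s \<in> X" "a p q" "a r s"
    "\<not> a x p" "\<not> a x q" "\<not> a x r" "\<not> a x s" "\<not> a p r" "\<not> a p s" "\<not> a q r" "\<not> a q s"
  shows "forbidden a X"
  unfolding forbidden_def
  by (rule disjI2, rule disjI2, rule bexI[of _ x], rule bexI[of _ p], rule conjI[OF assms(8)], rule bexI[of _ q],
      intro conjI, rule assms(6), rule assms(9), rule bexI[of _ r], intro conjI, rule assms(10),
      rule assms(12), rule assms(14), rule bexI[of _ s]) (simp_all add: assms)

text \<open>Lets a configuration on four vertices count as a forbidden five-tuple after padding with
  any fifth vertex.\<close>

lemma forbidden_mono:
  assumes "forbidden a X" "X \<subseteq> Y"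
  shows "forbidden a Y"
  using assms(1) unfolding forbidden_def[of a X]
proof (elim disjE bexE conjE, goal_cases)
  case (1 x p q r) then show ?case using assms(2) by (intro forbidden_paw[of x Y p q r a]) auto
next
  case (2 x p q r) then show ?case using assms(2) by (intro forbidden_K4[of x Y p q r a]) auto
next
  case (3 x p q r s) then show ?case using assms(2) by (intro forbidden_2K2_K1[of x Y p q r s a]) auto
qed

text \<open>Adjacency in \<open>2K\<^sub>3\<close>, the two triangles being \<open>{0, 1, 2}\<close> and \<open>{3, 4, 5}\<close>.\<close>

definition pat :: "nat \<Rightarrow> nat \<Rightarrow> bool" where
  "pat i j \<longleftrightarrow> i \<noteq> j \<and> (i < 3 \<longleftrightarrow> j < 3)"

lemma pat_sym: "pat i j \<longleftrightarrow> pat j i" and pat_irrefl: "\<not> pat i i"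
  by (auto simp: pat_def)

text \<open>
  If \<open>pq\<close> and \<open>rs\<close> are the edges of an induced \<open>2K\<^sub>2\<close> in a blowup of \<open>2K\<^sub>3\<close>, then \<open>p, q, r, s\<close> lie in parts \<open>0, 1, 3, 4\<close>
  up to automorphism, and the adjacencies to them determine the part of \<open>x\<close>. A vertex adjacent
  to none of them gets the junk value \<open>3\<close>.
\<close>

definition part_of :: "('v \<Rightarrow> 'v \<Rightarrow> bool) \<Rightarrow> 'v \<Rightarrow> 'v \<Rightarrow> 'v \<Rightarrow> 'v \<Rightarrow> 'v \<Rightarrow> nat" where
  "part_of a p q r s x = (if a x p then if a x q then 2 else 1 else if a x q then 0
     else if a x r then if a x s then 5 else 4 else 3)"

lemma part_of_less: "part_of a p q r s x < 6"
  by (simp add: part_of_def)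

definition induces_2K2 :: "('v \<Rightarrow> 'v \<Rightarrow> bool) \<Rightarrow> 'v \<Rightarrow> 'v \<Rightarrow> 'v \<Rightarrow> 'v \<Rightarrow> bool" where
  "induces_2K2 a p q r s \<longleftrightarrow> a p q \<and> a r s \<and> \<not> a p r \<and> \<not> a p s \<and> \<not> a q r \<and> \<not> a q s"

definition wrong :: "('v \<Rightarrow> 'v \<Rightarrow> bool) \<Rightarrow> ('v \<Rightarrow> nat) \<Rightarrow> 'v \<Rightarrow> 'v \<Rightarrow> bool" where
  "wrong a f x y \<longleftrightarrow> a x y \<noteq> pat (f x) (f y)"

context weighted_graph
begin

lemma no_paw:
  assumes "\<not> forbidden a X" "{x, p, q, r} \<subseteq> X"
  shows "\<not> (a x p \<and> a x q \<and> a p r \<and> \<not> a p q \<and> \<not> a q r)"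
  using assms forbidden_paw[of x X p q r a] by auto

text \<open>A vertex attached to both edges of the induced 2K_2 creates a P_4 or a paw, and one
  attached to neither creates 2K_2 plus an isolated vertex; so exactly one of the two edges is
  seen.\<close>

lemma part_of_cases:
  assumes t: "induces_2K2 a p q r s" and ok: "\<not> forbidden a {p, q, r, s, x}"
  shows "(a x p \<or> a x q) \<and> \<not> a x r \<and> \<not> a x s \<or> (a x r \<or> a x s) \<and> \<not> a x p \<and> \<not> a x q"
proof -
  note T = t[unfolded induces_2K2_def]
  have "\<not> (a x p \<and> a x r)" using no_paw[OF ok, of x p r q] T sym[of q p] sym[of r p] sym[of s p] sym[of r q] sym[of s q] by simp
  moreover have "\<not> (a x p \<and> a x s)" using no_paw[OF ok, of x p s q] T sym[of q p] sym[of r p] sym[of s p] sym[of r q] sym[of s q] by simp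
  moreover have "\<not> (a x q \<and> a x r)" using no_paw[OF ok, of x q r p] T sym[of q p] sym[of r p] sym[of s p] sym[of r q] sym[of s q] by simp
  moreover have "\<not> (a x q \<and> a x s)" using no_paw[OF ok, of x q s p] T sym[of q p] sym[of r p] sym[of s p] sym[of r q] sym[of s q] by simp
  moreover have "a x p \<or> a x q \<or> a x r \<or> a x s"
    using ok forbidden_2K2_K1[of x "{p, q, r, s, x}" p q r s a] T by auto
  ultimately show ?thesis by blast
qed

lemma no_K4:
  assumes "\<not> forbidden a X" "{x, p, q, r} \<subseteq> X"
  shows "\<not> (a x p \<and> a x q \<and> a x r \<and> a p q \<and> a p r \<and> a q r)"
  using assms forbidden_K4[of x X p q r a] by auto

text \<open>Both vertices see the edge \<open>pq\<close>, so they belong to its triangle, and their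
  traces on {p, q} tell the part. Adjacency with equal traces, or nonadjacency with different ones,
  produces a P_4, a paw or a K_4.\<close>

lemma same_side:
  assumes "a p q" "\<not> forbidden a {p, q, x, y}" "a x p \<or> a x q" "a y p \<or> a y q"
  shows "a x y \<longleftrightarrow> (a x p \<noteq> a y p \<or> a x q \<noteq> a y q)"
proof -
  note P = no_paw[OF assms(2)] and K = no_K4[OF assms(2)]
  have "\<not> (a q x \<and> a q p \<and> a x y \<and> \<not> a x p \<and> \<not> a p y)" by (rule P) auto
  moreover have "\<not> (a p x \<and> a p q \<and> a x y \<and> \<not> a x q \<and> \<not> a q y)" by (rule P) auto
  moreover have "\<not> (a p q \<and> a p x \<and> a p y \<and> a q x \<and> a q y \<and> a x y)" by (rule K) auto
  moreover have "\<not> (a q p \<and> a q x \<and> a p y \<and> \<not> a p x \<and> \<not> a x y)" by (rule P) auto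
  moreover have "\<not> (a q p \<and> a q y \<and> a p x \<and> \<not> a p y \<and> \<not> a y x)" by (rule P) auto
  moreover have "\<not> (a q y \<and> a q x \<and> a y p \<and> \<not> a y x \<and> \<not> a x p)" by (rule P) auto
  moreover have "\<not> (a q x \<and> a q y \<and> a x p \<and> \<not> a x y \<and> \<not> a y p)" by (rule P) auto
  moreover have "\<not> (a p y \<and> a p x \<and> a y q \<and> \<not> a y x \<and> \<not> a x q)" by (rule P) auto
  moreover have "\<not> (a p x \<and> a p y \<and> a x q \<and> \<not> a x y \<and> \<not> a y q)" by (rule P) auto
  ultimately show ?thesis
    using assms(1,3,4) sym[of q p] sym[of p x] sym[of q x] sym[of p y] sym[of q y] sym[of y x]
    by (cases "a x p"; cases "a x q"; cases "a y p"; cases "a y q"; cases "a x y") simp_all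
qed

lemma other_side:
  assumes "a p q" "\<not> forbidden a {p, q, x, y}" "a x p \<or> a x q" "\<not> a y p" "\<not> a y q"
  shows "\<not> a x y"
proof -
  note P = no_paw[OF assms(2)]
  have "\<not> (a x q \<and> a x y \<and> a q p \<and> \<not> a q y \<and> \<not> a y p)" by (rule P) auto
  moreover have "\<not> (a x p \<and> a x y \<and> a p q \<and> \<not> a p y \<and> \<not> a y q)" by (rule P) auto
  ultimately show ?thesis
    using assms(1,3,4,5) sym[of q p] sym[of q y] sym[of p y] by (cases "a x p"; cases "a x q") simp_all
qed

text \<open>The first two five-sets fix the sides of \<open>x\<close> and \<open>y\<close>; the last
  two contain {p, q, x, y} and {r, s, x, y}, padded by a vertex of the other edge, and decide the
  pair itself. The padding is there because \<open>forb\<close> measures five-tuples.\<close>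

lemma wrong_forbidden:
  assumes t: "induces_2K2 a p q r s" and w: "wrong a (part_of a p q r s) x y"
  shows "forbidden a {p, q, r, s, x} \<or> forbidden a {p, q, r, s, y} \<or> forbidden a {p, q, r, x, y} \<or> forbidden a {p, r, s, x, y}"
proof (rule ccontr)
  assume n: "\<not> ?thesis"
  note T = t[unfolded induces_2K2_def]
  have pq: "\<not> forbidden a {p, q, x, y}" and rs: "\<not> forbidden a {r, s, x, y}"
    using n forbidden_mono[of a "{p, q, x, y}" "{p, q, r, x, y}"] forbidden_mono[of a "{r, s, x, y}" "{p, r, s, x, y}"] by auto
  have pq': "\<not> forbidden a {p, q, y, x}" using pq by (simp add: insert_commute)
  have X: "(a x p \<or> a x q) \<and> \<not> a x r \<and> \<not> a x s \<or> (a x r \<or> a x s) \<and> \<not> a x p \<and> \<not> a x q"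
    by (rule part_of_cases[OF t]) (use n in auto)
  have Y: "(a y p \<or> a y q) \<and> \<not> a y r \<and> \<not> a y s \<or> (a y r \<or> a y s) \<and> \<not> a y p \<and> \<not> a y q"
    by (rule part_of_cases[OF t]) (use n in auto)
  have Pat: "pat (part_of a p q r s x) (part_of a p q r s y) \<longleftrightarrow>
     (if a x p \<or> a x q then (a y p \<or> a y q) \<and> (a x p \<noteq> a y p \<or> a x q \<noteq> a y q)
      else (a y r \<or> a y s) \<and> (a x r \<noteq> a y r \<or> a x s \<noteq> a y s))"
    using X Y by (auto simp: pat_def part_of_def)
  have axy: "a x y \<noteq> pat (part_of a p q r s x) (part_of a p q r s y)" using w by (simp add: wrong_def)
  show False
  proof (cases "a x p \<or> a x q"; cases "a y p \<or> a y q")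
    assume xy: "a x p \<or> a x q" "a y p \<or> a y q"
    show False using axy same_side[OF _ pq xy] T xy unfolding Pat by simp
  next
    assume xy: "a x p \<or> a x q" "\<not> (a y p \<or> a y q)"
    show False using axy other_side[OF _ pq xy(1)] T xy unfolding Pat by simp
  next
    assume xy: "\<not> (a x p \<or> a x q)" "a y p \<or> a y q"
    moreover have "\<not> (a y r \<or> a y s)" using Y xy by blast
    ultimately show False using axy other_side[OF _ pq' xy(2)] T sym[of x y] unfolding Pat by simp
  next
    assume xy: "\<not> (a x p \<or> a x q)" "\<not> (a y p \<or> a y q)"
    then have xy': "a x r \<or> a x s" "a y r \<or> a y s" using X Y by blast+
    show False using axy same_side[OF _ rs xy'] T xy xy' unfolding Pat by simp
  qed
qed

end

context weighted_graph
begin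

lemma E_const [simp]: "E (\<lambda>_. c) = c"
  by (rule avg_const[OF w_sum])

text \<open>Choose an edge \<open>pq\<close>, a vertex \<open>r\<close> adjacent to neither end, and
  a neighbour \<open>s\<close> of \<open>r\<close>: degrees near 1/3 give about 1/27 > 1/40 of all
  tuples. If \<open>s\<close> sees \<open>p\<close> or \<open>q\<close>, a P_4 or a paw arises. The
  fifth vertex \<open>t\<close> only completes the five-tuple.\<close>

lemma E_2K2:
  assumes \<delta>: "\<delta> \<le> 1/1000"
    and F: "\<And>x. x \<in> V \<Longrightarrow> forb a V w x \<le> \<delta>" and D: "\<And>x. x \<in> V \<Longrightarrow> \<bar>deg a V w x - 1/3\<bar> \<le> \<delta>"
  shows "1/40 < E (\<lambda>p. E (\<lambda>q. E (\<lambda>r. E (\<lambda>s. of_bool (induces_2K2 a p q r s)))))"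
proof -
  have d: "1/3 - \<delta> \<le> deg a V w x" "deg a V w x \<le> 1/3 + \<delta>" if "x \<in> V" for x using D[OF that] by linarith+
  have pt: "of_bool (a p q) * (of_bool (\<not> a p r \<and> \<not> a q r) * of_bool (a r s))
      \<le> of_bool (induces_2K2 a p q r s) + (of_bool (forbidden a {p, q, r, s, t}) :: real)" for p q r s t
  proof (cases "a p q \<and> \<not> a p r \<and> \<not> a q r \<and> a r s \<and> \<not> induces_2K2 a p q r s")
    case True
    then have "a p s \<or> a q s" by (auto simp: induces_2K2_def)
    then have "forbidden a {p, q, r, s, t}"
    proof
      assume "a p s"
      then show ?thesis using True sym[of s p] sym[of s r] sym[of r q] by (intro forbidden_paw[of s _ p r q]) auto
    next
      assume "a q s"
      then show ?thesis using True sym[of s q] sym[of s r] sym[of q p] sym[of r p] by (intro forbidden_paw[of s _ q r p]) auto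
    qed
    then show ?thesis by simp
  qed auto
  have "(1/3 - \<delta>) * ((1/3 - 2 * \<delta>) * (1/3 - \<delta>))
     \<le> E (\<lambda>p. E (\<lambda>q. of_bool (a p q) * ((1/3 - 2 * \<delta>) * (1/3 - \<delta>))))"
  proof -
    have "E (\<lambda>p. E (\<lambda>q. of_bool (a p q) * ((1/3 - 2 * \<delta>) * (1/3 - \<delta>)))) = E (deg a V w) * ((1/3 - 2 * \<delta>) * (1/3 - \<delta>))"
      by (simp add: avg_multc deg_def[abs_def])
    moreover have "1/3 - \<delta> \<le> E (deg a V w)"
      using E_mono[of "\<lambda>_. 1/3 - \<delta>" "deg a V w"] d by simp
    ultimately show ?thesis using \<delta> by (simp add: mult_right_mono)
  qed
  also have "\<dots> \<le> E (\<lambda>p. E (\<lambda>q. E (\<lambda>r. E (\<lambda>s. of_bool (a p q) * (of_bool (\<not> a p r \<and> \<not> a q r) * of_bool (a r s))))))"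
  proof (intro E_mono)
    fix p q assume pq: "p \<in> V" "q \<in> V"
    have "(1/3 - 2 * \<delta>) * (1/3 - \<delta>) \<le> E (\<lambda>r. of_bool (\<not> a p r \<and> \<not> a q r)) * (1/3 - \<delta>)"
    proof (rule mult_right_mono)
      have "1 - deg a V w p - deg a V w q = E (\<lambda>r. 1 - of_bool (a p r) - of_bool (a q r))"
        by (simp add: avg_linear deg_def)
      also have "\<dots> \<le> E (\<lambda>r. of_bool (\<not> a p r \<and> \<not> a q r))" by (intro E_mono) auto
      finally show "1/3 - 2 * \<delta> \<le> E (\<lambda>r. of_bool (\<not> a p r \<and> \<not> a q r))" using d[OF pq(1)] d[OF pq(2)] by linarith
    qed (use \<delta> in simp)
    also have "\<dots> \<le> E (\<lambda>r. of_bool (\<not> a p r \<and> \<not> a q r) * deg a V w r)"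
      unfolding avg_multc[symmetric] by (intro E_mono mult_left_mono d) auto
    finally have "of_bool (a p q) * ((1/3 - 2 * \<delta>) * (1/3 - \<delta>))
        \<le> of_bool (a p q) * E (\<lambda>r. of_bool (\<not> a p r \<and> \<not> a q r) * deg a V w r)"
      by (rule mult_left_mono) simp
    then show "of_bool (a p q) * ((1/3 - 2 * \<delta>) * (1/3 - \<delta>))
       \<le> E (\<lambda>r. E (\<lambda>s. of_bool (a p q) * (of_bool (\<not> a p r \<and> \<not> a q r) * of_bool (a r s))))"
      by (simp add: avg_linear deg_def)
  qed
  also have "\<dots> \<le> E (\<lambda>p. E (\<lambda>q. E (\<lambda>r. E (\<lambda>s. E (\<lambda>t. of_bool (induces_2K2 a p q r s) + of_bool (forbidden a {p, q, r, s, t}))))))"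
  proof (intro E_mono)
    fix p q r s
    have "E (\<lambda>t. of_bool (a p q) * (of_bool (\<not> a p r \<and> \<not> a q r) * of_bool (a r s)))
        \<le> E (\<lambda>t. of_bool (induces_2K2 a p q r s) + of_bool (forbidden a {p, q, r, s, t}))"
      by (intro E_mono pt)
    then show "of_bool (a p q) * (of_bool (\<not> a p r \<and> \<not> a q r) * of_bool (a r s))
        \<le> E (\<lambda>t. of_bool (induces_2K2 a p q r s) + of_bool (forbidden a {p, q, r, s, t}))" by simp
  qed
  also have "\<dots> = E (\<lambda>p. E (\<lambda>q. E (\<lambda>r. E (\<lambda>s. of_bool (induces_2K2 a p q r s))))) + E (forb a V w)"
    by (simp add: avg_linear forb_def[abs_def])
  also have "E (forb a V w) \<le> \<delta>" using E_mono[of "forb a V w" "\<lambda>_. \<delta>"] F by simp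
  finally have "(1/3 - \<delta>) * ((1/3 - 2 * \<delta>) * (1/3 - \<delta>)) - \<delta> \<le> E (\<lambda>p. E (\<lambda>q. E (\<lambda>r. E (\<lambda>s. of_bool (induces_2K2 a p q r s)))))"
    by linarith
  moreover have "(33/100) * ((33/100) * (33/100)) \<le> (1/3 - \<delta>) * ((1/3 - 2 * \<delta>) * (1/3 - \<delta>))"
    using \<delta> by (intro mult_mono) auto
  ultimately show ?thesis using \<delta> by linarith
qed

text \<open>If every choice gave at least 160 \<delta>, averaging over the induced copies of 2K_2
  alone would give more than 160 \<delta>/40 = 4 \<delta>, whereas each wrong pair is charged to one
  of four forbidden five-tuples of density at most \<delta>.\<close>

lemma exists_2K2:
  assumes \<delta>: "0 < \<delta>" "\<delta> \<le> 1/1000"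
    and F: "\<And>x. x \<in> V \<Longrightarrow> forb a V w x \<le> \<delta>" and D: "\<And>x. x \<in> V \<Longrightarrow> \<bar>deg a V w x - 1/3\<bar> \<le> \<delta>"
  shows "\<exists>p q r s. E (\<lambda>x. E (\<lambda>y. of_bool (wrong a (part_of a p q r s) x y))) \<le> 160 * \<delta>"
proof (rule ccontr)
  assume "\<not> ?thesis"
  then have n: "160 * \<delta> \<le> E (\<lambda>x. E (\<lambda>y. of_bool (wrong a (part_of a p q r s) x y)))" for p q r s
    by (meson linear)
  have EF: "E (\<lambda>x. forb a V w x) \<le> \<delta>" using E_mono[of "forb a V w" "\<lambda>_. \<delta>"] F by simp
  let ?t = "E (\<lambda>p. E (\<lambda>q. E (\<lambda>r. E (\<lambda>s. of_bool (induces_2K2 a p q r s)))))"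
  have "?t * (160 * \<delta>) = E (\<lambda>p. E (\<lambda>q. E (\<lambda>r. E (\<lambda>s. of_bool (induces_2K2 a p q r s) * (160 * \<delta>)))))"
    by (simp only: avg_multc)
  also have "\<dots> \<le> E (\<lambda>p. E (\<lambda>q. E (\<lambda>r. E (\<lambda>s. of_bool (induces_2K2 a p q r s) *
      E (\<lambda>x. E (\<lambda>y. of_bool (wrong a (part_of a p q r s) x y)))))))"
    by (intro E_mono mult_left_mono n) auto
  also have "\<dots> = E (\<lambda>p. E (\<lambda>q. E (\<lambda>r. E (\<lambda>s.
      E (\<lambda>x. E (\<lambda>y. of_bool (induces_2K2 a p q r s) * of_bool (wrong a (part_of a p q r s) x y)))))))"
    by (simp only: avg_cmult)
  also have "\<dots> \<le> E (\<lambda>p. E (\<lambda>q. E (\<lambda>r. E (\<lambda>s. E (\<lambda>x. E (\<lambda>y. of_bool (forbidden a {p, q, r, s, x})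
      + of_bool (forbidden a {p, q, r, s, y}) + of_bool (forbidden a {p, q, r, x, y}) + of_bool (forbidden a {p, r, s, x, y})))))))"
  proof (intro E_mono)
    fix p q r s x y
    show "of_bool (induces_2K2 a p q r s) * of_bool (wrong a (part_of a p q r s) x y)
      \<le> of_bool (forbidden a {p, q, r, s, x}) + of_bool (forbidden a {p, q, r, s, y})
       + of_bool (forbidden a {p, q, r, x, y}) + (of_bool (forbidden a {p, r, s, x, y}) :: real)"
      using wrong_forbidden[of p q r s x y] by (auto simp: of_bool_def)
  qed
  also have "\<dots> = E (\<lambda>x. forb a V w x) + E (\<lambda>x. forb a V w x) + E (\<lambda>x. forb a V w x) + E (\<lambda>x. forb a V w x)"
    unfolding forb_def by (simp only: avg_add E_const)
  also have "\<dots> \<le> 4 * \<delta>" using EF by linarith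
  finally have "?t * 40 * \<delta> \<le> 1 * \<delta>" by (simp add: mult_ac)
  then have "?t * 40 \<le> 1" using \<delta>(1) by (simp only: mult_le_cancel_right)
  then show False using E_2K2[OF \<delta>(2) F D] by simp
qed

end

locale finite_graph =
  fixes V :: "'v set" and a :: "'v \<Rightarrow> 'v \<Rightarrow> bool"
  assumes finite_V: "finite V" and V_ne: "V \<noteq> {}" and a_sym: "a x y \<longleftrightarrow> a y x" and a_irrefl: "\<not> a x x"

sublocale finite_graph \<subseteq> weighted_graph V a "unif V"
  by unfold_locales (use finite_V V_ne a_sym a_irrefl in \<open>auto simp: unif_def\<close>)

context finite_graph
begin

lemma E_eq: "E f = (\<Sum>x\<in>V. f x) / real (card V)"
  by (simp add: avg_def unif_def sum_divide_distrib)

lemma card_pos: "0 < card V"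
  using finite_V V_ne by (simp add: card_gt_0_iff)

lemma sum_wrong_split:
  assumes "x \<in> V"
  shows "(\<Sum>u\<in>V. \<Sum>v\<in>V. of_bool (wrong a f u v))
    = (\<Sum>u\<in>V - {x}. \<Sum>v\<in>V - {x}. of_bool (wrong a f u v)) + 2 * (\<Sum>v\<in>V. of_bool (wrong a f x v) :: nat)"
proof -
  have wx: "\<not> wrong a f x x" by (simp add: wrong_def a_irrefl pat_irrefl)
  have ws: "wrong a f u v = wrong a f v u" for u v using a_sym pat_sym by (simp add: wrong_def)
  have "(\<Sum>u\<in>V. \<Sum>v\<in>V. of_bool (wrong a f u v)) = (\<Sum>v\<in>V. of_bool (wrong a f x v))
      + (\<Sum>u\<in>V - {x}. \<Sum>v\<in>V. of_bool (wrong a f u v) :: nat)"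
    using sum.remove[OF finite_V assms] by blast
  also have "(\<Sum>u\<in>V - {x}. \<Sum>v\<in>V. of_bool (wrong a f u v))
      = (\<Sum>u\<in>V - {x}. of_bool (wrong a f u x) + (\<Sum>v\<in>V - {x}. of_bool (wrong a f u v) :: nat))"
    by (intro sum.cong refl sum.remove[OF finite_V assms])
  also have "\<dots> = (\<Sum>u\<in>V - {x}. of_bool (wrong a f x u)) + (\<Sum>u\<in>V - {x}. \<Sum>v\<in>V - {x}. of_bool (wrong a f u v))"
    by (simp only: sum.distrib ws[of _ x])
  also have "(\<Sum>u\<in>V - {x}. of_bool (wrong a f x u)) = (\<Sum>u\<in>V. of_bool (wrong a f x u) :: nat)"
    using sum.remove[OF finite_V assms, of "\<lambda>u. of_bool (wrong a f x u) :: nat"] wx by simp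
  finally show ?thesis by simp
qed

text \<open>
  Minimality of the number of wrong pairs makes every vertex lie in the part that suits it best.
\<close>

lemma exists_optimal_parts:
  assumes \<delta>: "0 < \<delta>" "\<delta> \<le> 1/1000"
    and F: "\<And>x. x \<in> V \<Longrightarrow> forb a V (unif V) x \<le> \<delta>" and D: "\<And>x. x \<in> V \<Longrightarrow> \<bar>deg a V (unif V) x - 1/3\<bar> \<le> \<delta>"
  obtains f :: "'v \<Rightarrow> nat" where "\<And>x. f x < 6" "E (\<lambda>x. E (\<lambda>y. of_bool (wrong a f x y))) \<le> 160 * \<delta>"
    "\<And>x k. x \<in> V \<Longrightarrow> k < 6 \<Longrightarrow> E (\<lambda>y. of_bool (wrong a f x y)) \<le> E (\<lambda>y. of_bool (a x y \<noteq> pat k (f y)))"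
proof -
  define cnt where "cnt f = (\<Sum>u\<in>V. \<Sum>v\<in>V. of_bool (wrong a f u v) :: nat)" for f
  have EE: "E (\<lambda>x. E (\<lambda>y. of_bool (wrong a f x y))) = real (cnt f) / real (card V)^2" for f
    by (simp add: E_eq cnt_def sum_divide_distrib[symmetric] power2_eq_square)
  from exists_2K2[OF \<delta> F D] obtain p q r s where
    0: "E (\<lambda>x. E (\<lambda>y. of_bool (wrong a (part_of a p q r s) x y))) \<le> 160 * \<delta>" by blast
  have "\<exists>f. (\<forall>x. f x < 6) \<and> (\<forall>g. (\<forall>x. g x < 6) \<longrightarrow> cnt f \<le> cnt g)"
    by (rule ex_has_least_nat[of _ "part_of a p q r s"]) (simp add: part_of_less)
  then obtain f where f: "\<And>x. f x < 6" and min: "\<And>g. (\<And>x. g x < 6) \<Longrightarrow> cnt f \<le> cnt g" by blast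
  show ?thesis
  proof (rule that[OF f])
    have "cnt f \<le> cnt (part_of a p q r s)" by (rule min) (rule part_of_less)
    then have "real (cnt f) / real (card V)^2 \<le> real (cnt (part_of a p q r s)) / real (card V)^2"
      by (intro divide_right_mono) auto
    then show "E (\<lambda>x. E (\<lambda>y. of_bool (wrong a f x y))) \<le> 160 * \<delta>" using 0 unfolding EE by linarith
    fix x and k :: nat assume x: "x \<in> V" and k: "k < 6"
    define g where "g = f(x := k)"
    have "cnt f \<le> cnt g" by (rule min) (auto simp: g_def f k)
    moreover have "(\<Sum>u\<in>V - {x}. \<Sum>v\<in>V - {x}. of_bool (wrong a g u v)) = (\<Sum>u\<in>V - {x}. \<Sum>v\<in>V - {x}. of_bool (wrong a f u v) :: nat)"
      by (intro sum.cong) (auto simp: g_def wrong_def)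
    ultimately have "(\<Sum>v\<in>V. of_bool (wrong a f x v) :: nat) \<le> (\<Sum>v\<in>V. of_bool (wrong a g x v))"
      unfolding cnt_def sum_wrong_split[OF x] by linarith
    also have "\<dots> \<le> (\<Sum>v\<in>V. of_bool (a x v \<noteq> pat k (f v)))"
      by (intro sum_mono) (auto simp: g_def wrong_def a_irrefl pat_irrefl)
    finally have "real (\<Sum>v\<in>V. of_bool (wrong a f x v) :: nat) \<le> real (\<Sum>v\<in>V. of_bool (a x v \<noteq> pat k (f v)))"
      by (simp only: of_nat_le_iff)
    then show "E (\<lambda>y. of_bool (wrong a f x y)) \<le> E (\<lambda>y. of_bool (a x y \<noteq> pat k (f y)))"
      unfolding E_eq by (intro divide_right_mono) auto
  qed
qed

end

section \<open>Sizes of the parts from the degrees\<close>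

lemma sum6: "(\<Sum>i<6. g i) = g 0 + g 1 + g 2 + g 3 + g 4 + g (5 :: nat)"
  by (simp add: eval_nat_numeral)

text \<open>\<open>a\<close>, \<open>b\<close>, \<open>c\<close> are the masses in one triangle, and
  a part that is not negligible fixes the sum of the other two at 1/3. A single such part is
  impossible; two have about 1/3 each, in total 2/3; three have about 1/6 each, in total
  1/2.\<close>

lemma three_parts:
  fixes a b c \<rho> :: real
  assumes "0 \<le> a" "0 \<le> b" "0 \<le> c" "\<rho> \<le> 1/100"
    and "a \<le> \<rho> \<or> \<bar>b + c - 1/3\<bar> \<le> \<rho>" "b \<le> \<rho> \<or> \<bar>a + c - 1/3\<bar> \<le> \<rho>" "c \<le> \<rho> \<or> \<bar>a + b - 1/3\<bar> \<le> \<rho>"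
  shows "a + b + c \<le> 3 * \<rho> \<or> \<bar>a + b + c - 2/3\<bar> \<le> 5 * \<rho> \<or>
    \<bar>a + b + c - 1/2\<bar> \<le> 2 * \<rho> \<and> \<bar>a - 1/6\<bar> \<le> 3 * \<rho> \<and> \<bar>b - 1/6\<bar> \<le> 3 * \<rho> \<and> \<bar>c - 1/6\<bar> \<le> 3 * \<rho>"
  using assms unfolding abs_le_iff
  by (elim disjE)
    ((rule disjI1, linarith) | (rule disjI2, rule disjI1, linarith) |
     (rule disjI2, rule disjI2, intro conjI; linarith))+

text \<open>The two triangles have totals near 0, 1/2 or 2/3 that add up to 1, which leaves only 1/2
  + 1/2.\<close>

lemma six_parts:
  fixes s :: "nat \<Rightarrow> real"
  assumes "\<And>i. 0 \<le> s i" "(\<Sum>i<6. s i) = 1" "\<rho> \<le> 1/100"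
    and D: "\<And>i. i < 6 \<Longrightarrow> s i \<le> \<rho> \<or> \<bar>(\<Sum>j<6. of_bool (pat i j) * s j) - 1/3\<bar> \<le> \<rho>"
    and i: "i < 6"
  shows "\<bar>s i - 1/6\<bar> \<le> 3 * \<rho>"
proof -
  have 1: "s 0 + s 1 + s 2 + s 3 + s 4 + s 5 = 1" using assms(2) unfolding sum6 .
  have A: "s 0 \<le> \<rho> \<or> \<bar>s 1 + s 2 - 1/3\<bar> \<le> \<rho>" "s 1 \<le> \<rho> \<or> \<bar>s 0 + s 2 - 1/3\<bar> \<le> \<rho>" "s 2 \<le> \<rho> \<or> \<bar>s 0 + s 1 - 1/3\<bar> \<le> \<rho>"
    and B: "s 3 \<le> \<rho> \<or> \<bar>s 4 + s 5 - 1/3\<bar> \<le> \<rho>" "s 4 \<le> \<rho> \<or> \<bar>s 3 + s 5 - 1/3\<bar> \<le> \<rho>" "s 5 \<le> \<rho> \<or> \<bar>s 3 + s 4 - 1/3\<bar> \<le> \<rho>"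
    using D[of 0] D[of 1] D[of 2] D[of 3] D[of 4] D[of 5] by (simp_all add: sum6 pat_def)
  note TA = three_parts[OF assms(1) assms(1) assms(1) assms(3) A]
  note TB = three_parts[OF assms(1) assms(1) assms(1) assms(3) B]
  have "i = 0 \<or> i = 1 \<or> i = 2 \<or> i = 3 \<or> i = 4 \<or> i = 5" using i by auto
  moreover have "\<bar>s 0 - 1/6\<bar> \<le> 3 * \<rho> \<and> \<bar>s 1 - 1/6\<bar> \<le> 3 * \<rho> \<and> \<bar>s 2 - 1/6\<bar> \<le> 3 * \<rho> \<and> \<bar>s 3 - 1/6\<bar> \<le> 3 * \<rho> \<and> \<bar>s 4 - 1/6\<bar> \<le> 3 * \<rho> \<and> \<bar>s 5 - 1/6\<bar> \<le> 3 * \<rho>"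
    using TA TB 1 assms(3) by (elim disjE conjE; intro conjI; linarith)
  ultimately show ?thesis by blast
qed

context weighted_graph
begin

text \<open>For independent \<open>p\<close>, \<open>q\<close>, \<open>r\<close>, \<open>s\<close>
  from the four classes, either one of the six pairs is wrong or the five vertices are forbidden.
  The classes will be the neighbours or nonneighbours of \<open>x\<close> within a part, so small
  products locate \<open>x\<close>.\<close>

lemma product_bound:
  assumes "\<And>p q r s. P p \<Longrightarrow> Q q \<Longrightarrow> R r \<Longrightarrow> S s \<Longrightarrow> \<not> wrong a f p q \<Longrightarrow> \<not> wrong a f p r \<Longrightarrow> \<not> wrong a f p s \<Longrightarrow>
      \<not> wrong a f q r \<Longrightarrow> \<not> wrong a f q s \<Longrightarrow> \<not> wrong a f r s \<Longrightarrow> forbidden a {x, p, q, r, s}"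
  shows "E (\<lambda>p. of_bool (P p)) * E (\<lambda>q. of_bool (Q q)) * E (\<lambda>r. of_bool (R r)) * E (\<lambda>s. of_bool (S s))
    \<le> forb a V w x + 6 * E (\<lambda>x. E (\<lambda>y. of_bool (wrong a f x y)))"
proof -
  let ?W = "\<lambda>x y. of_bool (wrong a f x y) :: real"
  have "E (\<lambda>p. of_bool (P p)) * E (\<lambda>q. of_bool (Q q)) * E (\<lambda>r. of_bool (R r)) * E (\<lambda>s. of_bool (S s))
     = E (\<lambda>p. E (\<lambda>q. E (\<lambda>r. E (\<lambda>s. of_bool (P p) * (of_bool (Q q) * (of_bool (R r) * of_bool (S s)))))))"
    by (simp only: avg_linear mult.assoc)
  also have "\<dots> \<le> E (\<lambda>p. E (\<lambda>q. E (\<lambda>r. E (\<lambda>s. of_bool (forbidden a {x, p, q, r, s})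
      + ?W p q + ?W p r + ?W p s + ?W q r + ?W q s + ?W r s))))"
  proof (intro E_mono)
    fix p q r s
    show "of_bool (P p) * (of_bool (Q q) * (of_bool (R r) * of_bool (S s))) \<le> of_bool (forbidden a {x, p, q, r, s})
      + ?W p q + ?W p r + ?W p s + ?W q r + ?W q s + ?W r s"
    proof (cases "P p \<and> Q q \<and> R r \<and> S s")
      case True
      then show ?thesis using assms[of p q r s] by (auto simp: of_bool_def)
    qed auto
  qed
  also have "\<dots> = forb a V w x + 6 * E (\<lambda>x. E (\<lambda>y. ?W x y))"
    by (simp only: avg_add E_const forb_def)
  finally show ?thesis .
qed

lemma E_parts:
  assumes "\<And>x. f x < (6 :: nat)"
  shows "E \<phi> = (\<Sum>i<6. E (\<lambda>v. of_bool (f v = i) * \<phi> v))"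
proof -
  have "E \<phi> = E (\<lambda>v. \<Sum>i<6. of_bool (f v = i) * \<phi> v)"
  proof (rule avg_cong)
    fix v
    have "(\<Sum>i<6. of_bool (f v = i) * \<phi> v) = (\<Sum>i<6. if f v = i then \<phi> v else 0)"
      by (intro sum.cong) auto
    then show "\<phi> v = (\<Sum>i<6. of_bool (f v = i) * \<phi> v)" using assms[of v] by simp
  qed
  then show ?thesis by (simp only: avg_sum)
qed

text \<open>Up to wrong pairs, a vertex of part \<open>j\<close> has as degree the mass of the parts
  adjacent to \<open>j\<close>. A tiny part says little about degrees, so averaging over part
  \<open>j\<close> bounds only a product; this is the origin of the alternatives in
  \<open>six_parts\<close>.\<close>

lemma parts_balanced:
  assumes f: "\<And>x. f x < 6" and \<delta>: "0 \<le> \<delta>" and \<rho>: "0 < \<rho>" "\<rho> \<le> 1/100"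
    and D: "\<And>x. x \<in> V \<Longrightarrow> \<bar>deg a V w x - 1/3\<bar> \<le> \<delta>"
    and W: "E (\<lambda>x. E (\<lambda>y. of_bool (wrong a f x y))) \<le> \<theta>"
    and \<kappa>: "\<delta> + \<theta> \<le> \<rho>^2" and i: "i < 6"
  shows "\<bar>E (\<lambda>v. of_bool (f v = i)) - 1/6\<bar> \<le> 3 * \<rho>"
proof -
  define s where "s j = E (\<lambda>v. of_bool (f v = j))" for j
  define d where "d j = (\<Sum>k<6. of_bool (pat j k) * s k)" for j
  have dev: "\<bar>d (f x) - 1/3\<bar> \<le> \<delta> + E (\<lambda>y. of_bool (wrong a f x y))" if "x \<in> V" for x
  proof -
    have d_eq: "d j = E (\<lambda>y. of_bool (pat j (f y)))" for j
    proof -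
      have "E (\<lambda>y. of_bool (pat j (f y))) = (\<Sum>k<6. E (\<lambda>v. of_bool (f v = k) * of_bool (pat j (f v))))"
        by (rule E_parts[OF f])
      also have "\<dots> = (\<Sum>k<6. of_bool (pat j k) * s k)"
      proof (intro sum.cong refl)
        fix k
        have "E (\<lambda>v. of_bool (f v = k) * of_bool (pat j (f v))) = E (\<lambda>v. of_bool (pat j k) * of_bool (f v = k))"
          by (intro avg_cong) auto
        then show "E (\<lambda>v. of_bool (f v = k) * of_bool (pat j (f v))) = of_bool (pat j k) * s k"
          by (simp only: avg_cmult s_def)
      qed
      finally show ?thesis by (simp only: d_def)
    qed
    have "d (f x) - deg a V w x \<le> E (\<lambda>y. of_bool (wrong a f x y))"
      unfolding d_eq deg_def avg_linear[symmetric] by (intro E_mono) (auto simp: wrong_def)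
    moreover have "deg a V w x - d (f x) \<le> E (\<lambda>y. of_bool (wrong a f x y))"
      unfolding d_eq deg_def avg_linear[symmetric] by (intro E_mono) (auto simp: wrong_def)
    ultimately show ?thesis using D[OF that] by linarith
  qed
  have sd: "s j * \<bar>d j - 1/3\<bar> \<le> \<rho>^2" for j
  proof -
    have "s j * \<bar>d j - 1/3\<bar> = E (\<lambda>x. of_bool (f x = j) * \<bar>d j - 1/3\<bar>)" by (simp only: avg_multc s_def)
    also have "\<dots> \<le> E (\<lambda>x. \<delta> + E (\<lambda>y. of_bool (wrong a f x y)))"
    proof (rule E_mono)
      fix x assume "x \<in> V"
      from dev[OF this] show "of_bool (f x = j) * \<bar>d j - 1/3\<bar> \<le> \<delta> + E (\<lambda>y. of_bool (wrong a f x y))"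
        using \<delta> by (cases "f x = j") (auto intro!: add_nonneg_nonneg E_ge_0)
    qed
    also have "\<dots> \<le> \<rho>^2" using W \<kappa> by (simp add: avg_add)
    finally show ?thesis .
  qed
  have dich: "s j \<le> \<rho> \<or> \<bar>d j - 1/3\<bar> \<le> \<rho>" for j
  proof (rule ccontr)
    assume "\<not> ?thesis"
    then have "\<rho> * \<rho> < s j * \<bar>d j - 1/3\<bar>" using \<rho> by (intro mult_strict_mono) auto
    then show False using sd[of j] by (simp add: power2_eq_square)
  qed
  show ?thesis
    unfolding s_def[symmetric]
  proof (rule six_parts[OF _ _ \<rho>(2) _ i])
    show "0 \<le> s j" for j unfolding s_def by (intro E_ge_0) simp
    show "(\<Sum>j<6. s j) = 1" using E_parts[OF f, of "\<lambda>_. 1"] by (simp add: s_def)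
    show "s j \<le> \<rho> \<or> \<bar>(\<Sum>k<6. of_bool (pat j k) * s k) - 1/3\<bar> \<le> \<rho>" for j
      using dich[of j] by (simp only: d_def)
  qed
qed

lemma product_dichotomy: "0 \<le> r \<Longrightarrow> x * y \<le> r^2 \<Longrightarrow> x \<le> r \<or> y \<le> (r::real)"
  using mult_strict_mono[of r x r y] by (fastforce simp: power2_eq_square)

text \<open>Many neighbours in both triangles would create P_4s or paws, and many nonneighbours on
  edges of both would create copies of 2K_2 plus an isolated vertex. So \<open>x\<close> has almost
  no neighbours in one triangle and many nonneighbours in at most one part of the other; since its
  degree is about 1/3, it misses that part almost entirely.\<close>

lemma small_defect:
  assumes f: "\<And>x. f x < 6" and x: "x \<in> V"
    and D: "\<bar>deg a V w x - 1/3\<bar> \<le> 1/10^15"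
    and F: "forb a V w x \<le> 1/10^15"
    and W: "E (\<lambda>x. E (\<lambda>y. of_bool (wrong a f x y))) \<le> 160/10^15"
    and S: "\<And>i. i < 6 \<Longrightarrow> \<bar>E (\<lambda>v. of_bool (f v = i)) - 1/6\<bar> \<le> 3/100000"
  shows "\<exists>k<6. E (\<lambda>y. of_bool (a x y \<noteq> pat k (f y))) \<le> 1/1000"
proof -
  define s where "s j = E (\<lambda>v. of_bool (f v = j))" for j
  define y where "y j = E (\<lambda>v. of_bool (f v = j \<and> a x v))" for j
  define z where "z j = E (\<lambda>v. of_bool (f v = j \<and> \<not> a x v))" for j
  have s: "s j = y j + z j" for j
    unfolding s_def y_def z_def avg_add[symmetric] by (intro avg_cong) auto
  have y0: "0 \<le> y j" and z0: "0 \<le> z j" for j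
    unfolding y_def z_def by (intro E_ge_0; simp)+
  have S': "\<bar>s j - 1/6\<bar> \<le> 3/100000" if "j < 6" for j using S[OF that] by (simp only: s_def)
  have deg: "deg a V w x = y 0 + y 1 + y 2 + y 3 + y 4 + y 5"
    using E_parts[OF f, of "\<lambda>y. of_bool (a x y)"] by (simp add: deg_def sum6 y_def of_bool_conj)
  have def_k: "E (\<lambda>v. of_bool (a x v \<noteq> pat k (f v))) = (\<Sum>j<6. if pat k j then z j else y j)" for k
  proof -
    have "E (\<lambda>v. of_bool (a x v \<noteq> pat k (f v))) = (\<Sum>j<6. E (\<lambda>v. of_bool (f v = j) * of_bool (a x v \<noteq> pat k (f v))))"
      by (rule E_parts[OF f])
    also have "\<dots> = (\<Sum>j<6. if pat k j then z j else y j)"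
      by (intro sum.cong refl) (auto simp: y_def z_def intro!: avg_cong)
    finally show ?thesis .
  qed
  \<comment> \<open>The bound 961 = 1 + 6 * 160 collects the forbidden density and the six wrong
    pairs. Three classes suffice here, so the fourth is the whole vertex set.\<close>
  have yys: "y i * y j * s k \<le> 961/10^15" if "pat i k" "\<not> pat i j" "\<not> pat j k" for i j k
  proof -
    have "y i * y j * s k * E (\<lambda>_. of_bool True) \<le> forb a V w x + 6 * E (\<lambda>x. E (\<lambda>y. of_bool (wrong a f x y)))"
      unfolding y_def s_def
      by (rule product_bound) (use that in \<open>auto simp: wrong_def intro: forbidden_paw[of x]\<close>)
    then show ?thesis using F W by simp
  qed
  have zzzz: "z i * z i' * z j * z j' \<le> 961/10^15"
    if "pat i i'" "pat j j'" "\<not> pat i j" "\<not> pat i j'" "\<not> pat i' j" "\<not> pat i' j'" for i i' j j'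
  proof -
    have "z i * z i' * z j * z j' \<le> forb a V w x + 6 * E (\<lambda>x. E (\<lambda>y. of_bool (wrong a f x y)))"
      unfolding z_def
    proof (rule product_bound)
      fix p q r t
      assume "f p = i \<and> \<not> a x p" "f q = i' \<and> \<not> a x q" "f r = j \<and> \<not> a x r" "f t = j' \<and> \<not> a x t"
        "\<not> wrong a f p q" "\<not> wrong a f p r" "\<not> wrong a f p t" "\<not> wrong a f q r" "\<not> wrong a f q t" "\<not> wrong a f r t"
      then show "forbidden a {x, p, q, r, t}"
        using that by (intro forbidden_2K2_K1[of x _ p q r t]) (auto simp: wrong_def)
    qed
    then show ?thesis using F W by simp
  qed
  have yy: "y i \<le> 1/100000 \<or> y j \<le> 1/100000" if "i < 6" "j < 6" "i < 3 \<longleftrightarrow> \<not> j < 3" for i j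
  proof (rule product_dichotomy)
    \<comment> \<open>Another part in the triangle of \<open>i\<close>, hence adjacent to
      \<open>i\<close> but not to \<open>j\<close>.\<close>
    define k :: nat where "k = (if i = 0 then 1 else if i < 3 then 0 else if i = 3 then 4 else 3)"
    have k: "k < 6" "pat i k" "\<not> pat i j" "\<not> pat j k"
      using that by (auto simp: pat_def k_def)
    have "1/7 \<le> s k" using S'[OF k(1)] by linarith
    then have "y i * y j * (1/7) \<le> y i * y j * s k" using y0 by (intro mult_left_mono) auto
    also have "\<dots> \<le> 961/10^15" by (rule yys[OF k(2-4)])
    finally show "y i * y j \<le> (1/100000)^2" by (simp add: power2_eq_square)
  qed simp
  have D': "\<bar>deg a V w x - 1/3\<bar> \<le> 1/1000000" by (rule order_trans[OF D]) simp
  \<comment> \<open>In the triangle of the \<open>j\<close>s almost everything is a nonneighbour of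
    \<open>x\<close>, which supplies one edge; two parts with many nonneighbours in the triangle of
    the \<open>i\<close>s would supply the other.\<close>
  have side: "\<exists>k\<in>{i0, i1, i2}. z i0 + z i1 + z i2 - z k + y k + (y j0 + y j1 + y j2) \<le> 1/1000"
    if i: "{i0, i1, i2, j0, j1, j2} \<subseteq> {..<6}" "pat i0 i1" "pat i0 i2" "pat i1 i2" "pat j0 j1"
      "\<forall>i\<in>{i0, i1, i2}. \<forall>j\<in>{j0, j1}. \<not> pat i j"
      and small: "y j0 \<le> 1/100000" "y j1 \<le> 1/100000" "y j2 \<le> 1/100000"
      and d: "deg a V w x = y i0 + y i1 + y i2 + (y j0 + y j1 + y j2)" for i0 i1 i2 j0 j1 j2
  proof -
    have zj: "1/7 \<le> z j0" "1/7 \<le> z j1"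
    proof -
      have "j0 < 6" "j1 < 6" using i(1) by auto
      then show "1/7 \<le> z j0" "1/7 \<le> z j1"
        using S'[of j0] S'[of j1] s[of j0] s[of j1] small by linarith+
    qed
    have zz: "z i \<le> 1/100000 \<or> z i' \<le> 1/100000" if "pat i i'" "i \<in> {i0, i1, i2}" "i' \<in> {i0, i1, i2}" for i i'
    proof (rule product_dichotomy)
      have "z i * z i' * (1/7 * (1/7)) \<le> z i * z i' * (z j0 * z j1)"
        using z0 zj by (intro mult_left_mono mult_mono) auto
      also have "\<dots> = z i * z i' * z j0 * z j1" by simp
      also have "\<dots> \<le> 961/10^15" using that i by (intro zzzz) auto
      finally show "z i * z i' \<le> (1/100000)^2" by (simp add: power2_eq_square)
    qed simp
    have z3: "z i0 \<le> 1/100000 \<or> z i1 \<le> 1/100000" "z i0 \<le> 1/100000 \<or> z i2 \<le> 1/100000" "z i1 \<le> 1/100000 \<or> z i2 \<le> 1/100000"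
      using zz i by auto
    have sz: "\<bar>y i0 + z i0 - 1/6\<bar> \<le> 3/100000" "\<bar>y i1 + z i1 - 1/6\<bar> \<le> 3/100000" "\<bar>y i2 + z i2 - 1/6\<bar> \<le> 3/100000"
      using S'[of i0] S'[of i1] S'[of i2] i(1) by (simp_all add: s)
    from z3 consider "z i0 \<le> 1/100000" "z i1 \<le> 1/100000" | "z i0 \<le> 1/100000" "z i2 \<le> 1/100000" | "z i1 \<le> 1/100000" "z i2 \<le> 1/100000"
      by blast
    then show ?thesis
    proof cases
      case 1 then show ?thesis
        using D'[unfolded d] small y0[of j0] y0[of j1] y0[of j2] sz by (intro bexI[of _ i2]) (linarith | simp)+
    next
      case 2 then show ?thesis
        using D'[unfolded d] small y0[of j0] y0[of j1] y0[of j2] sz by (intro bexI[of _ i1]) (linarith | simp)+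
    next
      case 3 then show ?thesis
        using D'[unfolded d] small y0[of j0] y0[of j1] y0[of j2] sz by (intro bexI[of _ i0]) (linarith | simp)+
    qed
  qed
  have "(y 0 \<le> 1/100000 \<and> y 1 \<le> 1/100000 \<and> y 2 \<le> 1/100000) \<or> (y 3 \<le> 1/100000 \<and> y 4 \<le> 1/100000 \<and> y 5 \<le> 1/100000)"
    using yy[of 0 3] yy[of 0 4] yy[of 0 5] yy[of 1 3] yy[of 1 4] yy[of 1 5] yy[of 2 3] yy[of 2 4] yy[of 2 5] by auto
  then show ?thesis
  proof
    assume "y 3 \<le> 1/100000 \<and> y 4 \<le> 1/100000 \<and> y 5 \<le> 1/100000"
    then have "\<exists>k\<in>{0, 1, 2}. z 0 + z 1 + z 2 - z k + y k + (y 3 + y 4 + y 5) \<le> 1/1000"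
      by (intro side) (auto simp: pat_def deg)
    then show ?thesis unfolding def_k sum6 by (elim bexE) (rule_tac x=k in exI, auto simp: pat_def)
  next
    assume "y 0 \<le> 1/100000 \<and> y 1 \<le> 1/100000 \<and> y 2 \<le> 1/100000"
    then have "\<exists>k\<in>{3, 4, 5}. z 3 + z 4 + z 5 - z k + y k + (y 0 + y 1 + y 2) \<le> 1/1000"
      by (intro side) (auto simp: pat_def deg)
    then show ?thesis unfolding def_k sum6 by (elim bexE) (rule_tac x=k in exI, auto simp: pat_def)
  qed
qed

end

context finite_graph
begin

text \<open>With \<delta> = 10^-15 the wrong pairs have density at most 160 \<delta>, balance needs
  161 \<delta> <= (10^-5)^2, and the admissible deficit (\<delta>^2/5000)^2 = 4 * 10^-68 exceeds
  10^-70. Optimality of \<open>f\<close> transfers the bound for some part to the part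
  \<open>f x\<close>.\<close>

theorem exists_parts:
  assumes dens: "1/2 - 1/10^70 \<le> dens a V (unif V)"
    and at: "\<And>x. x \<in> V \<Longrightarrow> 1/2 - 1/10^70 \<le> dens_at a V (unif V) x"
  obtains f :: "'v \<Rightarrow> nat" where "\<And>x. f x < 6" "\<And>i. i < 6 \<Longrightarrow> \<bar>E (\<lambda>v. of_bool (f v = i)) - 1/6\<bar> \<le> 1/1000"
    "\<And>x. x \<in> V \<Longrightarrow> E (\<lambda>y. of_bool (wrong a f x y)) \<le> 1/1000"
proof -
  have le: "1/2 - ((1/10^15)^2/5000)^2 \<le> 1/2 - (1/10^70 :: real)" by (simp add: power2_eq_square)
  have F: "forb a V (unif V) x \<le> 1/10^15" and D: "\<bar>deg a V (unif V) x - 1/3\<bar> \<le> 1/10^15" if "x \<in> V" for x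
    using rooted_close[of x "1/10^15"] that order_trans[OF le dens] order_trans[OF le at[OF that]] by simp_all
  have "0 < 1/(10 :: real)^15" "1/10^15 \<le> (1/1000 :: real)" by simp_all
  from exists_optimal_parts[OF this F D] obtain f where f: "\<And>x. f x < 6"
    and W: "E (\<lambda>x. E (\<lambda>y. of_bool (wrong a f x y))) \<le> 160 * (1/10^15)"
    and opt: "\<And>x k. x \<in> V \<Longrightarrow> k < 6 \<Longrightarrow> E (\<lambda>y. of_bool (wrong a f x y)) \<le> E (\<lambda>y. of_bool (a x y \<noteq> pat k (f y)))"
    by blast
  have S: "\<bar>E (\<lambda>v. of_bool (f v = i)) - 1/6\<bar> \<le> 3/100000" if "i < 6" for i
    using parts_balanced[OF f _ _ _ D W _ that, of "1/100000"] by (simp add: power2_eq_square)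
  show ?thesis
  proof (rule that[OF f])
    fix i :: nat assume "i < 6"
    from S[OF this] show "\<bar>E (\<lambda>v. of_bool (f v = i)) - 1/6\<bar> \<le> 1/1000" by simp
  next
    fix x assume x: "x \<in> V"
    from small_defect[OF f x D[OF x] F[OF x] _ S] W
    obtain k where "k < 6" "E (\<lambda>y. of_bool (a x y \<noteq> pat k (f y))) \<le> 1/1000" by auto
    with opt[OF x] show "E (\<lambda>y. of_bool (wrong a f x y)) \<le> 1/1000" by (meson order_trans)
  qed
qed

end

section \<open>Counting four-sets\<close>

definition adj :: "'v set set \<Rightarrow> 'v \<Rightarrow> 'v \<Rightarrow> bool" where
  "adj Ed u v \<longleftrightarrow> {u, v} \<in> Ed"

definition spans2 :: "'v set set \<Rightarrow> 'v set \<Rightarrow> bool" where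
  "spans2 Ed S \<longleftrightarrow> card {e \<in> Ed. e \<subseteq> S} = 2"

definition quads :: "'v set \<Rightarrow> 'v set set \<Rightarrow> 'v set \<Rightarrow> 'v set set" where
  "quads V Ed A = {S. A \<subseteq> S \<and> S \<subseteq> V \<and> card S = 4 \<and> spans2 Ed S}"

lemma adj_sym: "adj Ed u v \<longleftrightarrow> adj Ed v u"
  by (simp add: adj_def insert_commute)

lemma adj_irrefl: "\<forall>e\<in>Ed. card e = 2 \<Longrightarrow> \<not> adj Ed u u"
  by (auto simp: adj_def)

lemma spans2_iff:
  assumes Ed: "\<forall>e\<in>Ed. card e = 2" and d: "distinct [x, y, z, u]"
  shows "spans2 Ed {x, y, z, u} \<longleftrightarrow> two_edges (adj Ed) x y z u"
proof -
  let ?ps = "[{x, y}, {x, z}, {x, u}, {y, z}, {y, u}, {z, u}]"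
  have eq: "{e \<in> Ed. e \<subseteq> {x, y, z, u}} = set (filter (\<lambda>e. e \<in> Ed) ?ps)"
  proof (intro set_eqI iffI)
    fix e assume e: "e \<in> {e \<in> Ed. e \<subseteq> {x, y, z, u}}"
    then have "card e = 2" using Ed by blast
    then obtain p q where pq: "e = {p, q}" "p \<noteq> q" unfolding card_2_iff by blast
    then have "p \<in> {x, y, z, u}" "q \<in> {x, y, z, u}" using e by auto
    then have "{p, q} \<in> set ?ps" using pq(2)
      by (elim insertE emptyE; hypsubst_thin; simp add: insert_commute)
    then show "e \<in> set (filter (\<lambda>e. e \<in> Ed) ?ps)" using e pq(1) by (simp only: set_filter mem_Collect_eq)
  next
    fix e assume "e \<in> set (filter (\<lambda>e. e \<in> Ed) ?ps)"
    then have "e \<in> Ed" "e \<in> set ?ps" by (simp_all only: set_filter mem_Collect_eq)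
    then show "e \<in> {e \<in> Ed. e \<subseteq> {x, y, z, u}}" by auto
  qed
  have dist: "distinct (filter (\<lambda>e. e \<in> Ed) ?ps)"
    using d by (intro distinct_filter) (auto simp: doubleton_eq_iff)
  have "card {e \<in> Ed. e \<subseteq> {x, y, z, u}} = length (filter (\<lambda>e. e \<in> Ed) ?ps)"
    unfolding eq by (rule distinct_card[OF dist])
  then show ?thesis by (simp add: spans2_def two_edges_def adj_def)
qed

lemma card_ordered:
  assumes W: "finite W"
  shows "card {xs. length xs = k \<and> distinct xs \<and> set xs \<subseteq> W \<and> P (set xs)} = fact k * card {T. T \<subseteq> W \<and> card T = k \<and> P T}"
proof -
  let ?I = "{T. T \<subseteq> W \<and> card T = k \<and> P T}"
  have fin: "finite ?I" using W by auto
  have "{xs. length xs = k \<and> distinct xs \<and> set xs \<subseteq> W \<and> P (set xs)} = (\<Union>T\<in>?I. permutations_of_set T)"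
    by (auto simp: permutations_of_set_def distinct_card)
  also have "card \<dots> = (\<Sum>T\<in>?I. card (permutations_of_set T))"
    by (rule card_UN_disjoint) (use fin in \<open>auto dest: permutations_of_setD\<close>)
  also have "\<dots> = (\<Sum>T\<in>?I. fact k)"
    using W by (intro sum.cong) (auto simp: finite_subset)
  finally show ?thesis by simp
qed

lemma sum_lists_Suc:
  assumes "finite V"
  shows "(\<Sum>xs | length xs = Suc k \<and> set xs \<subseteq> V. g xs) = (\<Sum>x\<in>V. \<Sum>xs | length xs = k \<and> set xs \<subseteq> V. (g (x # xs) :: real))"
proof -
  have "(\<Sum>xs | length xs = Suc k \<and> set xs \<subseteq> V. g xs) = (\<Sum>(x, xs)\<in>V \<times> {xs. length xs = k \<and> set xs \<subseteq> V}. g (x # xs))"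
    by (rule sum.reindex_bij_witness[of _ "\<lambda>(x, xs). x # xs" "\<lambda>xs. (hd xs, tl xs)"]) (auto simp: length_Suc_conv)
  then show ?thesis by (simp add: sum.cartesian_product)
qed

lemma sum_lists_0: "(\<Sum>xs | length xs = 0 \<and> set xs \<subseteq> V. g xs) = (g [] :: real)"
proof -
  have "{xs. length xs = 0 \<and> set xs \<subseteq> V} = {[]}" by auto
  then show ?thesis by simp
qed

lemma sum_lists2:
  assumes "finite V"
  shows "(\<Sum>xs | length xs = 2 \<and> set xs \<subseteq> V. g xs) = (\<Sum>x\<in>V. \<Sum>y\<in>V. (g [x, y] :: real))"
  unfolding numeral_2_eq_2 sum_lists_Suc[OF assms] sum_lists_0 by (rule refl)

lemma sum_lists3:
  assumes "finite V"
  shows "(\<Sum>xs | length xs = 3 \<and> set xs \<subseteq> V. g xs) = (\<Sum>x\<in>V. \<Sum>y\<in>V. \<Sum>z\<in>V. (g [x, y, z] :: real))"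
  unfolding numeral_3_eq_3 sum_lists_Suc[OF assms] sum_lists_0 by (rule refl)

lemma sum_lists4:
  assumes "finite V"
  shows "(\<Sum>xs | length xs = 4 \<and> set xs \<subseteq> V. g xs) = (\<Sum>x\<in>V. \<Sum>y\<in>V. \<Sum>z\<in>V. \<Sum>u\<in>V. (g [x, y, z, u] :: real))"
proof -
  have "4 = Suc 3" by simp
  then show ?thesis unfolding sum_lists3[OF assms, symmetric] by (simp only: sum_lists_Suc[OF assms] sum_lists3[OF assms])
qed

text \<open>Each four-set containing \<open>A\<close> arises from k! orderings of its remaining
  vertices. Used with \<open>A\<close> of size 0, 1 and 2, for the four-sets in all, at a vertex and
  at a pair.\<close>

lemma sum_ordered:
  assumes V: "finite V" and A: "A \<subseteq> V" and k: "card A + k = 4"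
  shows "(\<Sum>xs | length xs = k \<and> set xs \<subseteq> V. of_bool (distinct xs \<and> set xs \<inter> A = {} \<and> spans2 Ed (A \<union> set xs)))
    = fact k * real (card (quads V Ed A))"
proof -
  have finA: "finite A" using A V by (rule finite_subset)
  have fl: "finite {xs. length xs = k \<and> set xs \<subseteq> V}"
    using finite_lists_length_eq[OF V, of k] by (simp add: conj_commute)
  have "(\<Sum>xs | length xs = k \<and> set xs \<subseteq> V. of_bool (distinct xs \<and> set xs \<inter> A = {} \<and> spans2 Ed (A \<union> set xs)))
      = real (card ({xs. length xs = k \<and> set xs \<subseteq> V} \<inter> {xs. distinct xs \<and> set xs \<inter> A = {} \<and> spans2 Ed (A \<union> set xs)}))"
    using fl by (simp only: sum_of_bool_eq)
  also have "{xs. length xs = k \<and> set xs \<subseteq> V} \<inter> {xs. distinct xs \<and> set xs \<inter> A = {} \<and> spans2 Ed (A \<union> set xs)}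
      = {xs. length xs = k \<and> distinct xs \<and> set xs \<subseteq> V - A \<and> spans2 Ed (A \<union> set xs)}"
    by auto
  also have "card \<dots> = fact k * card {T. T \<subseteq> V - A \<and> card T = k \<and> spans2 Ed (A \<union> T)}"
    using V by (intro card_ordered) auto
  also have "card {T. T \<subseteq> V - A \<and> card T = k \<and> spans2 Ed (A \<union> T)} = card (quads V Ed A)"
  proof (rule bij_betw_same_card[of "\<lambda>T. A \<union> T"], rule bij_betw_byWitness[where f' = "\<lambda>S. S - A"], goal_cases)
    case 3
    show ?case
    proof (intro image_subsetI)
      fix T assume T: "T \<in> {T. T \<subseteq> V - A \<and> card T = k \<and> spans2 Ed (A \<union> T)}"
      then have "finite T" using V by (auto intro: finite_subset)
      then have "card (A \<union> T) = card A + card T" using T finA by (intro card_Un_disjoint) auto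
      then show "A \<union> T \<in> quads V Ed A" using T A k by (auto simp: quads_def)
    qed
  next
    case 4
    show ?case
    proof (intro image_subsetI)
      fix S assume S: "S \<in> quads V Ed A"
      then have "card (S - A) = card S - card A" using finA by (intro card_Diff_subset) (auto simp: quads_def)
      moreover have "A \<union> (S - A) = S" using S by (auto simp: quads_def)
      ultimately show "S - A \<in> {T. T \<subseteq> V - A \<and> card T = k \<and> spans2 Ed (A \<union> T)}"
        using S k by (auto simp: quads_def)
    qed
  qed (auto simp: quads_def)
  finally show ?thesis by simp
qed

locale vgraph =
  fixes V :: "'v set" and Ed :: "'v set set"
  assumes fin_V: "finite V" and ne: "V \<noteq> {}" and Ed2: "\<forall>e\<in>Ed. card e = 2"

sublocale vgraph \<subseteq> finite_graph V "adj Ed"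
  by unfold_locales (fact fin_V, fact ne, rule adj_sym, rule adj_irrefl[OF Ed2])

context vgraph
begin

abbreviation n :: real where "n \<equiv> real (card V)"

lemma n_pos: "0 < n"
  using card_pos by simp

lemma E_delta: "x \<in> V \<Longrightarrow> E (\<lambda>y. of_bool (y = x)) = 1 / n"
  using fin_V by (simp add: E_eq)

lemma count4: "E (\<lambda>x. E (\<lambda>y. E (\<lambda>z. E (\<lambda>u. of_bool (distinct [x, y, z, u] \<and> two_edges (adj Ed) x y z u)))))
   = 24 * real (card (quads V Ed {})) / n^4"
proof -
  have pw: "(distinct [x, y, z, u] \<and> set [x, y, z, u] \<inter> {} = {} \<and> spans2 Ed ({} \<union> set [x, y, z, u]))
    \<longleftrightarrow> distinct [x, y, z, u] \<and> two_edges (adj Ed) x y z u" for x y z u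
    using spans2_iff[OF Ed2, of x y z u] by (cases "distinct [x, y, z, u]") auto
  have "fact 4 * real (card (quads V Ed {}))
      = (\<Sum>x\<in>V. \<Sum>y\<in>V. \<Sum>z\<in>V. \<Sum>u\<in>V. of_bool (distinct [x, y, z, u] \<and> two_edges (adj Ed) x y z u))"
    by (subst sum_ordered[OF fin_V, symmetric]) (simp_all only: sum_lists4[OF fin_V] pw card.empty add_0 empty_subsetI)
  then show ?thesis
    by (simp only: E_eq sum_divide_distrib[symmetric]) (simp add: power4_eq_xxxx fact_numeral)
qed

lemma count3:
  assumes x: "x \<in> V"
  shows "E (\<lambda>y. E (\<lambda>z. E (\<lambda>u. of_bool (distinct [x, y, z, u] \<and> two_edges (adj Ed) x y z u))))
   = 6 * real (card (quads V Ed {x})) / n^3"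
proof -
  have pw: "(distinct [y, z, u] \<and> set [y, z, u] \<inter> {x} = {} \<and> spans2 Ed ({x} \<union> set [y, z, u]))
    \<longleftrightarrow> distinct [x, y, z, u] \<and> two_edges (adj Ed) x y z u" for y z u
  proof -
    have eq: "{x} \<union> set [y, z, u] = {x, y, z, u}" by auto
    show ?thesis
      unfolding eq using spans2_iff[OF Ed2, of x y z u] by (cases "distinct [x, y, z, u]") auto
  qed
  have "(\<Sum>xs | length xs = 3 \<and> set xs \<subseteq> V. of_bool (distinct xs \<and> set xs \<inter> {x} = {} \<and> spans2 Ed ({x} \<union> set xs)))
    = fact 3 * real (card (quads V Ed {x}))"
    using x by (intro sum_ordered[OF fin_V]) auto
  then have "fact 3 * real (card (quads V Ed {x}))
      = (\<Sum>y\<in>V. \<Sum>z\<in>V. \<Sum>u\<in>V. of_bool (distinct [x, y, z, u] \<and> two_edges (adj Ed) x y z u))"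
    by (simp only: sum_lists3[OF fin_V] pw)
  then show ?thesis
    by (simp only: E_eq sum_divide_distrib[symmetric]) (simp add: power3_eq_cube fact_numeral)
qed

lemma count2:
  assumes "x \<in> V" "y \<in> V" "x \<noteq> y"
  shows "E (\<lambda>z. E (\<lambda>u. of_bool (distinct [x, y, z, u] \<and> two_edges (adj Ed) x y z u)))
   = 2 * real (card (quads V Ed {x, y})) / n^2"
proof -
  have pw: "(distinct [z, u] \<and> set [z, u] \<inter> {x, y} = {} \<and> spans2 Ed ({x, y} \<union> set [z, u]))
    \<longleftrightarrow> distinct [x, y, z, u] \<and> two_edges (adj Ed) x y z u" for z u
  proof -
    have eq: "{x, y} \<union> set [z, u] = {x, y, z, u}" by auto
    show ?thesis
      unfolding eq using spans2_iff[OF Ed2, of x y z u] assms by (cases "distinct [x, y, z, u]") auto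
  qed
  have "(\<Sum>xs | length xs = 2 \<and> set xs \<subseteq> V. of_bool (distinct xs \<and> set xs \<inter> {x, y} = {} \<and> spans2 Ed ({x, y} \<union> set xs)))
    = fact 2 * real (card (quads V Ed {x, y}))"
    using assms by (intro sum_ordered[OF fin_V]) auto
  then have "fact 2 * real (card (quads V Ed {x, y}))
      = (\<Sum>z\<in>V. \<Sum>u\<in>V. of_bool (distinct [x, y, z, u] \<and> two_edges (adj Ed) x y z u))"
    by (simp only: sum_lists2[OF fin_V] pw)
  then show ?thesis
    by (simp only: E_eq sum_divide_distrib[symmetric]) (simp add: power2_eq_square fact_numeral)
qed

lemma quads_le_dens: "24 * real (card (quads V Ed {})) / n^4 \<le> dens (adj Ed) V (unif V)"
  unfolding count4[symmetric] dens_def by (intro E_mono) auto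

lemma quads_at_le_dens_at: "x \<in> V \<Longrightarrow> 6 * real (card (quads V Ed {x})) / n^3 \<le> dens_at (adj Ed) V (unif V) x"
  unfolding count3[symmetric] dens_at_def by (intro E_mono) auto

lemma dens_le_half: "dens (adj Ed) V (unif V) \<le> 1/2"
proof -
  have "0 \<le> 1/600 * E (forb (adj Ed) V (unif V)) + 9/10 * E (\<lambda>x. (deg (adj Ed) V (unif V) x - 1/3)^2)"
    unfolding forb_def by (intro add_nonneg_nonneg mult_nonneg_nonneg E_ge_0) auto
  then show ?thesis using certificate by linarith
qed

text \<open>Tuples with a repeated vertex have density at most 6/n: 1/n for each of the six pairs of
  positions.\<close>

lemma dens_le_quads: "dens (adj Ed) V (unif V) \<le> 24 * real (card (quads V Ed {})) / n^4 + 6 / n"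
proof -
  let ?D = "\<lambda>x y. of_bool (y = x) :: real"
  have "dens (adj Ed) V (unif V) \<le> E (\<lambda>x. E (\<lambda>y. E (\<lambda>z. E (\<lambda>u. of_bool (distinct [x, y, z, u] \<and> two_edges (adj Ed) x y z u)
     + ?D x y + ?D x z + ?D x u + ?D y z + ?D y u + ?D z u))))"
    unfolding dens_def by (intro E_mono) auto
  also have "\<dots> = 24 * real (card (quads V Ed {})) / n^4 + 6 * E (\<lambda>x. E (\<lambda>y. ?D x y))"
    by (simp only: avg_add E_const count4)
  also have "E (\<lambda>x. E (\<lambda>y. ?D x y)) = E (\<lambda>x. 1 / n)"
    by (intro avg_cong E_delta)
  finally show ?thesis by simp
qed

lemma quads_pair_le:
  assumes "x \<in> V" "y \<in> V" "x \<noteq> y"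
  shows "real (card (quads V Ed {x, y})) \<le> n^2"
proof -
  have "2 * real (card (quads V Ed {x, y})) / n^2 \<le> E (\<lambda>_. E (\<lambda>_. 1))"
    unfolding count2[OF assms, symmetric] by (intro E_mono) auto
  then have "2 * real (card (quads V Ed {x, y})) \<le> n^2" using n_pos by (simp add: divide_le_eq)
  then show ?thesis by linarith
qed

lemma finite_quads: "finite (quads V Ed A)"
  using fin_V by (auto simp: quads_def intro: finite_subset[of _ "Pow V"])

lemma sum_quads_at: "(\<Sum>x\<in>V. card (quads V Ed {x})) = 4 * card (quads V Ed {})"
proof -
  have "(\<Sum>x\<in>V. card (quads V Ed {x})) = (\<Sum>x\<in>V. \<Sum>S\<in>quads V Ed {}. of_bool (x \<in> S))"
  proof (intro sum.cong refl)
    fix x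
    have "quads V Ed {x} = quads V Ed {} \<inter> {S. x \<in> S}" by (auto simp: quads_def)
    then show "card (quads V Ed {x}) = (\<Sum>S\<in>quads V Ed {}. of_bool (x \<in> S))"
      using finite_quads by (simp add: sum_of_bool_eq)
  qed
  also have "\<dots> = (\<Sum>S\<in>quads V Ed {}. \<Sum>x\<in>V. of_bool (x \<in> S))" by (rule sum.swap)
  also have "\<dots> = (\<Sum>S\<in>quads V Ed {}. 4)"
  proof (intro sum.cong refl)
    fix S assume "S \<in> quads V Ed {}"
    then have "V \<inter> S = S" "card S = 4" by (auto simp: quads_def)
    then show "(\<Sum>x\<in>V. of_bool (x \<in> S)) = (4 :: nat)" using fin_V by (simp add: sum_of_bool_eq)
  qed
  finally show ?thesis by simp
qed

end

section \<open>Local improvements\<close>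

text \<open>
  The change of the indicator of two edges on four vertices in the parts \<open>i, j, k, l\<close> of a blowup of \<open>2K\<^sub>3\<close>
  when a wrong pair between \<open>i\<close> and \<open>j\<close> is corrected.
\<close>

definition flip_gain :: "nat \<Rightarrow> nat \<Rightarrow> nat \<Rightarrow> nat \<Rightarrow> int" where
  "flip_gain i j k l =
     of_bool (of_bool (pat i j) + of_bool (pat i k) + of_bool (pat i l) + of_bool (pat j k) + of_bool (pat j l)
       + of_bool (pat k l) = (2 :: nat))
     - of_bool (of_bool (\<not> pat i j) + of_bool (pat i k) + of_bool (pat i l) + of_bool (pat j k) + of_bool (pat j l)
       + of_bool (pat k l) = (2 :: nat))"

text \<open>A mean gain of at least 6/36 = 1/6 for every pair of parts, including i = j, where the
  wrong pair is an edge inside a part.\<close>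

lemma flip_gain_table:
  "list_all (\<lambda>i. list_all (\<lambda>j. 6 \<le> (\<Sum>k\<leftarrow>[0..<6]. \<Sum>l\<leftarrow>[0..<6]. flip_gain i j k l)) [0..<6]) [0..<6]"
  by code_simp

lemma flip_gain_sum:
  assumes "i < 6" "j < 6"
  shows "6 \<le> (\<Sum>k<6. \<Sum>l<6. flip_gain i j k l)"
proof -
  have "\<forall>i\<in>set [0..<6]. \<forall>j\<in>set [0..<6]. 6 \<le> (\<Sum>k\<leftarrow>[0..<6]. \<Sum>l\<leftarrow>[0..<6]. flip_gain i j k l)"
    using flip_gain_table unfolding list_all_iff .
  moreover have "i \<in> set [0..<6]" "j \<in> set [0..<6]" using assms by auto
  ultimately have "6 \<le> (\<Sum>k\<leftarrow>[0..<6]. \<Sum>l\<leftarrow>[0..<6]. flip_gain i j k l)"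
    by blast
  then show ?thesis
    by (simp only: interv_sum_list_conv_sum_set_nat atLeast_upt)
qed

lemma abs_flip_gain: "\<bar>flip_gain i j k l\<bar> \<le> 1"
proof -
  have "\<bar>of_bool P - (of_bool Q :: int)\<bar> \<le> 1" for P Q by (cases P; cases Q) simp_all
  then show ?thesis unfolding flip_gain_def .
qed

context weighted_graph
begin

lemma E_compose:
  assumes "\<And>x. f x < (6 :: nat)"
  shows "E (\<lambda>v. g (f v)) = (\<Sum>i<6. E (\<lambda>v. of_bool (f v = i)) * g i)"
proof -
  have "E (\<lambda>v. g (f v)) = (\<Sum>i<6. E (\<lambda>v. of_bool (f v = i) * g (f v)))" by (rule E_parts[OF assms])
  also have "\<dots> = (\<Sum>i<6. E (\<lambda>v. of_bool (f v = i) * g i))" by (intro sum.cong avg_cong refl) auto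
  finally show ?thesis by (simp only: avg_multc)
qed

text \<open>Equal parts would give at least 1/6; each of the 36 products of two sizes is off by at
  most 1/2000, and 1/6 - 36/2000 > 7/50.\<close>

lemma E_flip_gain:
  assumes f: "\<And>x. f x < 6" and S: "\<And>i. i < 6 \<Longrightarrow> \<bar>E (\<lambda>v. of_bool (f v = i)) - 1/6\<bar> \<le> 1/1000"
    and ij: "i < 6" "j < 6"
  shows "7/50 \<le> E (\<lambda>w. E (\<lambda>z. real_of_int (flip_gain i j (f w) (f z))))"
proof -
  define s where "s k = E (\<lambda>v. of_bool (f v = k))" for k
  have "E (\<lambda>w. E (\<lambda>z. real_of_int (flip_gain i j (f w) (f z)))) = (\<Sum>k<6. s k * (\<Sum>l<6. s l * flip_gain i j k l))"
    using E_compose[OF f, of "\<lambda>l. real_of_int (flip_gain i j _ l)"] E_compose[OF f, of "\<lambda>k. \<Sum>l<6. s l * flip_gain i j k l"]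
    unfolding s_def by simp
  also have "\<dots> = (\<Sum>k<6. \<Sum>l<6. s k * s l * flip_gain i j k l)" by (simp add: sum_distrib_left mult.assoc)
  also have "\<dots> \<ge> (\<Sum>k<6. \<Sum>l<6. 1/36 * flip_gain i j k l - 1/2000)"
  proof (intro sum_mono)
    fix k l :: nat assume "k \<in> {..<6}" "l \<in> {..<6}"
    then have k: "\<bar>s k - 1/6\<bar> \<le> 1/1000" and l: "\<bar>s l - 1/6\<bar> \<le> 1/1000" using S by (auto simp: s_def)
    define p where "p = (s k - 1/6) * (s l - 1/6)"
    have "s k * s l = p + s k / 6 + s l / 6 - 1/36" by (simp add: p_def field_simps)
    moreover have "\<bar>p\<bar> \<le> 1/1000 * (1/1000)"
      unfolding p_def abs_mult by (intro mult_mono k l) auto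
    then have "\<bar>p\<bar> \<le> 1/1000000" by simp
    ultimately have "\<bar>s k * s l - 1/36\<bar> \<le> 1/2000"
      using k l by linarith
    then have "\<bar>s k * s l - 1/36\<bar> * \<bar>real_of_int (flip_gain i j k l)\<bar> \<le> 1/2000 * 1"
      using abs_flip_gain[of i j k l] by (intro mult_mono) auto
    then have "\<bar>(s k * s l - 1/36) * flip_gain i j k l\<bar> \<le> 1/2000" by (simp only: abs_mult)
    then have "- (1/2000) \<le> (s k * s l - 1/36) * flip_gain i j k l" by linarith
    then show "1/36 * flip_gain i j k l - 1/2000 \<le> s k * s l * flip_gain i j k l"
      by (simp add: left_diff_distrib)
  qed
  also have "(\<Sum>k<6. \<Sum>l<6. 1/36 * flip_gain i j k l - 1/2000) = 1/36 * real_of_int (\<Sum>k<6. \<Sum>l<6. flip_gain i j k l) - 36/2000"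
    by (simp add: sum_subtractf sum_distrib_left sum_divide_distrib)
  also have "\<dots> \<ge> 1/36 * 6 - 36/2000"
  proof -
    have arith: "1/36 * 6 - 36/2000 \<le> 1/36 * x - 36/2000" if "6 \<le> x" for x :: real
      using that by simp
    have "real_of_int 6 \<le> real_of_int (\<Sum>k<6. \<Sum>l<6. flip_gain i j k l)"
      using flip_gain_sum[OF ij] by (simp only: of_int_le_iff)
    then show ?thesis unfolding of_int_numeral by (rule arith)
  qed
  finally show ?thesis by simp
qed

end

context vgraph
begin

lemma card_quads_split:
  "card (quads V Ed A) = card (quads V Ed (A \<union> B)) + card {S \<in> quads V Ed A. \<not> B \<subseteq> S}"
proof -
  have "quads V Ed A = quads V Ed (A \<union> B) \<union> {S \<in> quads V Ed A. \<not> B \<subseteq> S}" by (auto simp: quads_def)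
  moreover have "quads V Ed (A \<union> B) \<inter> {S \<in> quads V Ed A. \<not> B \<subseteq> S} = {}" by (auto simp: quads_def)
  ultimately show ?thesis using finite_quads card_Un_disjoint
    by (metis (no_types, lifting) finite_Un)
qed

text \<open>If the other five pairs among \<open>u\<close>, \<open>v\<close>, \<open>w\<close>,
  \<open>z\<close> are correct, the change is exactly \<open>flip_gain\<close>. A wrong pair may
  turn a gain of 1 into a loss of 1, hence the charge 2; a coincidence only cancels a gain of 1. The
  charges are at most 15/1000 against 7/50. Four-sets missing \<open>u\<close> or \<open>v\<close>
  do not change.\<close>

lemma flip:
  assumes f: "\<And>x. f x < 6" and S: "\<And>i. i < 6 \<Longrightarrow> \<bar>E (\<lambda>v. of_bool (f v = i)) - 1/6\<bar> \<le> 1/1000"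
    and W: "\<And>x. x \<in> V \<Longrightarrow> E (\<lambda>y. of_bool (wrong (adj Ed) f x y)) \<le> 1/1000"
    and uv: "u \<in> V" "v \<in> V" "wrong (adj Ed) f u v" and n: "1000 \<le> n"
    and Ed': "Ed' = sym_diff Ed {{u, v}}"
  shows "real (card (quads V Ed {})) + n^2 / 20 \<le> real (card (quads V Ed' {}))"
proof -
  have ne: "u \<noteq> v" using uv(3) irrefl by (auto simp: wrong_def pat_irrefl)
  have Ed2': "\<forall>e\<in>Ed'. card e = 2" using Ed2 ne by (auto simp: Ed')
  interpret G': vgraph V Ed' by unfold_locales (use fin_V V_ne Ed2' in auto)
  let ?W = "\<lambda>x y. of_bool (wrong (adj Ed) f x y) :: real" and ?D = "\<lambda>x y. of_bool (y = x) :: real"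
  let ?g = "\<lambda>w z. real_of_int (flip_gain (f u) (f v) (f w) (f z))"
  have pt: "?g w z - 2 * (?W u w + ?W u z + ?W v w + ?W v z + ?W w z) - (?D u w + ?D v w + ?D u z + ?D v z + ?D w z)
     \<le> of_bool (distinct [u, v, w, z] \<and> two_edges (adj Ed') u v w z)
       - of_bool (distinct [u, v, w, z] \<and> two_edges (adj Ed) u v w z)" for w z
  proof -
    have arith: "g - 2 * W - D \<le> L" if "g \<le> 1" "1 \<le> W" "0 \<le> D" "-1 \<le> L" for g W D L :: real
      using that by linarith
    have ob: "-1 \<le> of_bool P - (of_bool Q :: real)" for P Q by (cases P; cases Q) simp_all
    have g1: "?g w z \<le> 1" using abs_flip_gain[of "f u" "f v" "f w" "f z"] by linarith
    consider "\<not> distinct [u, v, w, z]" | "wrong (adj Ed) f u w \<or> wrong (adj Ed) f u z \<or> wrong (adj Ed) f v w \<or> wrong (adj Ed) f v z \<or> wrong (adj Ed) f w z"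
      | "distinct [u, v, w, z]" "\<not> wrong (adj Ed) f u w" "\<not> wrong (adj Ed) f u z" "\<not> wrong (adj Ed) f v w" "\<not> wrong (adj Ed) f v z" "\<not> wrong (adj Ed) f w z"
      by blast
    then show ?thesis
    proof cases
      case 1
      then have "1 \<le> ?D u w + ?D v w + ?D u z + ?D v z + ?D w z" using ne by auto
      moreover have "0 \<le> 2 * (?W u w + ?W u z + ?W v w + ?W v z + ?W w z)" by simp
      ultimately have "?g w z - 2 * (?W u w + ?W u z + ?W v w + ?W v z + ?W w z) - (?D u w + ?D v w + ?D u z + ?D v z + ?D w z) \<le> 0"
        using g1 by linarith
      then show ?thesis using 1 by (simp only: simp_thms of_bool_eq diff_zero)
    next
      case 2
      then have "1 \<le> ?W u w + ?W u z + ?W v w + ?W v z + ?W w z" by auto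
      moreover have "0 \<le> ?D u w + ?D v w + ?D u z + ?D v z + ?D w z" by simp
      moreover have "-1 \<le> of_bool (distinct [u, v, w, z] \<and> two_edges (adj Ed') u v w z)
       - (of_bool (distinct [u, v, w, z] \<and> two_edges (adj Ed) u v w z) :: real)" by (rule ob)
      ultimately show ?thesis
        by (rule arith[OF g1])
    next
      case 3
      have a': "adj Ed' u w = adj Ed u w" "adj Ed' u z = adj Ed u z" "adj Ed' v w = adj Ed v w" "adj Ed' v z = adj Ed v z"
        "adj Ed' w z = adj Ed w z" "adj Ed' u v = (\<not> adj Ed u v)"
        using 3(1) by (auto simp: adj_def Ed' doubleton_eq_iff)
      have uv': "adj Ed u v = (\<not> pat (f u) (f v))" using uv(3) by (auto simp: wrong_def)
      have eqs: "adj Ed u w = pat (f u) (f w)" "adj Ed u z = pat (f u) (f z)" "adj Ed v w = pat (f v) (f w)" "adj Ed v z = pat (f v) (f z)"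
        "adj Ed w z = pat (f w) (f z)"
        using 3 by (auto simp: wrong_def)
      have "?g w z = of_bool (two_edges (adj Ed') u v w z) - of_bool (two_edges (adj Ed) u v w z)"
        unfolding two_edges_def a' uv' eqs flip_gain_def by (simp only: of_int_diff of_int_of_bool not_not)
      moreover have "0 \<le> 2 * (?W u w + ?W u z + ?W v w + ?W v z + ?W w z)" "0 \<le> ?D u w + ?D v w + ?D u z + ?D v z + ?D w z"
        by simp_all
      ultimately show ?thesis using 3(1) by (simp only: simp_thms)
    qed
  qed
  have "E (\<lambda>w. E (\<lambda>z. ?g w z - 2 * (?W u w + ?W u z + ?W v w + ?W v z + ?W w z) - (?D u w + ?D v w + ?D u z + ?D v z + ?D w z)))
    \<le> E (\<lambda>w. E (\<lambda>z. of_bool (distinct [u, v, w, z] \<and> two_edges (adj Ed') u v w z)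
       - of_bool (distinct [u, v, w, z] \<and> two_edges (adj Ed) u v w z)))"
    by (intro E_mono pt)
  also have "\<dots> = 2 * real (card (quads V Ed' {u, v})) / n^2 - 2 * real (card (quads V Ed {u, v})) / n^2"
    by (simp only: avg_diff count2[OF uv(1,2) ne] G'.count2[OF uv(1,2) ne])
  also have "E (\<lambda>w. E (\<lambda>z. ?g w z - 2 * (?W u w + ?W u z + ?W v w + ?W v z + ?W w z) - (?D u w + ?D v w + ?D u z + ?D v z + ?D w z)))
    = E (\<lambda>w. E (\<lambda>z. ?g w z)) - 2 * (E (?W u) + E (?W u) + E (?W v) + E (?W v) + E (\<lambda>w. E (?W w)))
      - (E (?D u) + E (?D v) + E (?D u) + E (?D v) + E (\<lambda>w. E (?D w)))"
    by (simp only: avg_diff avg_cmult avg_add E_const)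
  finally have main: "E (\<lambda>w. E (\<lambda>z. ?g w z)) - 2 * (E (?W u) + E (?W u) + E (?W v) + E (?W v) + E (\<lambda>w. E (?W w)))
      - (E (?D u) + E (?D v) + E (?D u) + E (?D v) + E (\<lambda>w. E (?D w)))
     \<le> 2 * real (card (quads V Ed' {u, v})) / n^2 - 2 * real (card (quads V Ed {u, v})) / n^2" .
  have g: "7/50 \<le> E (\<lambda>w. E (\<lambda>z. ?g w z))" by (rule E_flip_gain[OF f S f f])
  have WW: "E (\<lambda>w. E (?W w)) \<le> 1/1000" using E_mono[of "\<lambda>w. E (?W w)" "\<lambda>_. 1/1000"] W by simp
  have Du: "E (?D u) = 1/n" "E (?D v) = 1/n" using E_delta uv by auto
  have DD: "E (\<lambda>w. E (?D w)) = 1/n" using avg_cong[of V "\<lambda>w. E (?D w)" "\<lambda>_. 1/n" "unif V"] E_delta by simp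
  have n1: "1/n \<le> 1/1000" using n by (simp add: field_simps)
  have arith: "1/10 \<le> q"
    if "g - 2 * (a + a + b + b + c) - (d + d + d + d + d) \<le> q" "7/50 \<le> g" "a \<le> 1/1000" "b \<le> 1/1000" "c \<le> 1/1000" "d \<le> 1/1000"
    for g a b c d q :: real
    using that by simp
  have "1/10 \<le> 2 * real (card (quads V Ed' {u, v})) / n^2 - 2 * real (card (quads V Ed {u, v})) / n^2"
    by (rule arith[OF main[unfolded Du DD] g W[OF uv(1)] W[OF uv(2)] WW n1])
  then have "1/10 \<le> (2 * real (card (quads V Ed' {u, v})) - 2 * real (card (quads V Ed {u, v}))) / n^2"
    by (simp only: diff_divide_distrib)
  then have "n^2 * (1/10) \<le> 2 * real (card (quads V Ed' {u, v})) - 2 * real (card (quads V Ed {u, v}))"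
    using n_pos by (simp add: field_simps)
  then have gain: "real (card (quads V Ed {u, v})) + n^2 / 20 \<le> real (card (quads V Ed' {u, v}))" by linarith
  have "{S \<in> quads V Ed {}. \<not> {u, v} \<subseteq> S} = {S \<in> quads V Ed' {}. \<not> {u, v} \<subseteq> S}"
  proof (rule Collect_cong)
    fix S
    show "(S \<in> quads V Ed {} \<and> \<not> {u, v} \<subseteq> S) \<longleftrightarrow> (S \<in> quads V Ed' {} \<and> \<not> {u, v} \<subseteq> S)"
    proof (cases "{u, v} \<subseteq> S")
      case False
      then have "{e \<in> Ed. e \<subseteq> S} = {e \<in> Ed'. e \<subseteq> S}" by (auto simp: Ed')
      then show ?thesis by (simp add: quads_def spans2_def)
    qed simp
  qed
  then show ?thesis
    using gain card_quads_split[of "{}" "{u, v}"] G'.card_quads_split[of "{}" "{u, v}"] by simp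
qed

text \<open>All edits are at \<open>x\<close>. Four-sets without \<open>x\<close> survive, and
  exchanging \<open>v\<close> for \<open>x\<close> carries those with \<open>v\<close> but without
  \<open>x\<close> injectively to new ones through \<open>x\<close>. The four-sets of the old graph
  through both vertices, at most n^2 of them, are given up.\<close>

lemma clone:
  assumes xv: "x \<in> V" "v \<in> V" "x \<noteq> v" and EdV: "\<forall>e\<in>Ed. e \<subseteq> V"
    and Ed': "Ed' = {e \<in> Ed. x \<notin> e} \<union> {{x, y} | y. y \<noteq> x \<and> {v, y} \<in> Ed}"
  shows "\<forall>e\<in>Ed'. e \<subseteq> V \<and> card e = 2" "card (sym_diff Ed Ed') \<le> card V"
    "real (card (quads V Ed {})) + real (card (quads V Ed {v})) - real (card (quads V Ed {x})) - n^2 \<le> real (card (quads V Ed' {}))"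
proof -
  show Ed2': "\<forall>e\<in>Ed'. e \<subseteq> V \<and> card e = 2" using Ed2 EdV xv by (auto simp: Ed')
  interpret G': vgraph V Ed' by unfold_locales (use fin_V V_ne Ed2' in auto)
  have "sym_diff Ed Ed' \<subseteq> (\<lambda>y. {x, y}) ` V"
  proof
    fix e assume e: "e \<in> sym_diff Ed Ed'"
    then have "x \<in> e" "e \<subseteq> V" "card e = 2" using Ed2' Ed2 EdV xv(1) by (auto simp: Ed')
    then obtain y where "e = {x, y}" by (auto simp: card_2_iff insert_commute)
    then show "e \<in> (\<lambda>y. {x, y}) ` V" using \<open>e \<subseteq> V\<close> by auto
  qed
  then have "card (sym_diff Ed Ed') \<le> card ((\<lambda>y. {x, y}) ` V)" using fin_V by (intro card_mono) auto
  also have "\<dots> \<le> card V" by (rule card_image_le[OF fin_V])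
  finally show "card (sym_diff Ed Ed') \<le> card V" .
  define A where "A = {S \<in> quads V Ed {}. \<not> {x} \<subseteq> S}"
  define B where "B = {S \<in> quads V Ed {v}. \<not> {x} \<subseteq> S}"
  define h where "h S = insert x (S - {v})" for S
  have adj': "adj Ed' x p = adj Ed v p" "p \<noteq> x \<Longrightarrow> q \<noteq> x \<Longrightarrow> adj Ed' p q = adj Ed p q" if "p \<noteq> x" for p q
    using that by (auto simp: adj_def Ed' doubleton_eq_iff)
  have Asub: "A \<subseteq> quads V Ed' {}"
  proof
    fix S assume S: "S \<in> A"
    then have "{e \<in> Ed. e \<subseteq> S} = {e \<in> Ed'. e \<subseteq> S}" by (auto simp: Ed' A_def)
    then show "S \<in> quads V Ed' {}" using S by (simp add: A_def quads_def spans2_def)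
  qed
  have hsub: "h ` B \<subseteq> quads V Ed' {}"
  proof (intro image_subsetI)
    fix S assume S: "S \<in> B"
    then have "card S = 4" "v \<in> S" and SV: "S \<subseteq> V" "x \<notin> S" by (auto simp: B_def quads_def)
    then have "card (S - {v}) = 3" by (simp add: card_Diff_singleton)
    then obtain p q r where pqr: "S - {v} = {p, q, r}" "p \<noteq> q" "p \<noteq> r" "q \<noteq> r" by (auto simp: card_3_iff)
    have mem: "p \<in> S - {v}" "q \<in> S - {v}" "r \<in> S - {v}" using pqr(1) by auto
    have S4: "S = {v, p, q, r}" using pqr(1) \<open>v \<in> S\<close> by blast
    have d: "distinct [v, p, q, r]" "distinct [x, p, q, r]" using mem pqr SV(2) by auto
    have hS: "h S = {x, p, q, r}" by (simp add: h_def pqr(1))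
    have "two_edges (adj Ed) v p q r" using S spans2_iff[OF Ed2 d(1)] S4 by (simp add: B_def quads_def)
    moreover have nx: "p \<noteq> x" "q \<noteq> x" "r \<noteq> x" using d(2) by auto
    have "two_edges (adj Ed') x p q r = two_edges (adj Ed) v p q r"
      unfolding two_edges_def adj'(1)[OF nx(1)] adj'(1)[OF nx(2)] adj'(1)[OF nx(3)]
        adj'(2)[OF nx(1) nx(1) nx(2)] adj'(2)[OF nx(1) nx(1) nx(3)] adj'(2)[OF nx(2) nx(2) nx(3)] by (rule refl)
    ultimately have "two_edges (adj Ed') x p q r" by blast
    then have "spans2 Ed' (h S)" using spans2_iff[OF G'.Ed2 d(2)] by (simp add: hS)
    moreover have "card (h S) = 4" using d(2) by (simp add: hS)
    moreover have "h S \<subseteq> V" using SV xv by (auto simp: h_def)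
    ultimately show "h S \<in> quads V Ed' {}" by (simp add: quads_def)
  qed
  have inj: "inj_on h B"
  proof (rule inj_on_inverseI[where g = "\<lambda>T. insert v (T - {x})"])
    fix S assume "S \<in> B"
    then have "v \<in> S" "x \<notin> S" by (auto simp: B_def quads_def)
    then show "insert v (h S - {x}) = S" using xv by (auto simp: h_def)
  qed
  have finAB: "finite A" "finite B" using finite_quads by (auto simp: A_def B_def)
  have "card A + card B = card A + card (h ` B)" by (simp add: card_image[OF inj])
  also have "\<dots> = card (A \<union> h ` B)"
    using finAB by (intro card_Un_disjoint[symmetric]) (auto simp: A_def h_def)
  also have "\<dots> \<le> card (quads V Ed' {})" using Asub hsub G'.finite_quads by (intro card_mono) auto
  finally have "card A + card B \<le> card (quads V Ed' {})" .
  moreover have "card (quads V Ed {}) = card (quads V Ed {x}) + card A"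
    using card_quads_split[of "{}" "{x}"] by (simp add: A_def)
  moreover have "card (quads V Ed {v}) = card (quads V Ed {v, x}) + card B"
    using card_quads_split[of "{v}" "{x}"] by (simp add: B_def insert_commute)
  moreover have "real (card (quads V Ed {v, x})) \<le> n^2" using quads_pair_le[of v x] xv by auto
  ultimately show "real (card (quads V Ed {})) + real (card (quads V Ed {v})) - real (card (quads V Ed {x})) - n^2 \<le> real (card (quads V Ed' {}))"
    by linarith
qed

text \<open>If all vertices have density near 1/2, the six parts exist, and the graph either agrees
  with them or has a wrong pair to flip. Otherwise some vertex is short by more than \<epsilon>
  while, by averaging, another is short by at most \<epsilon>/2; a clone of the latter replaces the
  former.\<close>

lemma improve:
  assumes EdV: "\<forall>e\<in>Ed. e \<subseteq> V" and n: "24 * 10^70 \<le> n"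
    and num: "(1/2 - 1/(2 * 10^70)) * n^4 \<le> 24 * real (card (quads V Ed {}))"
  shows "(\<exists>f. (\<forall>x. f x < 6) \<and> (\<forall>u\<in>V. \<forall>v\<in>V. adj Ed u v = pat (f u) (f v))) \<or>
    (\<exists>Ed'. (\<forall>e\<in>Ed'. e \<subseteq> V \<and> card e = 2) \<and>
       real (card (quads V Ed {})) + 1/(48 * 10^70) * n^2 * real (card (sym_diff Ed Ed')) < real (card (quads V Ed' {})))"
proof -
  define \<epsilon> where "\<epsilon> = (1 / 10^70 :: real)"
  have \<epsilon>: "0 < \<epsilon>" "\<epsilon> < 1/1000" by (simp_all add: \<epsilon>_def)
  have n\<epsilon>: "24 \<le> \<epsilon> * n" using n by (simp add: \<epsilon>_def field_simps)
  have num': "(1/2 - \<epsilon>/2) * n^4 \<le> 24 * real (card (quads V Ed {}))" using num by (simp add: \<epsilon>_def)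
  have np: "0 < n" by (rule n_pos)
  have c: "1/(48 * 10^70) = \<epsilon>/48" by (simp add: \<epsilon>_def)
  show ?thesis
  proof (cases "\<forall>x\<in>V. (1/2 - \<epsilon>) * n^3 \<le> 6 * real (card (quads V Ed {x}))")
    case True
    have d: "1/2 - 1/10^70 \<le> dens (adj Ed) V (unif V)"
    proof -
      have "(1/2 - \<epsilon>) * n^4 \<le> (1/2 - \<epsilon>/2) * n^4" using \<epsilon> by (intro mult_right_mono) auto
      then have "(1/2 - \<epsilon>) * n^4 \<le> 24 * real (card (quads V Ed {}))" using num' by (rule order_trans)
      moreover have "0 < n^4" using np by simp
      ultimately have "1/2 - \<epsilon> \<le> 24 * real (card (quads V Ed {})) / n^4"
        by (simp only: pos_le_divide_eq)
      then show ?thesis using quads_le_dens unfolding \<epsilon>_def by (rule order_trans)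
    qed
    have da: "1/2 - 1/10^70 \<le> dens_at (adj Ed) V (unif V) x" if "x \<in> V" for x
    proof -
      have "0 < n^3" using np by simp
      then have "1/2 - \<epsilon> \<le> 6 * real (card (quads V Ed {x})) / n^3"
        using True that by (simp only: pos_le_divide_eq)
      then show ?thesis using quads_at_le_dens_at[OF that] unfolding \<epsilon>_def by (rule order_trans)
    qed
    from exists_parts[OF d da] obtain f where f: "\<And>x. f x < 6"
      and S: "\<And>i. i < 6 \<Longrightarrow> \<bar>E (\<lambda>v. of_bool (f v = i)) - 1/6\<bar> \<le> 1/1000"
      and W: "\<And>x. x \<in> V \<Longrightarrow> E (\<lambda>y. of_bool (wrong (adj Ed) f x y)) \<le> 1/1000" by blast
    show ?thesis
    proof (cases "\<exists>u\<in>V. \<exists>v\<in>V. wrong (adj Ed) f u v")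
      case False
      then show ?thesis using f by (auto simp: wrong_def)
    next
      case True
      then obtain u v where uv: "u \<in> V" "v \<in> V" "wrong (adj Ed) f u v" by blast
      have uvn: "u \<noteq> v" using uv(3) irrefl by (auto simp: wrong_def pat_irrefl)
      define Ed' where "Ed' = sym_diff Ed {{u, v}}"
      have "24 * 1000 \<le> n" using n by (rule order_trans[rotated]) simp
      then have "1000 \<le> n" by linarith
      from flip[OF f S W uv this Ed'_def]
      have gain: "real (card (quads V Ed {})) + n^2 / 20 \<le> real (card (quads V Ed' {}))" .
      have "sym_diff Ed Ed' = {{u, v}}" by (auto simp: Ed'_def)
      then have 1: "real (card (sym_diff Ed Ed')) = 1" by simp
      have "\<epsilon>/48 * n^2 < 1/20 * n^2" using \<epsilon> np by (intro mult_strict_right_mono) auto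
      then have "real (card (quads V Ed {})) + \<epsilon>/48 * n^2 * real (card (sym_diff Ed Ed')) < real (card (quads V Ed' {}))"
        unfolding 1 using gain by linarith
      moreover have "\<forall>e\<in>Ed'. e \<subseteq> V \<and> card e = 2"
      proof
        fix e assume "e \<in> Ed'"
        then have "e \<in> Ed \<or> e = {u, v}" by (auto simp: Ed'_def)
        then show "e \<subseteq> V \<and> card e = 2" using EdV Ed2 uv(1,2) uvn by (elim disjE) simp_all
      qed
      ultimately show ?thesis unfolding c by (intro disjI2 exI[of _ Ed'] conjI)
    qed
  next
    case False
    then obtain x where x: "x \<in> V" "6 * real (card (quads V Ed {x})) < (1/2 - \<epsilon>) * n^3" by (auto simp: not_le)
    have "\<exists>v\<in>V. (1/2 - \<epsilon>/2) * n^3 \<le> 6 * real (card (quads V Ed {v}))"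
    proof (rule ccontr)
      assume "\<not> ?thesis"
      then have "(\<Sum>v\<in>V. 6 * real (card (quads V Ed {v}))) < (\<Sum>v\<in>V. (1/2 - \<epsilon>/2) * n^3)"
        using fin_V V_ne by (intro sum_strict_mono) (auto simp: not_le)
      also have "\<dots> = (1/2 - \<epsilon>/2) * n^4" by (simp add: power3_eq_cube power4_eq_xxxx)
      also have "\<dots> \<le> 6 * real (\<Sum>v\<in>V. card (quads V Ed {v}))" using num' unfolding sum_quads_at by simp
      finally show False by (simp add: sum_distrib_left)
    qed
    then obtain v where v: "v \<in> V" "(1/2 - \<epsilon>/2) * n^3 \<le> 6 * real (card (quads V Ed {v}))" by blast
    have n3: "0 < n^3" using np by simp
    have "(1/2 - \<epsilon>) * n^3 < (1/2 - \<epsilon>/2) * n^3" using n3 \<epsilon> by (intro mult_strict_right_mono) auto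
    then have xv: "x \<noteq> v" using x(2) v(2) by auto
    define Ed' where "Ed' = {e \<in> Ed. x \<notin> e} \<union> {{x, y} | y. y \<noteq> x \<and> {v, y} \<in> Ed}"
    note cl = clone[OF x(1) v(1) xv EdV Ed'_def]
    have "(1/2 - \<epsilon>/2) * n^3 - (1/2 - \<epsilon>) * n^3 = \<epsilon>/2 * n^3" by (simp add: algebra_simps)
    \<comment> \<open>The difference \<epsilon>/2 divided by 6 is the gain \<epsilon>/12 n^3. The
      loss n^2 is at most \<epsilon>/24 n^3 by the size of \<open>n\<close>, and the penalty at most
      \<epsilon>/48 n^3, so a surplus remains.\<close>
    then have gain: "real (card (quads V Ed {})) + \<epsilon>/12 * n^3 - n^2 < real (card (quads V Ed' {}))"
      using cl(3) x(2) v(2) by simp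
    have "\<epsilon>/48 * n^2 * real (card (sym_diff Ed Ed')) \<le> \<epsilon>/48 * n^2 * n"
      using cl(2) \<epsilon> by (intro mult_left_mono) auto
    also have "\<dots> = \<epsilon>/48 * n^3" by (simp add: power2_eq_square power3_eq_cube)
    finally have 1: "\<epsilon>/48 * n^2 * real (card (sym_diff Ed Ed')) \<le> \<epsilon>/48 * n^3" .
    have "24 * n^2 \<le> \<epsilon> * n * n^2" using n\<epsilon> by (intro mult_right_mono) auto
    then have "24 * n^2 \<le> \<epsilon> * n^3" by (simp add: power2_eq_square power3_eq_cube mult_ac)
    moreover have "0 < \<epsilon> * n^3" using \<epsilon> n3 by simp
    ultimately have "real (card (quads V Ed {})) + \<epsilon>/48 * n^2 * real (card (sym_diff Ed Ed')) < real (card (quads V Ed' {}))"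
      using gain 1 by simp
    with cl(1) show ?thesis unfolding c by (intro disjI2 exI[of _ Ed'] conjI)
  qed
qed

end

section \<open>Densities of blowups\<close>

text \<open>The limit density of blowups as a polynomial in the proportions of the parts. Written as
  \<open>dens\<close> of the six-vertex pattern, it falls under the certificate.\<close>

definition pat_dens :: "(nat \<Rightarrow> real) \<Rightarrow> real" where
  "pat_dens s = dens pat {..<6} s"

lemma pat_dens_eq: "pat_dens s = (\<Sum>i<6. s i * (\<Sum>j<6. s j * (\<Sum>k<6. s k * (\<Sum>l<6. s l * of_bool (two_edges pat i j k l)))))"
  by (simp only: pat_dens_def dens_def avg_def)

lemma tendsto_pat_dens:
  assumes "\<And>i. i < 6 \<Longrightarrow> ((\<lambda>n. s n i) \<longlongrightarrow> t i) F"
  shows "((\<lambda>n. pat_dens (s n)) \<longlongrightarrow> pat_dens t) F"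
  unfolding pat_dens_eq by (intro tendsto_sum tendsto_mult tendsto_const assms) auto

lemma pat_dens_uniform: "pat_dens (\<lambda>i. 1/6) = 1/2"
proof -
  have "(\<Sum>i\<leftarrow>[0..<6]. \<Sum>j\<leftarrow>[0..<6]. \<Sum>k\<leftarrow>[0..<6]. \<Sum>l\<leftarrow>[0..<6]. of_bool (two_edges pat i j k l)) = (648 :: int)"
    by code_simp
  then have 1: "(\<Sum>i<6. \<Sum>j<6. \<Sum>k<6. \<Sum>l<6. of_bool (two_edges pat i j k l)) = (648 :: int)"
    by (simp only: interv_sum_list_conv_sum_set_nat atLeast_upt)
  have "pat_dens (\<lambda>i. 1/6) = real_of_int (\<Sum>i<6. \<Sum>j<6. \<Sum>k<6. \<Sum>l<6. of_bool (two_edges pat i j k l)) / 1296"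
    by (simp only: pat_dens_eq of_int_sum of_int_of_bool sum_divide_distrib sum_distrib_left) simp
  then show ?thesis unfolding 1 by simp
qed

lemma weighted_pat:
  assumes "x \<in> std_simplex 6"
  shows "weighted_graph {..<6} pat x"
  by unfold_locales (use assms pat_sym pat_irrefl in \<open>auto simp: std_simplex_def\<close>)

text \<open>The certificate is applied to the pattern itself with vertex weights \<open>x\<close>.
  Equality forces degree 1/3 at every vertex of positive weight, and \<open>six_parts\<close> with
  \<rho> = 0 then leaves only equal weights.\<close>

lemma pat_dens_le:
  assumes x: "x \<in> std_simplex 6"
  shows "pat_dens x \<le> 1/2" and "pat_dens x = 1/2 \<Longrightarrow> i < 6 \<Longrightarrow> x i = 1/6"
proof -
  interpret weighted_graph "{..<6}" pat x by (rule weighted_pat[OF x])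
  let ?q = "E (\<lambda>i. (deg pat {..<6} x i - 1/3)^2)"
  have "0 \<le> E (forb pat {..<6} x)" unfolding forb_def by (intro E_ge_0) auto
  then have c: "9/10 * ?q \<le> 1/2 - pat_dens x" using certificate unfolding pat_dens_def by linarith
  have q: "0 \<le> ?q" by (intro E_ge_0) simp
  show "pat_dens x \<le> 1/2" using c q by linarith
  assume "pat_dens x = 1/2" and i: "i < 6"
  then have "?q = 0" using c q by linarith
  then have z: "\<forall>i\<in>{..<6}. x i * (deg pat {..<6} x i - 1/3)^2 = 0"
    unfolding avg_def using w_nonneg by (subst (asm) sum_nonneg_eq_0_iff) auto
  have "\<bar>x i - 1/6\<bar> \<le> 3 * 0"
  proof (rule six_parts[OF _ _ _ _ i])
    show "0 \<le> x i" for i using x by (cases "i < 6") (auto simp: std_simplex_def)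
    show "(\<Sum>i<6. x i) = 1" using x by (simp add: std_simplex_def)
    show "x i \<le> 0 \<or> \<bar>(\<Sum>j<6. of_bool (pat i j) * x j) - 1/3\<bar> \<le> 0" if "i < 6" for i
    proof -
      have "x i = 0 \<or> deg pat {..<6} x i = 1/3" using z that by auto
      then show ?thesis by (auto simp: deg_def avg_def mult.commute)
    qed
  qed simp
  then show "x i = 1/6" by simp
qed

lemma choose4: "real (n choose 4) = real n * (real n - 1) * (real n - 2) * (real n - 3) / 24"
  by (simp add: binomial_gbinomial gbinomial_prod_rev eval_nat_numeral algebra_simps fact_numeral)

text \<open>Converts normalisation by n^4 into normalisation by \<open>n choose 4\<close>. For n <
  4, division by zero makes it 0, in agreement with \<open>ind_density\<close>.\<close>

definition ratio4 :: "nat \<Rightarrow> real" where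
  "ratio4 n = real n ^ 4 / (24 * real (n choose 4))"

lemma ratio4_tendsto: "ratio4 \<longlonglongrightarrow> 1"
  unfolding ratio4_def choose4 by real_asymp

context vgraph
begin

lemma ind_density_eq: "ind_density 4 2 (V, Ed) = real (card (quads V Ed {})) / real (card V choose 4)"
  by (simp add: ind_density_def quads_def spans2_def)

lemma ind_density_ratio: "ind_density 4 2 (V, Ed) = 24 * real (card (quads V Ed {})) / n^4 * ratio4 (card V)"
  using n_pos by (simp add: ind_density_eq ratio4_def)

lemma ratio4_nonneg: "0 \<le> ratio4 k"
  by (simp add: ratio4_def)

lemma ind_density_le: "ind_density 4 2 (V, Ed) \<le> 1/2 * ratio4 (card V)"
  unfolding ind_density_ratio using order_trans[OF quads_le_dens dens_le_half] ratio4_nonneg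
  by (intro mult_right_mono) auto

text \<open>There is no error term: a repeated vertex behaves like two vertices of one part, as both
  relations are irreflexive.\<close>

lemma dens_eq_pat_dens:
  assumes f: "\<And>x. f x < 6" and a: "\<And>u v. u \<in> V \<Longrightarrow> v \<in> V \<Longrightarrow> adj Ed u v = pat (f u) (f v)"
  shows "dens (adj Ed) V (unif V) = pat_dens (\<lambda>i. real (card {v \<in> V. f v = i}) / n)"
proof -
  define s where "s i = real (card {v \<in> V. f v = i}) / n" for i
  have s: "s i = E (\<lambda>v. of_bool (f v = i))" for i
    using fin_V by (simp add: s_def E_eq sum_of_bool_eq Int_def conj_commute)
  have comp: "E (\<lambda>v. g (f v)) = avg {..<6} s g" for g
    unfolding avg_def[of "{..<6}" s g] s by (rule E_compose[OF f])
  define T where "T i j k l = (of_bool (two_edges pat i j k l) :: real)" for i j k l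
  have "dens (adj Ed) V (unif V) = E (\<lambda>x. E (\<lambda>y. E (\<lambda>z. E (\<lambda>u. T (f x) (f y) (f z) (f u)))))"
    unfolding dens_def T_def by (intro avg_cong) (simp add: two_edges_def a)
  also have "\<dots> = E (\<lambda>x. E (\<lambda>y. E (\<lambda>z. avg {..<6} s (T (f x) (f y) (f z)))))"
    by (intro avg_cong comp)
  also have "\<dots> = E (\<lambda>x. E (\<lambda>y. avg {..<6} s (\<lambda>k. avg {..<6} s (T (f x) (f y) k))))"
    by (intro avg_cong comp)
  also have "\<dots> = E (\<lambda>x. avg {..<6} s (\<lambda>j. avg {..<6} s (\<lambda>k. avg {..<6} s (T (f x) j k))))"
    by (intro avg_cong comp)
  also have "\<dots> = avg {..<6} s (\<lambda>i. avg {..<6} s (\<lambda>j. avg {..<6} s (\<lambda>k. avg {..<6} s (T i j k))))"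
    by (rule comp)
  finally show ?thesis
    by (simp only: pat_dens_def dens_def[of pat] T_def[abs_def] s_def[abs_def])
qed

end

section \<open>Blowups of 2K_3 as maps to six parts\<close>

lemma two_K3_edge_iff: "i < 6 \<Longrightarrow> j < 6 \<Longrightarrow> {i, j} \<in> edges two_K3 \<longleftrightarrow> pat i j"
proof -
  assume "i < 6" "j < 6"
  then have "i = 0 \<or> i = 1 \<or> i = 2 \<or> i = 3 \<or> i = 4 \<or> i = 5" "j = 0 \<or> j = 1 \<or> j = 2 \<or> j = 3 \<or> j = 4 \<or> j = 5" by auto
  then show "{i, j} \<in> edges two_K3 \<longleftrightarrow> pat i j"
    by (elim disjE; hypsubst_thin; simp add: two_K3_def pat_def doubleton_eq_iff)
qed

lemma blowup_two_K3:
  assumes V: "valid_parts two_K3 P"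
  obtains V Ed f where "blowup two_K3 P = (V, Ed)" "finite V" "\<forall>e\<in>Ed. e \<subseteq> V \<and> card e = 2" "\<And>x. f x < 6"
    "\<And>i. i < 6 \<Longrightarrow> {v \<in> V. f v = i} = P i" "\<And>u v. u \<in> V \<Longrightarrow> v \<in> V \<Longrightarrow> adj Ed u v = pat (f u) (f v)"
proof -
  have vs: "verts two_K3 = {..<6}" by (simp add: two_K3_def)
  define V where "V = (\<Union>i<6. P i)"
  define Ed where "Ed = edges (blowup two_K3 P)"
  have fin: "finite V" using V by (auto simp: V_def valid_parts_def vs)
  have disj: "i = j" if "v \<in> P i" "v \<in> P j" "i < 6" "j < 6" for v i j
    using V that by (auto simp: valid_parts_def disjoint_family_on_def vs)
  \<comment> \<open>The default 0 outside \<open>V\<close> keeps \<open>f\<close> below 6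
    everywhere, as the lemmas on parts assume.\<close>
  define f where "f v = (if v \<in> V then (SOME i. i < 6 \<and> v \<in> P i) else 0)" for v
  have fV: "f v < 6 \<and> v \<in> P (f v)" if "v \<in> V" for v
  proof -
    have "\<exists>i. i < 6 \<and> v \<in> P i" using that by (auto simp: V_def)
    from someI_ex[OF this] show ?thesis using that by (simp add: f_def)
  qed
  have f6: "f x < 6" for x using fV[of x] by (cases "x \<in> V") (auto simp: f_def)
  have fP: "f v = i" if "v \<in> P i" "i < 6" for v i
  proof -
    have "v \<in> V" using that by (auto simp: V_def)
    then show ?thesis using disj fV that by blast
  qed
  have sg: "simple_graph (blowup two_K3 P)" by (rule simple_graph_blowup[OF pattern_two_K3 V])
  have VB: "verts (blowup two_K3 P) = V" by (simp add: blowup_def V_def vs)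
  show ?thesis
  proof (rule that[of V Ed f])
    show "blowup two_K3 P = (V, Ed)" by (simp add: Ed_def VB[symmetric])
    show "\<forall>e\<in>Ed. e \<subseteq> V \<and> card e = 2" using sg unfolding simple_graph_def Ed_def VB by blast
    show "{v \<in> V. f v = i} = P i" if "i < 6" for i
      using fV fP that by (auto simp: V_def)
    show "adj Ed u v = pat (f u) (f v)" if uv: "u \<in> V" "v \<in> V" for u v
    proof
      assume "adj Ed u v"
      then have "{u, v} \<in> edges (blowup two_K3 P)" by (simp add: adj_def Ed_def)
      then obtain x y i j where e: "{u, v} = {x, y}" "i < 6" "j < 6" "x \<in> P i" "y \<in> P j" "{i, j} \<in> edges two_K3"
        by (auto simp: blowup_def vs)
      then have "pat i j" "f x = i" "f y = j" using two_K3_edge_iff fP by auto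
      then show "pat (f u) (f v)" using e(1) pat_sym by (auto simp: doubleton_eq_iff)
    next
      assume p: "pat (f u) (f v)"
      then have "u \<noteq> v" using pat_irrefl by auto
      moreover have "{f u, f v} \<in> edges two_K3" using p two_K3_edge_iff fV uv by blast
      ultimately have "{u, v} \<in> edges (blowup two_K3 P)"
        using fV[OF uv(1)] fV[OF uv(2)] unfolding blowup_def vs by auto
      then show "adj Ed u v" by (simp add: adj_def Ed_def)
    qed
  qed (use fin f6 in auto)
qed

lemma in_blowups:
  assumes V: "finite V" and Ed: "\<forall>e\<in>Ed. e \<subseteq> V \<and> card e = 2" and f: "\<And>x. f x < (6 :: nat)"
    and a: "\<And>u v. u \<in> V \<Longrightarrow> v \<in> V \<Longrightarrow> adj Ed u v = pat (f u) (f v)"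
  shows "(V, Ed) \<in> blowups two_K3"
proof -
  define P where "P i = {v \<in> V. f v = i}" for i
  have vs: "verts two_K3 = {..<6}" by (simp add: two_K3_def)
  have valid: "valid_parts two_K3 P" using V by (auto simp: valid_parts_def P_def disjoint_family_on_def)
  have "{{x, y} |x y i j. i < 6 \<and> j < 6 \<and> x \<in> P i \<and> y \<in> P j \<and> x \<noteq> y \<and> {i, j} \<in> edges two_K3} = Ed"
  proof (intro set_eqI iffI)
    fix e assume "e \<in> {{x, y} |x y i j. i < 6 \<and> j < 6 \<and> x \<in> P i \<and> y \<in> P j \<and> x \<noteq> y \<and> {i, j} \<in> edges two_K3}"
    then obtain x y i j where e: "e = {x, y}" "i < 6" "j < 6" "x \<in> P i" "y \<in> P j" "{i, j} \<in> edges two_K3" by blast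
    then have "pat (f x) (f y)" "x \<in> V" "y \<in> V" using two_K3_edge_iff by (auto simp: P_def)
    then have "adj Ed x y" using a by blast
    then show "e \<in> Ed" by (simp add: adj_def e(1))
  next
    fix e assume e: "e \<in> Ed"
    then have "card e = 2" "e \<subseteq> V" using Ed by auto
    then obtain x y where xy: "e = {x, y}" "x \<noteq> y" "x \<in> V" "y \<in> V" by (auto simp: card_2_iff)
    then have "pat (f x) (f y)" using a[of x y] e by (simp add: adj_def)
    then have "{f x, f y} \<in> edges two_K3" using two_K3_edge_iff f by blast
    moreover have "x \<in> P (f x)" "y \<in> P (f y)" using xy by (auto simp: P_def)
    ultimately show "e \<in> {{x, y} |x y i j. i < 6 \<and> j < 6 \<and> x \<in> P i \<and> y \<in> P j \<and> x \<noteq> y \<and> {i, j} \<in> edges two_K3}"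
      using xy f by blast
  qed
  moreover have "(\<Union>i<6. P i) = V" using f by (auto simp: P_def)
  ultimately have "blowup two_K3 P = (V, Ed)" by (simp add: blowup_def vs)
  then show ?thesis using valid unfolding blowups_def by (metis (mono_tags, lifting) mem_Collect_eq)
qed

section \<open>Balanced blowups of every order\<close>

lemma card_mod6: "i < 6 \<Longrightarrow> card {m. m < n \<and> m mod 6 = i} = (n + 5 - i) div 6"
proof (induction n)
  case 0
  then show ?case by simp
next
  case (Suc n)
  have "{m. m < Suc n \<and> m mod 6 = i} = (if n mod 6 = i then insert n {m. m < n \<and> m mod 6 = i} else {m. m < n \<and> m mod 6 = i})"
    by (auto simp: less_Suc_eq)
  then have "card {m. m < Suc n \<and> m mod 6 = i} = (if n mod 6 = i then 1 else 0) + (n + 5 - i) div 6"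
    using Suc by simp
  also have "\<dots> = Suc (n + 5 - i) div 6"
  proof -
    have "i = 0 \<or> i = 1 \<or> i = 2 \<or> i = 3 \<or> i = 4 \<or> i = 5" using Suc.prems by auto
    then have "Suc (n + 5 - i) mod 6 = 0 \<longleftrightarrow> n mod 6 = i"
      by (elim disjE; hypsubst_thin; presburger)
    then show ?thesis by (simp only: div_Suc split: if_split) simp
  qed
  also have "Suc (n + 5 - i) = Suc n + 5 - i" using Suc.prems by simp
  finally show ?case .
qed

lemma mod6_tendsto:
  assumes "i < 6"
  shows "(\<lambda>n. real (card {m. m < n \<and> m mod 6 = i}) / real n) \<longlonglongrightarrow> 1/6"
proof (rule real_tendsto_sandwich)
  have b: "n \<le> 6 * card {m. m < n \<and> m mod 6 = i} + 5" "6 * card {m. m < n \<and> m mod 6 = i} \<le> n + 5" for n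
    unfolding card_mod6[OF assms]
    using assms div_mult_mod_eq[of "n + 5 - i" 6] mod_less_divisor[of 6 "n + 5 - i"] by linarith+
  have c: "(real n - 5) / 6 \<le> real (card {m. m < n \<and> m mod 6 = i})"
    "real (card {m. m < n \<and> m mod 6 = i}) \<le> (real n + 5) / 6" for n
  proof -
    have "real n \<le> real (6 * card {m. m < n \<and> m mod 6 = i} + 5)" "real (6 * card {m. m < n \<and> m mod 6 = i}) \<le> real (n + 5)"
      using b[of n] by (simp_all only: of_nat_le_iff)
    then show "(real n - 5) / 6 \<le> real (card {m. m < n \<and> m mod 6 = i})"
      "real (card {m. m < n \<and> m mod 6 = i}) \<le> (real n + 5) / 6" by simp_all
  qed
  show "eventually (\<lambda>n. (real n - 5) / 6 / real n \<le> real (card {m. m < n \<and> m mod 6 = i}) / real n) sequentially"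
    by (intro always_eventually allI divide_right_mono c) simp
  show "eventually (\<lambda>n. real (card {m. m < n \<and> m mod 6 = i}) / real n \<le> (real n + 5) / 6 / real n) sequentially"
    by (intro always_eventually allI divide_right_mono c) simp
  show "(\<lambda>n. (real n - 5) / 6 / real n) \<longlonglongrightarrow> 1/6" by real_asymp
  show "(\<lambda>n. (real n + 5) / 6 / real n) \<longlonglongrightarrow> 1/6" by real_asymp
qed

definition bal_dens :: "nat \<Rightarrow> real" where
  "bal_dens n = pat_dens (\<lambda>i. real (card {m. m < n \<and> m mod 6 = i}) / real n)"

lemma bal_dens_tendsto: "bal_dens \<longlonglongrightarrow> 1/2"
proof -
  have "(\<lambda>n. pat_dens (\<lambda>i. real (card {m. m < n \<and> m mod 6 = i}) / real n)) \<longlonglongrightarrow> pat_dens (\<lambda>i. 1/6)"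
    by (intro tendsto_pat_dens mod6_tendsto)
  then show ?thesis by (simp add: bal_dens_def[abs_def] pat_dens_uniform)
qed

text \<open>Numbering the vertices and sorting them by residue modulo 6 makes the part sizes depend
  on the order of the graph only.\<close>

lemma balanced_blowup:
  fixes V :: "'v set"
  assumes V: "finite V" "V \<noteq> {}"
  obtains Ed where "\<forall>e\<in>Ed. e \<subseteq> V \<and> card e = 2" "dens (adj Ed) V (unif V) = bal_dens (card V)"
proof -
  obtain h where h: "bij_betw h V {..<card V}"
    using V ex_bij_betw_finite_nat[OF V(1)] by (auto simp: atLeast0LessThan)
  define f where "f v = h v mod 6" for v
  have f6: "f x < 6" for x by (simp add: f_def)
  define Ed where "Ed = {{u, v} | u v. u \<in> V \<and> v \<in> V \<and> pat (f u) (f v)}"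
  have Ed: "\<forall>e\<in>Ed. e \<subseteq> V \<and> card e = 2"
  proof
    fix e assume "e \<in> Ed"
    then obtain u v where "e = {u, v}" "u \<in> V" "v \<in> V" "pat (f u) (f v)" by (auto simp: Ed_def)
    moreover from this have "u \<noteq> v" using pat_irrefl by auto
    ultimately show "e \<subseteq> V \<and> card e = 2" by simp
  qed
  have a: "adj Ed u v = pat (f u) (f v)" if "u \<in> V" "v \<in> V" for u v
    using that pat_sym[of "f u" "f v"] by (auto simp: adj_def Ed_def doubleton_eq_iff)
  interpret vgraph V Ed by unfold_locales (use V Ed in auto)
  have "card {v \<in> V. f v = i} = card {m. m < card V \<and> m mod 6 = i}" for i
  proof (rule bij_betw_same_card[of h])
    have "h ` {v \<in> V. f v = i} = {m. m < card V \<and> m mod 6 = i}"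
      using h by (auto simp: bij_betw_def f_def image_iff)
    then show "bij_betw h {v \<in> V. f v = i} {m. m < card V \<and> m mod 6 = i}"
      using bij_betw_subset[OF h, of "{v \<in> V. f v = i}"] by auto
  qed
  moreover have "dens (adj Ed) V (unif V) = pat_dens (\<lambda>i. real (card {v \<in> V. f v = i}) / n)"
    by (rule dens_eq_pat_dens[OF f6 a])
  ultimately have "dens (adj Ed) V (unif V) = bal_dens (card V)"
    by (simp only: bal_dens_def)
  with Ed show ?thesis by (rule that)
qed

section \<open>Edge-inducibility and stability\<close>

lemma simple_graph_iff: "simple_graph (V, Ed) \<longleftrightarrow> finite V \<and> (\<forall>e\<in>Ed. e \<subseteq> V \<and> card e = 2)"
  by (simp add: simple_graph_def)

lemma finite_ind_densities:
  "finite {ind_density \<kappa> l G | G :: 'v graph. simple_graph G \<and> card (verts G) = n}"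
proof (rule finite_subset)
  show "{ind_density \<kappa> l G | G :: 'v graph. simple_graph G \<and> card (verts G) = n}
      \<subseteq> (\<lambda>k. real k / real (n choose \<kappa>)) ` {..2 ^ n}"
  proof clarify
    fix V :: "'v set" and Ed
    assume G: "simple_graph (V, Ed)" "n = card (verts (V, Ed))"
    have "card {S. S \<subseteq> V \<and> card S = \<kappa> \<and> card {e \<in> Ed. e \<subseteq> S} = l} \<le> card (Pow V)"
      using G by (intro card_mono) (auto simp: simple_graph_iff)
    then show "ind_density \<kappa> l (V, Ed) \<in> (\<lambda>k. real k / real (card (verts (V, Ed)) choose \<kappa>)) ` {..2 ^ card (verts (V, Ed))}"
      using G by (auto simp: ind_density_def simple_graph_iff card_Pow intro!: imageI)
  qed
qed simp

lemma ind_density_le_max: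
  assumes "simple_graph (V, Ed)"
  shows "ind_density \<kappa> l (V :: nat set, Ed) \<le> max_ind_density \<kappa> l (card V)"
  unfolding max_ind_density_def
  by (rule Max_ge[OF finite_ind_densities]) (use assms in \<open>force\<close>)

lemma max_ind_density_attained:
  obtains V :: "nat set" and Ed where "simple_graph (V, Ed)" "card V = n" "max_ind_density \<kappa> l n = ind_density \<kappa> l (V, Ed)"
proof -
  let ?X = "{ind_density \<kappa> l G | G :: nat graph. simple_graph G \<and> card (verts G) = n}"
  have "simple_graph ({..<n}, {})" "card (verts ({..<n}, {} :: nat set set)) = n" by (auto simp: simple_graph_iff)
  then have "?X \<noteq> {}" by blast
  from Max_in[OF finite_ind_densities this]
  obtain G :: "nat graph" where G: "Max ?X = ind_density \<kappa> l G" "simple_graph G" "card (verts G) = n" by auto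
  show ?thesis
    by (rule that[of "verts G" "edges G"]) (use G in \<open>simp_all add: max_ind_density_def\<close>)
qed

lemma max_ind_density_tendsto: "max_ind_density 4 2 \<longlonglongrightarrow> 1/2"
proof (rule real_tendsto_sandwich)
  show "eventually (\<lambda>n. max_ind_density 4 2 n \<le> 1/2 * ratio4 n) sequentially"
    using eventually_gt_at_top[of 0]
  proof eventually_elim
    case (elim n)
    obtain V :: "nat set" and Ed where G: "simple_graph (V, Ed)" "card V = n" "max_ind_density 4 2 n = ind_density 4 2 (V, Ed)"
      by (rule max_ind_density_attained)
    interpret vgraph V Ed by unfold_locales (use G elim in \<open>auto simp: simple_graph_iff\<close>)
    show ?case using ind_density_le G by simp
  qed
  show "eventually (\<lambda>n. (bal_dens n - 6 / real n) * ratio4 n \<le> max_ind_density 4 2 n) sequentially"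
    using eventually_gt_at_top[of 0]
  proof eventually_elim
    case (elim m)
    have ne: "finite {..<m}" "{..<m} \<noteq> {}" using elim by auto
    obtain Ed where Ed: "\<forall>e\<in>Ed. e \<subseteq> {..<m} \<and> card e = 2" "dens (adj Ed) {..<m} (unif {..<m}) = bal_dens (card {..<m})"
      by (rule balanced_blowup[OF ne])
    interpret vgraph "{..<m}" Ed by unfold_locales (use Ed ne in auto)
    have "bal_dens m - 6 / real m \<le> 24 * real (card (quads {..<m} Ed {})) / real m ^ 4"
      using dens_le_quads Ed(2) by simp
    then have "(bal_dens m - 6 / real m) * ratio4 m \<le> ind_density 4 2 ({..<m}, Ed)"
      unfolding ind_density_ratio card_lessThan by (rule mult_right_mono[OF _ ratio4_nonneg])
    also have "\<dots> \<le> max_ind_density 4 2 (card {..<m})"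
      by (rule ind_density_le_max) (use Ed in \<open>auto simp: simple_graph_iff\<close>)
    finally show ?case by simp
  qed
  have "(\<lambda>n. 1/2 * ratio4 n) \<longlonglongrightarrow> 1/2 * 1" by (intro tendsto_intros ratio4_tendsto)
  then show "(\<lambda>n. 1/2 * ratio4 n) \<longlonglongrightarrow> 1/2" by simp
  have "(\<lambda>n. 6 / real n) \<longlonglongrightarrow> 0" by real_asymp
  then have "(\<lambda>n. (bal_dens n - 6 / real n) * ratio4 n) \<longlonglongrightarrow> (1/2 - 0) * 1"
    by (intro tendsto_intros bal_dens_tendsto ratio4_tendsto)
  then show "(\<lambda>n. (bal_dens n - 6 / real n) * ratio4 n) \<longlonglongrightarrow> 1/2" by simp
qed

text \<open>Below density 1/2 - \<epsilon>/2 the whole graph is exchanged for a balanced blowup,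
  which gains more than \<epsilon>/96 n^4 for at most n^2 edits. The factor 1/200 lies below this
  1/96 and below the 1/48 of the local moves.\<close>

lemma exists_better_or_blowup:
  "\<exists>N. \<forall>(V :: 'v set) Ed. finite V \<and> N \<le> card V \<and> (\<forall>e\<in>Ed. e \<subseteq> V \<and> card e = 2) \<longrightarrow>
    (\<exists>f. (\<forall>x. f x < (6::nat)) \<and> (\<forall>u\<in>V. \<forall>v\<in>V. adj Ed u v = pat (f u) (f v))) \<or>
    (\<exists>Ed'. (\<forall>e\<in>Ed'. e \<subseteq> V \<and> card e = 2) \<and>
       real (card (quads V Ed {})) + 1/(200 * 10^70) * real (card V)^2 * real (card (sym_diff Ed Ed')) < real (card (quads V Ed' {})))"
proof -
  define \<epsilon> where "\<epsilon> = (1 / 10^70 :: real)"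
  have \<epsilon>: "0 < \<epsilon>" by (simp add: \<epsilon>_def)
  have "(\<lambda>n. 6 / real n) \<longlonglongrightarrow> 0" by real_asymp
  then have "(\<lambda>n. bal_dens n - 6 / real n) \<longlonglongrightarrow> 1/2 - 0"
    by (intro tendsto_intros bal_dens_tendsto)
  then have "eventually (\<lambda>n. 1/2 - \<epsilon>/4 < bal_dens n - 6 / real n) sequentially"
    using \<epsilon> by (intro order_tendstoD) auto
  moreover have "eventually (\<lambda>n. 24 * 10^70 \<le> real n) sequentially"
    using filterlim_real_sequentially by (simp only: filterlim_at_top)
  ultimately have "eventually (\<lambda>n. 1/2 - \<epsilon>/4 < bal_dens n - 6 / real n \<and> 24 * 10^70 \<le> real n \<and> 0 < n) sequentially"
    using eventually_gt_at_top[of 0] by eventually_elim blast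
  then obtain N where N: "\<And>n. N \<le> n \<Longrightarrow> 1/2 - \<epsilon>/4 < bal_dens n - 6 / real n \<and> 24 * 10^70 \<le> real n \<and> 0 < n"
    unfolding eventually_sequentially by blast
  show ?thesis
  proof (intro exI[of _ N] allI impI, elim conjE)
    fix V :: "'v set" and Ed assume V: "finite V" "N \<le> card V" and Ed: "\<forall>e\<in>Ed. e \<subseteq> V \<and> card e = 2"
    have n: "1/2 - \<epsilon>/4 < bal_dens (card V) - 6 / real (card V)" "24 * 10^70 \<le> real (card V)" "0 < card V"
      using N[OF V(2)] by auto
    have V_ne: "V \<noteq> {}" using n(3) by auto
    interpret vgraph V Ed by unfold_locales (use V V_ne Ed in auto)
    have Ed': "\<forall>e\<in>Ed. e \<subseteq> V" using Ed by blast
    have c: "1/(200 * 10^70) = \<epsilon>/200" "1/(48 * 10^70) = \<epsilon>/48" "1/2 - 1/(2 * 10^70) = 1/2 - \<epsilon>/2" by (simp_all add: \<epsilon>_def)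
    have n4: "0 < n^4" using n_pos by simp
    show "(\<exists>f. (\<forall>x. f x < (6::nat)) \<and> (\<forall>u\<in>V. \<forall>v\<in>V. adj Ed u v = pat (f u) (f v))) \<or>
    (\<exists>Ed'. (\<forall>e\<in>Ed'. e \<subseteq> V \<and> card e = 2) \<and>
       real (card (quads V Ed {})) + 1/(200 * 10^70) * n^2 * real (card (sym_diff Ed Ed')) < real (card (quads V Ed' {})))"
    proof (cases "(1/2 - 1/(2 * 10^70)) * n^4 \<le> 24 * real (card (quads V Ed {}))")
      case True
      from improve[OF Ed' n(2) True] show ?thesis
      proof (elim disjE exE conjE)
        fix Ed' assume E': "\<forall>e\<in>Ed'. e \<subseteq> V \<and> card e = 2"
          "real (card (quads V Ed {})) + 1/(48 * 10^70) * n^2 * real (card (sym_diff Ed Ed')) < real (card (quads V Ed' {}))"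
        have "1/(200 * 10^70) * n^2 * real (card (sym_diff Ed Ed')) \<le> 1/(48 * 10^70) * n^2 * real (card (sym_diff Ed Ed'))"
          unfolding c using \<epsilon> by (intro mult_right_mono) auto
        then have "real (card (quads V Ed {})) + 1/(200 * 10^70) * n^2 * real (card (sym_diff Ed Ed')) < real (card (quads V Ed' {}))"
          using E'(2) by linarith
        with E'(1) show ?thesis by (intro disjI2 exI[of _ Ed'] conjI)
      next
        fix f :: "'v \<Rightarrow> nat" assume "\<forall>x. f x < 6" "\<forall>u\<in>V. \<forall>v\<in>V. adj Ed u v = pat (f u) (f v)"
        then show ?thesis by (intro disjI1 exI[of _ f] conjI)
      qed
    next
      case False
      obtain Ed' where E': "\<forall>e\<in>Ed'. e \<subseteq> V \<and> card e = 2" "dens (adj Ed') V (unif V) = bal_dens (card V)"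
        by (rule balanced_blowup[OF V(1) V_ne])
      interpret H: vgraph V Ed' by unfold_locales (use V V_ne E' in auto)
      have "1/2 - \<epsilon>/4 \<le> 24 * real (card (quads V Ed' {})) / n^4"
        using H.dens_le_quads n(1) E'(2) by linarith
      then have 1: "(1/2 - \<epsilon>/4) * n^4 \<le> 24 * real (card (quads V Ed' {}))"
        using n4 by (simp only: pos_le_divide_eq)
      have 2: "24 * real (card (quads V Ed {})) < (1/2 - \<epsilon>/2) * n^4" using False unfolding c by simp
      have "sym_diff Ed Ed' \<subseteq> (\<lambda>(x, y). {x, y}) ` (V \<times> V)"
      proof
        fix e assume "e \<in> sym_diff Ed Ed'"
        then have "e \<subseteq> V" "card e = 2" using Ed E'(1) by auto
        then show "e \<in> (\<lambda>(x, y). {x, y}) ` (V \<times> V)" by (auto simp: card_2_iff)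
      qed
      then have "card (sym_diff Ed Ed') \<le> card ((\<lambda>(x, y). {x, y}) ` (V \<times> V))" using V(1) by (intro card_mono) auto
      also have "\<dots> \<le> card (V \<times> V)" using V(1) by (intro card_image_le) auto
      also have "\<dots> = card V * card V" by (rule card_cartesian_product)
      finally have "real (card (sym_diff Ed Ed')) \<le> real (card V * card V)" by (simp only: of_nat_le_iff)
      then have "real (card (sym_diff Ed Ed')) \<le> n^2" by (simp add: power2_eq_square)
      then have "\<epsilon>/200 * n^2 * real (card (sym_diff Ed Ed')) \<le> \<epsilon>/200 * n^2 * n^2"
        using \<epsilon> by (intro mult_left_mono) auto
      then have 3: "\<epsilon>/200 * n^2 * real (card (sym_diff Ed Ed')) \<le> \<epsilon>/200 * n^4" by (simp add: power2_eq_square power4_eq_xxxx mult_ac)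
      have "0 < \<epsilon> * n^4" using \<epsilon> n4 by simp
      then have "real (card (quads V Ed {})) + \<epsilon>/200 * n^2 * real (card (sym_diff Ed Ed')) < real (card (quads V Ed' {}))"
        using 1 2 3 unfolding left_diff_distrib by simp
      then show ?thesis unfolding c using E'(1) by (intro disjI2 exI[of _ Ed'] conjI)
    qed
  qed
qed

lemma edit_distance_blowups_le:
  fixes V :: "nat set"
  assumes "(V, Ed') \<in> blowups B"
  shows "edit_distance_blowups (V, Ed) B \<le> card (sym_diff Ed Ed')"
proof -
  have "edit_distance_blowups (V, Ed) B \<le> edit_distance (V, Ed) (V, Ed')"
    unfolding edit_distance_blowups_def by (rule cInf_lower) (use assms in force)+
  also have "\<dots> \<le> card (sym_diff (edges (V, Ed)) ((`) id ` edges (V, Ed')))"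
    unfolding edit_distance_def by (rule cInf_lower) (auto intro!: exI[of _ id])
  also have "\<dots> = card (sym_diff Ed Ed')" by simp
  finally show ?thesis .
qed

lemma perfectly_stable_two_K3: "perfectly_stable 4 2 two_K3"
proof -
  define c where "c = (1/(200 * 10^70) :: real)"
  have c: "0 < c" by (simp add: c_def)
  obtain N where N: "\<forall>(V :: nat set) Ed. finite V \<and> N \<le> card V \<and> (\<forall>e\<in>Ed. e \<subseteq> V \<and> card e = 2) \<longrightarrow>
    (\<exists>f. (\<forall>x. f x < (6::nat)) \<and> (\<forall>u\<in>V. \<forall>v\<in>V. adj Ed u v = pat (f u) (f v))) \<or>
    (\<exists>Ed'. (\<forall>e\<in>Ed'. e \<subseteq> V \<and> card e = 2) \<and>
       real (card (quads V Ed {})) + c * real (card V)^2 * real (card (sym_diff Ed Ed')) < real (card (quads V Ed' {})))"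
    using exists_better_or_blowup[where 'v = nat, folded c_def] by (elim exE) (rule that)
  \<comment> \<open>The stability constant proper is 1/c; \<open>N\<close> is the threshold for the
    three moves, and 4 makes the binomial coefficient positive.\<close>
  define K where "K = max (1/c) (real (max N 4))"
  have K: "1/c \<le> K" "real N \<le> K" "4 \<le> K" "0 < K" by (auto simp: K_def)
  have "real (edit_distance_blowups (V, Ed) two_K3)
          \<le> K * (max_ind_density 4 2 (card V) - ind_density 4 2 (V, Ed)) * real (card V) ^ 2"
    if G: "simple_graph (V, Ed)" "K \<le> real (card V)" for V :: "nat set" and Ed
  proof -
    have V: "finite V" "N \<le> card V" "4 \<le> card V" and Ed: "\<forall>e\<in>Ed. e \<subseteq> V \<and> card e = 2"
      using G K by (auto simp: simple_graph_iff)
    have V_ne: "V \<noteq> {}" using V(3) by auto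
    let ?n = "real (card V)"
    define X where "X = {X. X \<subseteq> {e. e \<subseteq> V \<and> card e = 2}}"
    define \<Phi> where "\<Phi> X = real (card (quads V X {})) - c * ?n^2 * real (card (sym_diff Ed X))" for X
    have finV2: "finite {e. e \<subseteq> V \<and> card e = 2}" using V(1) by (auto intro: finite_subset[of _ "Pow V"])
    then have finX: "finite X" unfolding X_def by (simp add: Pow_def[symmetric])
    have EdX: "Ed \<in> X" using Ed by (auto simp: X_def)
    obtain H where H: "H \<in> X" "\<Phi> H = Max (\<Phi> ` X)"
    proof -
      have "Max (\<Phi> ` X) \<in> \<Phi> ` X" using finX EdX by (intro Max_in) auto
      then show ?thesis by (elim imageE) (rule that, simp_all)
    qed
    have H_max: "\<Phi> Y \<le> \<Phi> H" if "Y \<in> X" for Y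
      unfolding H(2) using finX that by (intro Max_ge) auto
    have HV: "\<forall>e\<in>H. e \<subseteq> V \<and> card e = 2" using H(1) by (auto simp: X_def)
    have "\<exists>f. (\<forall>x. f x < (6::nat)) \<and> (\<forall>u\<in>V. \<forall>v\<in>V. adj H u v = pat (f u) (f v))"
    proof (rule ccontr)
      assume "\<not> ?thesis"
      then obtain H' where H': "\<forall>e\<in>H'. e \<subseteq> V \<and> card e = 2"
        "real (card (quads V H {})) + c * ?n^2 * real (card (sym_diff H H')) < real (card (quads V H' {}))"
        using N[THEN spec, THEN spec, THEN mp, OF conjI[OF V(1) conjI[OF V(2) HV]]] by blast
      have H'X: "H' \<in> X" using H'(1) by (auto simp: X_def)
      have fin: "finite Y" if "Y \<in> X" for Y using that finV2 unfolding X_def by (auto intro: finite_subset)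
      \<comment> \<open>The penalty in \<Phi> is measured from \<open>Ed\<close>. By the triangle
        inequality for symmetric differences, a move from \<open>H\<close> that pays for its own
        edits therefore still raises \<Phi>.\<close>
      have "card (sym_diff Ed H') \<le> card (sym_diff Ed H \<union> sym_diff H H')"
        using fin[OF EdX] fin[OF H(1)] fin[OF H'X] by (intro card_mono) auto
      also have "\<dots> \<le> card (sym_diff Ed H) + card (sym_diff H H')" by (rule card_Un_le)
      finally have "real (card (sym_diff Ed H')) \<le> real (card (sym_diff Ed H)) + real (card (sym_diff H H'))" by linarith
      then have "c * ?n^2 * real (card (sym_diff Ed H')) \<le> c * ?n^2 * (real (card (sym_diff Ed H)) + real (card (sym_diff H H')))"
        using c by (intro mult_left_mono) auto
      then have "\<Phi> H < \<Phi> H'" using H'(2) unfolding \<Phi>_def distrib_left by linarith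
      then show False using H_max[OF H'X] by linarith
    qed
    then obtain f where f: "\<And>x. f x < (6::nat)" "\<And>u v. u \<in> V \<Longrightarrow> v \<in> V \<Longrightarrow> adj H u v = pat (f u) (f v)" by blast
    interpret G: vgraph V Ed by unfold_locales (use V V_ne Ed in auto)
    interpret H: vgraph V H by unfold_locales (use V V_ne HV in auto)
    let ?C = "real (card V choose 4)"
    have C: "0 < ?C" using V(3) by simp
    have C4: "?C \<le> ?n^4"
    proof -
      have "card V choose 4 \<le> card V ^ 4" using V(3) by (intro binomial_le_pow)
      then have "?C \<le> real (card V ^ 4)" by (simp only: of_nat_le_iff)
      then show ?thesis by simp
    qed
    \<comment> \<open>Comparison with \<open>Ed\<close> itself, whose penalty is 0: the gain of
      \<open>H\<close> pays for its distance from \<open>Ed\<close>.\<close>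
    have "c * ?n^2 * real (card (sym_diff Ed H)) \<le> real (card (quads V H {})) - real (card (quads V Ed {}))"
      using H_max[OF EdX] by (simp add: \<Phi>_def)
    also have "\<dots> = (ind_density 4 2 (V, H) - ind_density 4 2 (V, Ed)) * ?C"
      using C by (simp add: G.ind_density_eq H.ind_density_eq left_diff_distrib)
    also have "\<dots> \<le> (max_ind_density 4 2 (card V) - ind_density 4 2 (V, Ed)) * ?C"
      using ind_density_le_max[of V H 4 2] HV V C by (intro mult_right_mono) (auto simp: simple_graph_iff)
    also have "\<dots> \<le> (max_ind_density 4 2 (card V) - ind_density 4 2 (V, Ed)) * ?n^4"
      using ind_density_le_max[OF G(1), of 4 2] C4 by (intro mult_left_mono) auto
    finally have "?n^2 * (c * real (card (sym_diff Ed H))) \<le> ?n^2 * ((max_ind_density 4 2 (card V) - ind_density 4 2 (V, Ed)) * ?n^2)"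
      by (simp add: power2_eq_square power4_eq_xxxx mult_ac)
    moreover have "0 < ?n^2" using V(3) by auto
    ultimately have "c * real (card (sym_diff Ed H)) \<le> (max_ind_density 4 2 (card V) - ind_density 4 2 (V, Ed)) * ?n^2"
      by (simp only: mult_le_cancel_left_pos)
    then have "real (card (sym_diff Ed H)) \<le> 1/c * ((max_ind_density 4 2 (card V) - ind_density 4 2 (V, Ed)) * ?n^2)"
      using c by (simp add: field_simps)
    also have "\<dots> \<le> K * ((max_ind_density 4 2 (card V) - ind_density 4 2 (V, Ed)) * ?n^2)"
      using K(1) ind_density_le_max[OF G(1), of 4 2] by (intro mult_right_mono) auto
    finally have "real (card (sym_diff Ed H)) \<le> K * ((max_ind_density 4 2 (card V) - ind_density 4 2 (V, Ed)) * ?n^2)" .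
    moreover have "edit_distance_blowups (V, Ed) two_K3 \<le> card (sym_diff Ed H)"
      by (rule edit_distance_blowups_le[OF in_blowups[OF V(1) HV f]])
    ultimately show ?thesis by (simp add: mult.assoc)
  qed
  then show ?thesis unfolding perfectly_stable_def using K(4) by (intro exI[of _ K]) auto
qed

section \<open>Densities along sequences of blowups\<close>

lemma blowup_ind_density_bounds:
  fixes P :: "nat \<Rightarrow> 'v set"
  assumes P: "valid_parts two_K3 P" and m: "m = (\<Sum>i<6. card (P i))" "0 < m"
  shows "(pat_dens (\<lambda>i. real (card (P i)) / real m) - 6 / real m) * ratio4 m \<le> ind_density 4 2 (blowup two_K3 P)"
    and "ind_density 4 2 (blowup two_K3 P) \<le> pat_dens (\<lambda>i. real (card (P i)) / real m) * ratio4 m"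
proof -
  obtain V Ed f where B: "blowup two_K3 P = (V, Ed)" and fin: "finite V" and Ed: "\<forall>e\<in>Ed. e \<subseteq> V \<and> card e = 2"
    and f: "\<And>x. f x < 6" and parts: "\<And>i. i < 6 \<Longrightarrow> {v \<in> V. f v = i} = P i"
    and a: "\<And>u v. u \<in> V \<Longrightarrow> v \<in> V \<Longrightarrow> adj Ed u v = pat (f u) (f v)"
    by (rule blowup_two_K3[OF P]) (rule that)
  have mV: "card V = m"
  proof -
    have "V = (\<Union>i\<in>{..<6}. {v \<in> V. f v = i})" using f by auto
    then have "card V = card (\<Union>i\<in>{..<6}. {v \<in> V. f v = i})" by (rule arg_cong)
    also have "\<dots> = (\<Sum>i<6. card {v \<in> V. f v = i})" using fin by (intro card_UN_disjoint) auto
    also have "\<dots> = (\<Sum>i<6. card (P i))" by (intro sum.cong) (simp_all add: parts)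
    finally show ?thesis using m(1) by simp
  qed
  have "V \<noteq> {}" using mV m(2) by auto
  interpret vgraph V Ed by unfold_locales (use fin Ed \<open>V \<noteq> {}\<close> in auto)
  have "pat_dens (\<lambda>i. real (card {v \<in> V. f v = i}) / n) = pat_dens (\<lambda>i. real (card (P i)) / real m)"
    unfolding pat_dens_eq mV by (intro sum.cong refl arg_cong2[where f = times]) (simp_all add: parts)
  then have d: "dens (adj Ed) V (unif V) = pat_dens (\<lambda>i. real (card (P i)) / real m)"
    using dens_eq_pat_dens[OF f a] by (rule trans[rotated])
  have 1: "pat_dens (\<lambda>i. real (card (P i)) / real m) - 6 / n \<le> 24 * real (card (quads V Ed {})) / n^4"
    using dens_le_quads unfolding d by linarith
  have 2: "24 * real (card (quads V Ed {})) / n^4 \<le> pat_dens (\<lambda>i. real (card (P i)) / real m)"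
    using quads_le_dens unfolding d .
  show "(pat_dens (\<lambda>i. real (card (P i)) / real m) - 6 / real m) * ratio4 m \<le> ind_density 4 2 (blowup two_K3 P)"
    using mult_right_mono[OF 1 ratio4_nonneg] unfolding B ind_density_ratio mV .
  show "ind_density 4 2 (blowup two_K3 P) \<le> pat_dens (\<lambda>i. real (card (P i)) / real m) * ratio4 m"
    using mult_right_mono[OF 2 ratio4_nonneg] unfolding B ind_density_ratio mV .
qed

text \<open>The index \<open>n\<close> is only asymptotic to the order \<open>m n\<close> of the
  blowup, so the parts are renormalised by \<open>m n\<close> before the exact polynomial is
  used.\<close>

lemma blowup_ind_density_tendsto:
  fixes P :: "nat \<Rightarrow> nat \<Rightarrow> nat set"
  assumes x: "x \<in> std_simplex 6" and P: "\<And>n. valid_parts two_K3 (P n)"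
    and lim: "\<And>i. i < 6 \<Longrightarrow> (\<lambda>n. real (card (P n i)) / real n) \<longlonglongrightarrow> x i"
  shows "(\<lambda>n. ind_density 4 2 (blowup two_K3 (P n))) \<longlonglongrightarrow> pat_dens x"
proof -
  define m where "m n = (\<Sum>i<6. card (P n i))" for n
  define s where "s n i = real (card (P n i)) / real (m n)" for n i
  have "(\<lambda>n. \<Sum>i<6. real (card (P n i)) / real n) \<longlonglongrightarrow> (\<Sum>i<6. x i)"
    by (intro tendsto_sum lim) auto
  then have m1: "(\<lambda>n. real (m n) / real n) \<longlonglongrightarrow> 1"
    using x by (simp add: m_def sum_divide_distrib std_simplex_def)
  have m_top: "filterlim m at_top sequentially"
  proof -
    have "filterlim (\<lambda>n. real (m n) / real n * real n) at_top sequentially"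
      by (rule filterlim_tendsto_pos_mult_at_top[OF m1 _ filterlim_real_sequentially]) simp
    moreover have ev: "eventually (\<lambda>n. real (m n) / real n * real n = real (m n)) sequentially"
      using eventually_gt_at_top[of 0] by eventually_elim simp
    ultimately have top: "filterlim (\<lambda>n. real (m n)) at_top sequentially"
      by (simp only: filterlim_cong[OF refl refl ev])
    show ?thesis
      unfolding filterlim_at_top
    proof
      fix Z
      have "eventually (\<lambda>n. real Z \<le> real (m n)) sequentially"
        using top unfolding filterlim_at_top by (rule spec)
      then show "eventually (\<lambda>n. Z \<le> m n) sequentially" by (simp only: of_nat_le_iff)
    qed
  qed
  have s_lim: "(\<lambda>n. s n i) \<longlonglongrightarrow> x i" if "i < 6" for i
  proof -
    have "(\<lambda>n. real (card (P n i)) / real n / (real (m n) / real n)) \<longlonglongrightarrow> x i / 1"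
      by (intro tendsto_divide lim m1 that) simp
    moreover have ev: "eventually (\<lambda>n. real (card (P n i)) / real n / (real (m n) / real n) = s n i) sequentially"
      using eventually_gt_at_top[of 0] by eventually_elim (simp add: s_def)
    ultimately show ?thesis by (simp only: tendsto_cong[OF ev] div_by_1)
  qed
  have D: "(\<lambda>n. pat_dens (s n)) \<longlonglongrightarrow> pat_dens x" by (intro tendsto_pat_dens s_lim)
  have r: "(\<lambda>n. ratio4 (m n)) \<longlonglongrightarrow> 1" by (rule filterlim_compose[OF ratio4_tendsto m_top])
  have i0: "(\<lambda>n. 6 / real (m n)) \<longlonglongrightarrow> 0"
    by (rule filterlim_compose[OF _ m_top, of "\<lambda>n. 6 / real n"]) real_asymp
  have pos: "eventually (\<lambda>n. 0 < m n) sequentially"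
  proof -
    have "eventually (\<lambda>n. Suc 0 \<le> m n) sequentially"
      using m_top unfolding filterlim_at_top by (rule spec)
    then show ?thesis by (simp only: Suc_le_eq)
  qed
  have L: "(\<lambda>n. (pat_dens (s n) - 6 / real (m n)) * ratio4 (m n)) \<longlonglongrightarrow> (pat_dens x - 0) * 1"
    by (intro tendsto_intros D i0 r)
  have U: "(\<lambda>n. pat_dens (s n) * ratio4 (m n)) \<longlonglongrightarrow> pat_dens x * 1"
    by (intro tendsto_intros D r)
  show ?thesis
  proof (rule real_tendsto_sandwich)
    show "(\<lambda>n. (pat_dens (s n) - 6 / real (m n)) * ratio4 (m n)) \<longlonglongrightarrow> pat_dens x" using L by simp
    show "(\<lambda>n. pat_dens (s n) * ratio4 (m n)) \<longlonglongrightarrow> pat_dens x" using U by simp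
    show "eventually (\<lambda>n. (pat_dens (s n) - 6 / real (m n)) * ratio4 (m n) \<le> ind_density 4 2 (blowup two_K3 (P n))) sequentially"
      using pos
    proof eventually_elim
      case (elim n)
      show ?case unfolding s_def[abs_def] by (rule blowup_ind_density_bounds(1)[OF P m_def elim])
    qed
    show "eventually (\<lambda>n. ind_density 4 2 (blowup two_K3 (P n)) \<le> pat_dens (s n) * ratio4 (m n)) sequentially"
      using pos
    proof eventually_elim
      case (elim n)
      show ?case unfolding s_def[abs_def] by (rule blowup_ind_density_bounds(2)[OF P m_def elim])
    qed
  qed
qed

lemma blowup_density_two_K3:
  assumes x: "x \<in> std_simplex 6"
  shows "blowup_density 4 2 two_K3 x = pat_dens x"
  unfolding blowup_density_def
proof (rule the_equality)
  have vs: "verts two_K3 = {..<6}" by (simp add: two_K3_def)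
  show "\<forall>V. (\<forall>n. valid_parts two_K3 (V n)) \<and> (\<forall>i\<in>verts two_K3. (\<lambda>n. real (card (V n i)) / real n) \<longlonglongrightarrow> x i) \<longrightarrow>
      (\<lambda>n. ind_density 4 2 (blowup two_K3 (V n :: nat \<Rightarrow> nat set))) \<longlonglongrightarrow> pat_dens x"
    using blowup_ind_density_tendsto[OF x] by (simp add: vs)
  fix L
  assume L: "\<forall>V. (\<forall>n. valid_parts two_K3 (V n)) \<and> (\<forall>i\<in>verts two_K3. (\<lambda>n. real (card (V n i)) / real n) \<longlonglongrightarrow> x i) \<longrightarrow>
      (\<lambda>n. ind_density 4 2 (blowup two_K3 (V n :: nat \<Rightarrow> nat set))) \<longlonglongrightarrow> L"
  \<comment> \<open>Uniqueness of the limit requires at least one admissible sequence for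
    \<open>x\<close>; residues modulo 6 keep its parts disjoint.\<close>
  define P where "P n i = (\<lambda>k. 6 * k + i) ` {..<nat \<lfloor>x i * real n\<rfloor>}" for n i :: nat
  have valid: "valid_parts two_K3 (P n)" for n
  proof -
    have "P n i \<inter> P n j = {}" if "i < 6" "j < 6" "i \<noteq> j" for i j
    proof -
      have "(6 * k + i) mod 6 = i" "(6 * k + j) mod 6 = j" for k using that by simp_all
      then show ?thesis unfolding P_def using that(3) by (metis (no_types, lifting) disjoint_iff imageE)
    qed
    then show ?thesis by (auto simp: valid_parts_def vs disjoint_family_on_def P_def)
  qed
  have lim: "(\<lambda>n. real (card (P n i)) / real n) \<longlonglongrightarrow> x i" if "i < 6" for i
  proof -
    have x0: "0 \<le> x i" using x that by (auto simp: std_simplex_def)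
    have "card (P n i) = nat \<lfloor>x i * real n\<rfloor>" for n
      unfolding P_def by (subst card_image) (auto simp: inj_on_def)
    moreover have "(\<lambda>n. real (nat \<lfloor>x i * real n\<rfloor>) / real n) \<longlonglongrightarrow> x i"
    proof (rule real_tendsto_sandwich)
      show "eventually (\<lambda>n. (x i * real n - 1) / real n \<le> real (nat \<lfloor>x i * real n\<rfloor>) / real n) sequentially"
        by (intro always_eventually allI divide_right_mono) linarith+
      show "eventually (\<lambda>n. real (nat \<lfloor>x i * real n\<rfloor>) / real n \<le> x i * real n / real n) sequentially"
        using x0 by (intro always_eventually allI divide_right_mono of_nat_floor) auto
      show "(\<lambda>n. (x i * real n - 1) / real n) \<longlonglongrightarrow> x i" by real_asymp
      show "(\<lambda>n. x i * real n / real n) \<longlonglongrightarrow> x i" by real_asymp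
    qed
    ultimately show ?thesis by simp
  qed
  have "(\<lambda>n. ind_density 4 2 (blowup two_K3 (P n))) \<longlonglongrightarrow> L" using L valid lim by (simp add: vs)
  moreover have "(\<lambda>n. ind_density 4 2 (blowup two_K3 (P n))) \<longlonglongrightarrow> pat_dens x"
    by (rule blowup_ind_density_tendsto[OF x valid lim])
  ultimately show "L = pat_dens x" by (rule LIMSEQ_unique)
qed

lemma maximizers_two_K3: "maximizers 4 2 two_K3 = {\<lambda>i. if i < 6 then 1/6 else 0}"
proof -
  let ?u = "\<lambda>i::nat. if i < 6 then 1/6 else (0::real)"
  have vs: "card (verts two_K3) = 6" by (simp add: two_K3_def)
  have u: "?u \<in> std_simplex 6" by (simp add: std_simplex_def)
  have "pat_dens ?u = pat_dens (\<lambda>i. 1/6)" by (simp add: pat_dens_eq)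
  then have du: "pat_dens ?u = 1/2" by (simp only: pat_dens_uniform)
  show ?thesis
  proof (intro set_eqI iffI)
    fix x assume "x \<in> maximizers 4 2 two_K3"
    then have x: "x \<in> std_simplex 6" and "\<forall>y\<in>std_simplex 6. blowup_density 4 2 two_K3 y \<le> blowup_density 4 2 two_K3 x"
      by (auto simp: maximizers_def vs)
    then have "pat_dens ?u \<le> pat_dens x" using u by (simp add: blowup_density_two_K3)
    then have "pat_dens x = 1/2" using pat_dens_le(1)[OF x] du by linarith
    then have "x i = 1/6" if "i < 6" for i using pat_dens_le(2)[OF x] that by blast
    moreover have "x i = 0" if "\<not> i < 6" for i using x that by (auto simp: std_simplex_def)
    ultimately have "x = ?u" by (intro ext) simp
    then show "x \<in> {?u}" by simp
  next
    fix x assume "x \<in> {?u}"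
    then have "x = ?u" by simp
    moreover have "\<forall>y\<in>std_simplex 6. pat_dens y \<le> pat_dens ?u" unfolding du using pat_dens_le(1) by blast
    ultimately show "x \<in> maximizers 4 2 two_K3"
      using u by (simp add: maximizers_def vs blowup_density_two_K3)
  qed
qed

theorem theorem3p1:
  shows "convergent (max_ind_density 4 2) \<and> edge_inducibility 4 2 = 1/2
    \<and> perfectly_stable 4 2 two_K3
    \<and> maximizers 4 2 two_K3 = {\<lambda>i. if i < 6 then 1/6 else 0}"
  using max_ind_density_tendsto perfectly_stable_two_K3 maximizers_two_K3
  by (auto simp: edge_inducibility_def convergent_def limI[OF max_ind_density_tendsto])

end
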